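(* Let $p$ be an odd prime, let $k$ be a natural number, and let $E$ be an elementary abelian $p$-subgroup of $\mathfrak{S}_{kp}$. Let $F$ be an algebraically closed field of characteristic $p$. If either (i) $E$ has at least two orbits of size $p$ on $\{1,\ldots,kp\}$, or (ii) $E$ has at least one orbit of size $p^2$ on $\{1,\ldots,kp\}$, then $E$ is contained in a vertex of the Specht module $S^{(kp-p,1^p)}$ defined over $F$.
   Context: $\mathfrak{S}_n$ is the symmetric group on $\{1,\ldots,n\}$. For a partition $\lambda$ of $n$, $S^\lambda$ is the Specht module for $F\mathfrak{S}_n$ labelled by $\lambda$ as defined by James (the submodule of the permutation module on $\lambda$-tabloids spanned by the polytabloids); $(kp-p,1^p)$ is the hook partition of $kp$ with first part $kp-p$ followed by $p$ parts equal to $1$. In odd characteristic Specht modules are always indecomposable. Let $G$ be a finite group and $M$ an indecomposable $FG$-module. A subgroup $Q \le G$ is a vertex of $M$ if there is an $FQ$-module $U$ such that $M$ is a direct summand of the induced module $U\uparrow^G$, and $Q$ is minimal with this property. The vertices of $M$ form a single conjugacy class of $p$-subgroups of $G$. *)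

theory Defs
  imports
    "HOL-Algebra.Sym_Groups"
    "HOL-Algebra.Group_Action"
    "HOL-Computational_Algebra.Computational_Algebra"
    "HOL-Library.Function_Algebras"
begin

section \<open>Modules for group algebras\<close>

text \<open>
  An \<open>FG\<close>-module is a finite-dimensional vector space over the field \<open>'f\<close> (the type of scalars)
  with a linear action of \<open>G\<close>. Its vectors form a subspace \<open>fg_space\<close> of an ambient vector space
  whose carrier is the whole type \<open>'v\<close>; the scalar multiplication of the ambient space is
  \<open>fg_scale\<close> and its addition is that of the type class. Values of \<open>fg_act\<close> outside
  \<open>carrier G\<close> and \<open>fg_space\<close> are irrelevant.
\<close>

record ('f, 'g, 'v) fg =
  fg_space :: "'v set"
  fg_scale :: "'f \<Rightarrow> 'v \<Rightarrow> 'v"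
  fg_act :: "'g \<Rightarrow> 'v \<Rightarrow> 'v"

definition fg_module :: "'g monoid \<Rightarrow> ('f::field, 'g, 'v::ab_group_add) fg \<Rightarrow> bool" where
  "fg_module G M \<longleftrightarrow>
     group G \<and>
     vector_space (fg_scale M) \<and>
     module.subspace (fg_scale M) (fg_space M) \<and>
     (\<exists>B. finite B \<and> fg_space M = module.span (fg_scale M) B) \<and>
     (\<forall>g\<in>carrier G. \<forall>v\<in>fg_space M. fg_act M g v \<in> fg_space M) \<and>
     (\<forall>g\<in>carrier G. \<forall>v\<in>fg_space M. \<forall>w\<in>fg_space M.
        fg_act M g (v + w) = fg_act M g v + fg_act M g w) \<and>
     (\<forall>g\<in>carrier G. \<forall>c. \<forall>v\<in>fg_space M.
        fg_act M g (fg_scale M c v) = fg_scale M c (fg_act M g v)) \<and>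
     (\<forall>v\<in>fg_space M. fg_act M \<one>\<^bsub>G\<^esub> v = v) \<and>
     (\<forall>g\<in>carrier G. \<forall>h\<in>carrier G. \<forall>v\<in>fg_space M.
        fg_act M (g \<otimes>\<^bsub>G\<^esub> h) v = fg_act M g (fg_act M h v))"

definition fg_submodule ::
    "'g monoid \<Rightarrow> 'v set \<Rightarrow> ('f::field, 'g, 'v::ab_group_add) fg \<Rightarrow> bool" where
  "fg_submodule G W M \<longleftrightarrow>
     W \<subseteq> fg_space M \<and>
     module.subspace (fg_scale M) W \<and>
     (\<forall>g\<in>carrier G. \<forall>w\<in>W. fg_act M g w \<in> W)"

definition fg_direct_sum ::
    "'g monoid \<Rightarrow> ('f::field, 'g, 'v::ab_group_add) fg \<Rightarrow> 'v set \<Rightarrow> 'v set \<Rightarrow> bool" where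
  "fg_direct_sum G M W W' \<longleftrightarrow>
     fg_submodule G W M \<and> fg_submodule G W' M \<and>
     W \<inter> W' = {0} \<and> fg_space M = {w + w' | w w'. w \<in> W \<and> w' \<in> W'}"

definition fg_indecomposable ::
    "'g monoid \<Rightarrow> ('f::field, 'g, 'v::ab_group_add) fg \<Rightarrow> bool" where
  "fg_indecomposable G M \<longleftrightarrow>
     fg_space M \<noteq> {0} \<and>
     (\<forall>W W'. fg_direct_sum G M W W' \<longrightarrow> W = {0} \<or> W' = {0})"

definition fg_isomorphic ::
    "'g monoid \<Rightarrow> ('f::field, 'g, 'v::ab_group_add) fg \<Rightarrow>
       ('f, 'g, 'w::ab_group_add) fg \<Rightarrow> bool" where
  "fg_isomorphic G M N \<longleftrightarrow>
     (\<exists>\<phi>. bij_betw \<phi> (fg_space M) (fg_space N) \<and>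
        (\<forall>v\<in>fg_space M. \<forall>w\<in>fg_space M. \<phi> (v + w) = \<phi> v + \<phi> w) \<and>
        (\<forall>c. \<forall>v\<in>fg_space M. \<phi> (fg_scale M c v) = fg_scale N c (\<phi> v)) \<and>
        (\<forall>g\<in>carrier G. \<forall>v\<in>fg_space M. \<phi> (fg_act M g v) = fg_act N g (\<phi> v)))"

definition fg_direct_summand ::
    "'g monoid \<Rightarrow> ('f::field, 'g, 'v::ab_group_add) fg \<Rightarrow>
       ('f, 'g, 'w::ab_group_add) fg \<Rightarrow> bool" where
  "fg_direct_summand G M N \<longleftrightarrow>
     (\<exists>W W'. fg_direct_sum G N W W' \<and> fg_isomorphic G M (N\<lparr>fg_space := W\<rparr>))"

text \<open>
  For a finite group \<open>G\<close>, a subgroup \<open>Q\<close> and an \<open>FQ\<close>-module \<open>U\<close>, the induced module is the direct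
  sum of the spaces \<open>g \<otimes> U\<close> over the left cosets \<open>g Q\<close>, where \<open>g q \<otimes> u = g \<otimes> q u\<close>.
  To avoid choosing coset representatives, the element whose component in \<open>g \<otimes> U\<close> is
  \<open>g \<otimes> f g\<close> is encoded by the function \<open>f\<close> on all of \<open>G\<close>. That this component depends only on the
  coset says \<open>f (g q) = q\<^sup>-\<^sup>1 (f g)\<close>, and \<open>x (g \<otimes> u) = x g \<otimes> u\<close> becomes \<open>(x f) g = f (x\<^sup>-\<^sup>1 g)\<close>.
  Functions are set to \<open>0\<close> outside \<open>carrier G\<close> so that each element is encoded only once.
\<close>

definition fg_induced ::
    "'g monoid \<Rightarrow> 'g set \<Rightarrow> ('f, 'g, 'v::ab_group_add) fg \<Rightarrow> ('f, 'g, 'g \<Rightarrow> 'v) fg" where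
  "fg_induced G Q U =
     \<lparr>fg_space = {f. (\<forall>g\<in>carrier G. f g \<in> fg_space U) \<and> (\<forall>g. g \<notin> carrier G \<longrightarrow> f g = 0) \<and>
                     (\<forall>g\<in>carrier G. \<forall>q\<in>Q. f (g \<otimes>\<^bsub>G\<^esub> q) = fg_act U (inv\<^bsub>G\<^esub> q) (f g))},
      fg_scale = (\<lambda>c f g. fg_scale U c (f g)),
      fg_act = (\<lambda>x f g. if g \<in> carrier G then f (inv\<^bsub>G\<^esub> x \<otimes>\<^bsub>G\<^esub> g) else 0)\<rparr>"

text \<open>
  The module \<open>U\<close> ranges over modules realised on subspaces of a vector space with carrier type
  \<open>nat \<Rightarrow> 'f\<close>; every finite-dimensional module is isomorphic to one of these.
\<close>

definition fg_relatively_projective ::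
    "'g monoid \<Rightarrow> 'g set \<Rightarrow> ('f::field, 'g, 'v::ab_group_add) fg \<Rightarrow> bool" where
  "fg_relatively_projective G Q M \<longleftrightarrow>
     (\<exists>U :: ('f, 'g, nat \<Rightarrow> 'f) fg.
        fg_module (G\<lparr>carrier := Q\<rparr>) U \<and> fg_direct_summand G M (fg_induced G Q U))"

definition is_vertex ::
    "'g monoid \<Rightarrow> ('f::field, 'g, 'v::ab_group_add) fg \<Rightarrow> 'g set \<Rightarrow> bool" where
  "is_vertex G M Q \<longleftrightarrow>
     fg_module G M \<and> fg_indecomposable G M \<and>
     subgroup Q G \<and> fg_relatively_projective G Q M \<and>
     (\<forall>R. subgroup R G \<and> R \<subset> Q \<longrightarrow> \<not> fg_relatively_projective G R M)"


section \<open>Specht modules\<close>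

text \<open>
  A partition is the list of its parts. Boxes \<open>(i, j)\<close> of the Young diagram (row \<open>i\<close>, column \<open>j\<close>)
  are counted from \<open>0\<close>. A tableau takes the value \<open>0\<close> outside the diagram; since \<open>0\<close> is fixed by
  all permutations of \<open>{1..n}\<close>, these act on tableaux by composition.
\<close>

definition diagram :: "nat list \<Rightarrow> (nat \<times> nat) set" where
  "diagram lam = {(i, j). i < length lam \<and> j < lam ! i}"

definition tableau :: "nat list \<Rightarrow> (nat \<times> nat \<Rightarrow> nat) \<Rightarrow> bool" where
  "tableau lam t \<longleftrightarrow>
     bij_betw t (diagram lam) {1..sum_list lam} \<and> (\<forall>b. b \<notin> diagram lam \<longrightarrow> t b = 0)"

definition row_stabilizer :: "nat list \<Rightarrow> (nat \<times> nat \<Rightarrow> nat) \<Rightarrow> (nat \<Rightarrow> nat) set" where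
  "row_stabilizer lam t =
     {\<pi>. \<pi> permutes {1..sum_list lam} \<and>
         (\<forall>(i, j)\<in>diagram lam. \<exists>j'. (i, j') \<in> diagram lam \<and> \<pi> (t (i, j)) = t (i, j'))}"

definition column_stabilizer :: "nat list \<Rightarrow> (nat \<times> nat \<Rightarrow> nat) \<Rightarrow> (nat \<Rightarrow> nat) set" where
  "column_stabilizer lam t =
     {\<pi>. \<pi> permutes {1..sum_list lam} \<and>
         (\<forall>(i, j)\<in>diagram lam. \<exists>i'. (i', j) \<in> diagram lam \<and> \<pi> (t (i, j)) = t (i', j))}"

text \<open>A tabloid is a row-equivalence class of tableaux.\<close>

type_synonym tabl = "(nat \<times> nat \<Rightarrow> nat) set"

definition tabloid :: "nat list \<Rightarrow> (nat \<times> nat \<Rightarrow> nat) \<Rightarrow> tabl" where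
  "tabloid lam t = {\<pi> \<circ> t | \<pi>. \<pi> \<in> row_stabilizer lam t}"

definition tabloids :: "nat list \<Rightarrow> tabl set" where
  "tabloids lam = {tabloid lam t | t. tableau lam t}"

definition act_tabloid :: "(nat \<Rightarrow> nat) \<Rightarrow> tabl \<Rightarrow> tabl" where
  "act_tabloid \<pi> T = (\<lambda>t. \<pi> \<circ> t) ` T"

text \<open>
  The permutation module on tabloids: a formal linear combination of tabloids is the function
  giving its coefficients, so that \<open>(\<pi> v) T = v (\<pi>\<^sup>-\<^sup>1 T)\<close>.
\<close>

definition tabloid_module :: "nat list \<Rightarrow> ('f::field, nat \<Rightarrow> nat, tabl \<Rightarrow> 'f) fg" where
  "tabloid_module lam =
     \<lparr>fg_space = {v. \<forall>T. T \<notin> tabloids lam \<longrightarrow> v T = 0},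
      fg_scale = (\<lambda>c v T. c * v T),
      fg_act = (\<lambda>\<pi> v T. v (act_tabloid (Hilbert_Choice.inv \<pi>) T))\<rparr>"

definition tabloid_vec :: "tabl \<Rightarrow> (tabl \<Rightarrow> 'f::field)" where
  "tabloid_vec T = (\<lambda>T'. if T' = T then 1 else 0)"

definition polytabloid :: "nat list \<Rightarrow> (nat \<times> nat \<Rightarrow> nat) \<Rightarrow> (tabl \<Rightarrow> 'f::field)" where
  "polytabloid lam t =
     (\<Sum>\<pi>\<in>column_stabilizer lam t.
        (\<lambda>T. of_int (sign \<pi>) * tabloid_vec (act_tabloid \<pi> (tabloid lam t)) T))"

definition specht_module :: "nat list \<Rightarrow> ('f::field, nat \<Rightarrow> nat, tabl \<Rightarrow> 'f) fg" where
  "specht_module lam =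
     (tabloid_module lam)
       \<lparr>fg_space := module.span (fg_scale (tabloid_module lam :: ('f, nat \<Rightarrow> nat, tabl \<Rightarrow> 'f) fg))
                     {polytabloid lam t | t. tableau lam t}\<rparr>"


section \<open>Elementary abelian subgroups\<close>

definition elementary_abelian_subgroup :: "nat \<Rightarrow> 'g set \<Rightarrow> 'g monoid \<Rightarrow> bool" where
  "elementary_abelian_subgroup p E G \<longleftrightarrow>
     subgroup E G \<and> comm_group (G\<lparr>carrier := E\<rparr>) \<and> (\<forall>x\<in>E. x [^]\<^bsub>G\<^esub> p = \<one>\<^bsub>G\<^esub>)"

text \<open>The orbits on \<open>{1..n}\<close> of a subgroup \<open>E\<close> of the symmetric group.\<close>

definition point_orbits :: "nat \<Rightarrow> (nat \<Rightarrow> nat) set \<Rightarrow> nat set set" where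
  "point_orbits n E = orbits ((sym_group n)\<lparr>carrier := E\<rparr>) {1..n} (\<lambda>\<pi>. \<pi>)"

end

theory Submission
  imports Defs "HOL-Algebra.Left_Coset"
begin

text \<open>
  Let \<open>n = k * p\<close>. The idea is to detect large subgroups of a vertex by a single number: the value of a
  linear functional \<open>\<phi>\<close> at a vector \<open>z\<close> of the Specht module.

  A module is relatively \<open>Q\<close>-projective iff its identity map is a sum of endomorphisms \<open>F y\<close>, indexed
  by the left cosets \<open>y\<close> of \<open>Q\<close> and permuted by conjugation exactly as the cosets are permuted by
  translation (Higman's criterion, in a form that chooses no coset representatives). Now let \<open>X\<close> be
  a set of commuting elements of order dividing \<open>p\<close> that fix both \<open>z\<close> and \<open>\<phi>\<close>. In \<open>\<phi> z = (\<Sum>y. \<phi> (F y z))\<close>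
  the terms are then constant on orbits of \<open>X\<close>, so in characteristic \<open>p\<close> only the cosets fixed by
  \<open>X\<close> contribute. If a further element \<open>d\<close> of order \<open>p\<close> commutes with \<open>X\<close> and fixes none of these
  cosets, they fall into \<open>d\<close>-orbits of length \<open>p\<close>, each contributing
  \<open>\<Sum>j<p. \<phi> (d\<^sup>j (f (d\<^sup>-\<^sup>j z)))\<close> for some endomorphism \<open>f\<close> that commutes with \<open>X\<close>. So if all these
  averages vanish although \<open>\<phi> z \<noteq> 0\<close>, some coset \<open>g Q\<close> is fixed by \<open>X\<close> and \<open>d\<close>, which means that
  \<open>X\<close> and \<open>d\<close> lie in the conjugate \<open>g Q g\<^sup>-\<^sup>1\<close> (lemmas \<open>fixed_coset_exists\<close>, \<open>vertex_containing\<close>).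

  Over a field of characteristic not 2 the Specht module of \<open>(n - r, 1\<^sup>r)\<close> is the space of alternating
  functions of \<open>r\<close> points whose sum over each argument is zero (lemma \<open>specht_space\<close>); in other words
  it is the \<open>r\<close>-th exterior power of the functions on \<open>{1..n}\<close> with sum zero. In particular every
  exterior product of \<open>r\<close> functions with sum zero lies in it. It is indecomposable because the vectors
  on which the column group of a tableau acts by its sign form a line.

  Two orbits \<open>x\<^sub>0, \<dots>, x\<^sub>p\<^sub>-\<^sub>1\<close> and \<open>y\<^sub>0, \<dots>, y\<^sub>p\<^sub>-\<^sub>1\<close> of size \<open>p\<close>, cyclically permuted by \<open>g1\<close> and \<open>g2\<close>:
  take for \<open>z\<close> the exterior product of the \<open>x\<^sub>i - y\<^sub>i\<close>, for \<open>\<phi>\<close> the coefficient at \<open>(x\<^sub>0, \<dots>, x\<^sub>p\<^sub>-\<^sub>1)\<close>,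
  \<open>g1 \<circ> g2\<close> in \<open>X\<close> and \<open>d = g2\<^sup>-\<^sup>1\<close>. The average is the sum over \<open>j\<close> of the values of \<open>\<phi> \<circ> f\<close> at the products of
  the \<open>x\<^sub>i - y\<^sub>i\<^sub>+\<^sub>j\<close>. These are the terms with constant \<open>J\<close> in the expansion of the exterior product of
  the sums \<open>\<Sum>j. (x\<^sub>i - y\<^sub>i\<^sub>+\<^sub>j)\<close> into products of \<open>x\<^sub>i - y\<^sub>i\<^sub>+\<^sub>J\<^sub>i\<close>. A cyclic shift of \<open>J\<close> does not change
  the value, so the nonconstant \<open>J\<close> cancel modulo \<open>p\<close>; and the whole product is zero, since all of its
  factors equal minus the sum of the \<open>y\<^sub>i\<close> (lemma \<open>vertex_two_orbits\<close>).

  One orbit \<open>\<Omega>\<close> of size \<open>p\<^sup>2\<close>, with the regular action of two elements \<open>c\<close> and \<open>d\<close>: take for \<open>z\<close> the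
  exterior product of the indicator functions of the \<open>p\<close> orbits of \<open>d\<close> (their sums are \<open>p = 0\<close>), for
  \<open>\<phi>\<close> the coefficient at an orbit of \<open>c\<close>, which is a transversal of them, and \<open>c\<close> in \<open>X\<close>. The average is
  now a sum over the \<open>p\<close> translates of the transversal, and the same cyclic shift turns it into the
  value at \<open>s, c s, \<dots>, c\<^sup>p\<^sup>-\<^sup>1 s\<close>, where \<open>s\<close> is the sum of a \<open>d\<close>-orbit. One of these arguments may be
  replaced by the sum of all points of \<open>\<Omega>\<close>, hence by minus the sum of the points outside \<open>\<Omega>\<close>, and
  those cancel modulo \<open>p\<close> if \<open>X\<close> has no common fixed point among them. This can be achieved: the number
  of points fixed by \<open>E\<close> is divisible by \<open>p\<close>, so a permutation of order \<open>p\<close> that moves exactly these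
  points may be added to \<open>X\<close> (lemmas \<open>transversal_sum_zero\<close>, \<open>vertex_square_orbit\<close>).

  In both cases \<open>E\<close> is contained in the group generated by \<open>X\<close> and \<open>d\<close>, once the restrictions of the
  elements of \<open>E\<close> to the complement of the chosen orbits are added to \<open>X\<close>.
\<close>

section \<open>Sums over orbits of maps of prime order\<close>

lemma funpow_mult_fixed:
  assumes "(d ^^ m) y = y" shows "(d ^^ (m * k)) y = y"
  by (induction k) (auto simp: funpow_add assms)

lemma prime_cycle_inj:
  fixes d :: "'a \<Rightarrow> 'a"
  assumes "prime p" and per: "(d ^^ p) y = y" and "d y \<noteq> y"
  shows "inj_on (\<lambda>j. (d ^^ j) y) {..<p}"
proof (rule linorder_inj_onI')
  fix i j :: nat assume ij: "i \<in> {..<p}" "j \<in> {..<p}" "i < j"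
  show "(d ^^ i) y \<noteq> (d ^^ j) y"
  proof
    assume eq: "(d ^^ i) y = (d ^^ j) y"
    define m where "m = j - i"
    have "(d ^^ (p - i)) ((d ^^ i) y) = (d ^^ (p - i + i)) y"
      by (simp only: funpow_add o_apply)
    also have "\<dots> = y" using ij per by simp
    finally have 1: "(d ^^ (p - i)) ((d ^^ i) y) = y" .
    have "(d ^^ (p - i)) ((d ^^ j) y) = (d ^^ (p - i + j)) y"
      by (simp only: funpow_add o_apply)
    also have "p - i + j = m + p" using ij by (simp add: m_def)
    also have "(d ^^ (m + p)) y = (d ^^ m) y"
      by (simp only: funpow_add o_apply per)
    finally have dm: "(d ^^ m) y = y" using 1 eq by simp
    have m: "0 < m" "m < p" using ij by (auto simp: m_def)
    then have "\<not> p dvd m" by (simp add: nat_dvd_not_less)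
    then have "coprime m p"
      using prime_imp_coprime[OF \<open>prime p\<close>, of m] by (simp add: coprime_commute)
    moreover have "m \<noteq> 0" using m by simp
    ultimately obtain k l where "m * k = p * l + 1"
      using bezout_nat[of m p] by (metis coprime_imp_gcd_eq_1)
    then have "y = (d ^^ (p * l + 1)) y"
      using funpow_mult_fixed[OF dm, of k] by simp
    also have "\<dots> = d ((d ^^ (p * l)) y)" by simp
    also have "\<dots> = d y" using funpow_mult_fixed[OF per, of l] by simp
    finally show False using assms(3) by simp
  qed
qed

text \<open>
  The orbits of a map of prime order \<open>p\<close> have size 1 or \<open>p\<close>. Those of size \<open>p\<close> are removed one at a
  time. Assuming no more than that their sums vanish makes the lemma applicable to functions that are
  not constant on them.
\<close>

lemma sum_prime_cyclic:
  fixes d :: "'a \<Rightarrow> 'a" and a :: "'a \<Rightarrow> 'b::comm_monoid_add"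
  assumes "prime p" "finite S"
    and "\<And>y. y \<in> S \<Longrightarrow> d y \<in> S" and "\<And>y. y \<in> S \<Longrightarrow> (d ^^ p) y = y"
    and "\<And>y. y \<in> S \<Longrightarrow> d y \<noteq> y \<Longrightarrow> (\<Sum>j<p. a ((d ^^ j) y)) = 0"
  shows "sum a S = sum a {y \<in> S. d y = y}"
  using assms(2-5)
proof (induction S rule: finite_psubset_induct)
  case (psubset S)
  have dj: "(d ^^ j) y \<in> S" if "y \<in> S" for y j
    using that by (induction j) (auto simp: psubset.prems(1))
  show ?case
  proof (cases "\<exists>y\<in>S. d y \<noteq> y")
    case False
    then have "{y \<in> S. d y = y} = S" by auto
    then show ?thesis by simp
  next
    case True
    then obtain y where y: "y \<in> S" "d y \<noteq> y" by blast
    define orb where "orb = (\<lambda>j. (d ^^ j) y) ` {..<p}"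
    have p0: "p > 0" using \<open>prime p\<close> prime_gt_0_nat by blast
    have inj: "inj_on (\<lambda>j. (d ^^ j) y) {..<p}"
      by (rule prime_cycle_inj[OF \<open>prime p\<close> psubset.prems(2)[OF y(1)] y(2)])
    have sub: "orb \<subseteq> S" using dj y by (auto simp: orb_def)
    have ne: "y \<in> orb" unfolding orb_def using p0 by (intro image_eqI[of _ _ 0]) auto
    have sum0: "sum a orb = 0"
      unfolding orb_def using psubset.prems(3)[OF y] by (simp only: sum.reindex[OF inj] o_def)
    have pred: "z = (d ^^ (p - 1)) (d z)" if "z \<in> S" for z
    proof -
      have "z = (d ^^ (Suc (p - 1))) z" using psubset.prems(2)[OF that] p0 by simp
      then show ?thesis by (simp only: funpow_Suc_right o_apply)
    qed
    have closed: "(d ^^ m) z \<in> orb" if "z \<in> orb" for z m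
    proof -
      have 1: "d w \<in> orb" if w: "w \<in> orb" for w
      proof -
        obtain j where j: "j < p" "w = (d ^^ j) y" using w by (auto simp: orb_def)
        show ?thesis
        proof (cases "Suc j < p")
          case True
          then show ?thesis using j by (auto simp: orb_def intro!: image_eqI[of _ _ "Suc j"])
        next
          case False
          then have "p = Suc j" using j by simp
          then have "d w = y" using j psubset.prems(2)[OF y(1)] by simp
          then show ?thesis using ne by simp
        qed
      qed
      show ?thesis using that by (induction m) (auto simp: 1)
    qed
    have diff: "d z \<in> S - orb" if "z \<in> S - orb" for z
    proof -
      have "d z \<notin> orb" using closed[of "d z" "p - 1"] pred[of z] that by auto
      then show ?thesis using that psubset.prems(1) by auto
    qed
    have nofix: "d z \<noteq> z" if z: "z \<in> orb" for z
    proof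
      assume fx: "d z = z"
      obtain j where j: "j < p" "z = (d ^^ j) y" using z by (auto simp: orb_def)
      have fxm: "(d ^^ m) z = z" for m by (induction m) (auto simp: fx)
      have "y = (d ^^ (p - j + j)) y" using j psubset.prems(2)[OF y(1)] by simp
      also have "\<dots> = (d ^^ (p - j)) z" using j by (simp only: funpow_add o_apply)
      also have "\<dots> = z" by (rule fxm)
      finally show False using fx y(2) by simp
    qed
    have "sum a (S - orb) = sum a {z \<in> S - orb. d z = z}"
      by (rule psubset.IH) (use sub ne diff psubset.prems in auto)
    moreover have "{z \<in> S - orb. d z = z} = {z \<in> S. d z = z}" using nofix by auto
    moreover have "sum a S = sum a (S - orb) + sum a orb"
      using sum.subset_diff[OF sub psubset.hyps] .
    ultimately show ?thesis using sum0 by simp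
  qed
qed

lemma of_nat_char_eq_0: "CHAR('f::semiring_1) = p \<Longrightarrow> of_nat p = (0::'f)"
  using of_nat_CHAR by metis

lemma sum_prime_cyclic_invariant:
  fixes d :: "'a \<Rightarrow> 'a" and a :: "'a \<Rightarrow> 'f::semiring_1"
  assumes "prime p" "CHAR('f) = p" "finite S"
    and maps: "\<And>y. y \<in> S \<Longrightarrow> d y \<in> S" and "\<And>y. y \<in> S \<Longrightarrow> (d ^^ p) y = y"
    and inv: "\<And>y. y \<in> S \<Longrightarrow> a (d y) = a y"
  shows "sum a S = sum a {y \<in> S. d y = y}"
proof (rule sum_prime_cyclic[OF assms(1,3,4,5)])
  fix y assume "y \<in> S" "d y \<noteq> y"
  have "(d ^^ j) y \<in> S \<and> a ((d ^^ j) y) = a y" for j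
    by (induction j) (auto simp: maps inv \<open>y \<in> S\<close>)
  then show "(\<Sum>j<p. a ((d ^^ j) y)) = 0"
    by (simp add: of_nat_char_eq_0[OF assms(2)])
qed

text \<open>
  The elements of \<open>X\<close> are treated one after the other: as they commute, each acts on the common
  fixed points of its predecessors.
\<close>

lemma sum_commuting_invariant:
  fixes act :: "'x \<Rightarrow> 'a \<Rightarrow> 'a" and a :: "'a \<Rightarrow> 'f::semiring_1"
  assumes "prime p" "CHAR('f) = p" "finite S" "finite X"
    and "\<And>x y. x \<in> X \<Longrightarrow> y \<in> S \<Longrightarrow> act x y \<in> S"
    and "\<And>x y. x \<in> X \<Longrightarrow> y \<in> S \<Longrightarrow> (act x ^^ p) y = y"
    and "\<And>x x' y. x \<in> X \<Longrightarrow> x' \<in> X \<Longrightarrow> y \<in> S \<Longrightarrow> act x (act x' y) = act x' (act x y)"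
    and "\<And>x y. x \<in> X \<Longrightarrow> y \<in> S \<Longrightarrow> a (act x y) = a y"
  shows "sum a S = sum a {y \<in> S. \<forall>x\<in>X. act x y = y}"
  using assms(4-8)
proof (induction X)
  case empty
  then show ?case by simp
next
  case (insert x X)
  have "sum a S = sum a {y \<in> S. \<forall>x\<in>X. act x y = y}"
    by (rule insert.IH) (use insert.prems in auto)
  also have "\<dots> = sum a {y \<in> {y \<in> S. \<forall>x\<in>X. act x y = y}. act x y = y}"
  proof (rule sum_prime_cyclic_invariant[OF assms(1,2)])
    show "act x y \<in> {y \<in> S. \<forall>x\<in>X. act x y = y}" if "y \<in> {y \<in> S. \<forall>x\<in>X. act x y = y}" for y
    proof -
      have "act x' (act x y) = act x y" if "x' \<in> X" for x'
        using insert.prems(3)[of x' x y] that \<open>y \<in> _\<close> by simp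
      then show ?thesis using that insert.prems(1) by simp
    qed
  qed (use insert.prems assms(3) in auto)
  also have "{y \<in> {y \<in> S. \<forall>x\<in>X. act x y = y}. act x y = y} = {y \<in> S. \<forall>x\<in>insert x X. act x y = y}"
    by auto
  finally show ?case .
qed

section \<open>Higman's criterion and vertices\<close>

lemma sum_additive_on:
  fixes f :: "'a::comm_monoid_add \<Rightarrow> 'b::comm_monoid_add"
  assumes "0 \<in> S" and "\<And>a b. a \<in> S \<Longrightarrow> b \<in> S \<Longrightarrow> a + b \<in> S"
    and "f 0 = 0" and "\<And>a b. a \<in> S \<Longrightarrow> b \<in> S \<Longrightarrow> f (a + b) = f a + f b"
    and "\<And>i. i \<in> I \<Longrightarrow> v i \<in> S"
  shows "f (\<Sum>i\<in>I. v i) = (\<Sum>i\<in>I. f (v i))"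
proof -
  have "(\<Sum>i\<in>I. v i) \<in> S \<and> f (\<Sum>i\<in>I. v i) = (\<Sum>i\<in>I. f (v i))"
    using assms(5) by (induction I rule: infinite_finite_induct) (auto simp: assms(1-4))
  then show ?thesis by blast
qed

locale fg_mod = group G for G :: "'g monoid" (structure) +
  fixes M :: "('f::field, 'g, 'v::ab_group_add) fg"
  assumes is_fg_module: "fg_module G M"
begin

abbreviation "V \<equiv> fg_space M"
abbreviation "act \<equiv> fg_act M"
abbreviation "scale \<equiv> fg_scale M"

sublocale vector_space "fg_scale M"
  using is_fg_module by (simp add: fg_module_def)

lemma subspace_V: "subspace V"
  using is_fg_module by (simp add: fg_module_def)

lemmas zero_V [simp] = subspace_0[OF subspace_V]
lemmas add_V = subspace_add[OF subspace_V]
lemmas scale_V = subspace_scale[OF subspace_V]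
lemmas sum_V = subspace_sum[OF subspace_V]

lemma act_V: "g \<in> carrier G \<Longrightarrow> v \<in> V \<Longrightarrow> act g v \<in> V"
  and act_add: "g \<in> carrier G \<Longrightarrow> v \<in> V \<Longrightarrow> w \<in> V \<Longrightarrow> act g (v + w) = act g v + act g w"
  and act_scale: "g \<in> carrier G \<Longrightarrow> v \<in> V \<Longrightarrow> act g (scale c v) = scale c (act g v)"
  and act_one: "v \<in> V \<Longrightarrow> act \<one> v = v"
  and act_mult: "g \<in> carrier G \<Longrightarrow> h \<in> carrier G \<Longrightarrow> v \<in> V \<Longrightarrow> act (g \<otimes> h) v = act g (act h v)"
  using is_fg_module by (auto simp: fg_module_def)

lemma act_0: "g \<in> carrier G \<Longrightarrow> act g 0 = 0"
  using act_scale[of g 0 0] by simp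

lemma act_sum: "g \<in> carrier G \<Longrightarrow> (\<And>i. i \<in> I \<Longrightarrow> v i \<in> V) \<Longrightarrow>
    act g (\<Sum>i\<in>I. v i) = (\<Sum>i\<in>I. act g (v i))"
  by (induction I rule: infinite_finite_induct) (auto simp: act_0 act_add sum_V)

lemma act_inv_act [simp]: "g \<in> carrier G \<Longrightarrow> v \<in> V \<Longrightarrow> act (inv g) (act g v) = v"
  and act_act_inv [simp]: "g \<in> carrier G \<Longrightarrow> v \<in> V \<Longrightarrow> act g (act (inv g) v) = v"
  by (simp_all flip: act_mult add: act_one)

end

definition linear_endo :: "('f, 'g, 'v::ab_group_add) fg \<Rightarrow> ('v \<Rightarrow> 'v) \<Rightarrow> bool" where
  "linear_endo M f \<longleftrightarrow>
     (\<forall>v\<in>fg_space M. f v \<in> fg_space M) \<and>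
     (\<forall>v\<in>fg_space M. \<forall>w\<in>fg_space M. f (v + w) = f v + f w) \<and>
     (\<forall>c. \<forall>v\<in>fg_space M. f (fg_scale M c v) = fg_scale M c (f v))"

text \<open>
  If \<open>f\<close> is an \<open>FQ\<close>-endomorphism with \<open>(\<Sum>g. g f g\<^sup>-\<^sup>1) = id\<close>, summed over representatives \<open>g\<close> of the left
  cosets of \<open>Q\<close>, then \<open>F (g Q) = g f g\<^sup>-\<^sup>1\<close> does not depend on the representatives. Such a family is
  described by its equivariance; \<open>f\<close> is recovered as \<open>F Q\<close>.
\<close>

definition trace_decomposition ::
  "'g monoid \<Rightarrow> 'g set \<Rightarrow> ('f, 'g, 'v::ab_group_add) fg \<Rightarrow> ('g set \<Rightarrow> 'v \<Rightarrow> 'v) \<Rightarrow> bool" where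
  "trace_decomposition G Q M F \<longleftrightarrow>
     (\<forall>y\<in>lcosets\<^bsub>G\<^esub> Q. linear_endo M (F y)) \<and>
     (\<forall>x\<in>carrier G. \<forall>y\<in>lcosets\<^bsub>G\<^esub> Q. \<forall>v\<in>fg_space M.
        F (x <#\<^bsub>G\<^esub> y) (fg_act M x v) = fg_act M x (F y v)) \<and>
     (\<forall>v\<in>fg_space M. (\<Sum>y\<in>lcosets\<^bsub>G\<^esub> Q. F y v) = v)"

lemma lcosets_iff: "y \<in> lcosets\<^bsub>G\<^esub> Q \<longleftrightarrow> (\<exists>g\<in>carrier G. y = g <#\<^bsub>G\<^esub> Q)"
  by (auto simp: LCOSETS_def)

lemma (in group) lcosets_transl:
  assumes "Q \<subseteq> carrier G" "x \<in> carrier G" "y \<in> lcosets Q"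
  shows "x <# y \<in> lcosets Q" and "y \<subseteq> carrier G"
proof -
  obtain g where "g \<in> carrier G" "y = g <# Q" using assms(3) by (auto simp: lcosets_iff)
  then show "x <# y \<in> lcosets Q" "y \<subseteq> carrier G"
    using assms l_coset_subset_G by (auto simp: lcosets_iff lcos_m_assoc intro!: bexI[of _ "x \<otimes> g"])
qed

lemma induced_space_iff:
    "f \<in> fg_space (fg_induced G Q U) \<longleftrightarrow>
      (\<forall>g\<in>carrier G. f g \<in> fg_space U) \<and> (\<forall>g. g \<notin> carrier G \<longrightarrow> f g = 0) \<and>
      (\<forall>g\<in>carrier G. \<forall>q\<in>Q. f (g \<otimes>\<^bsub>G\<^esub> q) = fg_act U (inv\<^bsub>G\<^esub> q) (f g))"
  and induced_scale_apply: "fg_scale (fg_induced G Q U) c f g = fg_scale U c (f g)"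
  and induced_act_apply:
    "fg_act (fg_induced G Q U) x f g = (if g \<in> carrier G then f (inv\<^bsub>G\<^esub> x \<otimes>\<^bsub>G\<^esub> g) else 0)"
  by (simp_all add: fg_induced_def)

lemma induced_vector_space:
  assumes "vector_space (fg_scale (U :: ('f::field, 'g, 'v::ab_group_add) fg))"
  shows "vector_space (fg_scale (fg_induced G Q U))"
proof -
  interpret vector_space "fg_scale U" by fact
  show ?thesis
    by standard
      (auto simp: fun_eq_iff induced_scale_apply scale_right_distrib scale_left_distrib)
qed

lemma induced_space_subspace:
  fixes G :: "'g monoid" (structure)
  assumes "group G" and Q: "subgroup Q G" and U: "fg_module (G\<lparr>carrier := Q\<rparr>) U"
  shows "module.subspace (fg_scale (fg_induced G Q U)) (fg_space (fg_induced G Q U))"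
proof -
  interpret group G by fact
  interpret Q: subgroup Q G by fact
  interpret U: fg_mod "G\<lparr>carrier := Q\<rparr>" U
    using U by (simp add: fg_mod_def fg_mod_axioms_def fg_module_def)
  interpret N: vector_space "fg_scale (fg_induced G Q U)"
    by (rule induced_vector_space[OF U.vector_space_axioms])
  have "U.act (inv q) (f g + h g) = U.act (inv q) (f g) + U.act (inv q) (h g)"
    if "g \<in> carrier G" "q \<in> Q" "f \<in> fg_space (fg_induced G Q U)" "h \<in> fg_space (fg_induced G Q U)"
    for f h g q
    using that by (intro U.act_add) (auto simp: induced_space_iff)
  moreover have "U.act (inv q) (U.scale c (f g)) = U.scale c (U.act (inv q) (f g))"
    if "g \<in> carrier G" "q \<in> Q" "f \<in> fg_space (fg_induced G Q U)" for c f g q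
    using that by (intro U.act_scale) (auto simp: induced_space_iff)
  moreover have "U.act (inv q) 0 = 0" if "q \<in> Q" for q using that U.act_0 by simp
  ultimately show ?thesis
    by (intro N.subspaceI) (auto simp: induced_space_iff induced_scale_apply U.add_V U.scale_V)
qed

lemma direct_sum_projection:
  fixes N :: "('f::field, 'g, 'v::ab_group_add) fg"
  assumes vs: "vector_space (fg_scale N)" and ds: "fg_direct_sum G N W W'"
    and act_add: "\<And>g v w. g \<in> carrier G \<Longrightarrow> fg_act N g (v + w) = fg_act N g v + fg_act N g w"
  obtains pr where
    "\<And>v. v \<in> fg_space N \<Longrightarrow> pr v \<in> W"
    "\<And>v w. v \<in> fg_space N \<Longrightarrow> w \<in> fg_space N \<Longrightarrow> pr (v + w) = pr v + pr w"
    "\<And>c v. v \<in> fg_space N \<Longrightarrow> pr (fg_scale N c v) = fg_scale N c (pr v)"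
    "\<And>g v. g \<in> carrier G \<Longrightarrow> v \<in> fg_space N \<Longrightarrow> pr (fg_act N g v) = fg_act N g (pr v)"
    "\<And>v. v \<in> W \<Longrightarrow> pr v = v"
proof -
  interpret vector_space "fg_scale N" by fact
  have W: "subspace W" "subspace W'" and int: "W \<inter> W' = {0}"
    and sp: "fg_space N = {w + w' | w w'. w \<in> W \<and> w' \<in> W'}"
    and actW: "\<And>g w. g \<in> carrier G \<Longrightarrow> w \<in> W \<Longrightarrow> fg_act N g w \<in> W"
    and actW': "\<And>g w. g \<in> carrier G \<Longrightarrow> w \<in> W' \<Longrightarrow> fg_act N g w \<in> W'"
    using ds by (auto simp: fg_direct_sum_def fg_submodule_def)
  define pr where "pr v = (THE w. w \<in> W \<and> (\<exists>w'\<in>W'. v = w + w'))" for v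
  have pr: "pr (w + w') = w" if "w \<in> W" "w' \<in> W'" for w w'
    unfolding pr_def
  proof (rule the_equality)
    fix u assume "u \<in> W \<and> (\<exists>w''\<in>W'. w + w' = u + w'')"
    then obtain w'' where u: "u \<in> W" "w'' \<in> W'" "w + w' = u + w''" by blast
    then have "u - w = w' - w''" by (simp add: algebra_simps)
    moreover have "u - w \<in> W" "w' - w'' \<in> W'"
      using u that W by (auto intro: subspace_diff)
    ultimately have "u - w \<in> W \<inter> W'" by simp
    then show "u = w" using int by simp
  qed (use that in blast)
  show thesis
  proof
    show "pr v \<in> W" if "v \<in> fg_space N" for v
      using that sp pr by auto
    show "pr (v + w) = pr v + pr w" if vw: "v \<in> fg_space N" "w \<in> fg_space N" for v w
    proof -
      obtain a a' b b' where *: "v = a + a'" "w = b + b'" "a \<in> W" "b \<in> W" "a' \<in> W'" "b' \<in> W'"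
        using vw unfolding sp by blast
      have "v + w = (a + b) + (a' + b')" using * by (simp add: algebra_simps)
      then show ?thesis using * pr subspace_add W by metis
    qed
    show "pr (fg_scale N c v) = fg_scale N c (pr v)" if v: "v \<in> fg_space N" for c v
    proof -
      obtain a a' where *: "v = a + a'" "a \<in> W" "a' \<in> W'" using v unfolding sp by blast
      then show ?thesis using pr subspace_scale W by (simp add: scale_right_distrib)
    qed
    show "pr (fg_act N g v) = fg_act N g (pr v)" if g: "g \<in> carrier G" and v: "v \<in> fg_space N" for g v
    proof -
      obtain a a' where *: "v = a + a'" "a \<in> W" "a' \<in> W'" using v unfolding sp by blast
      then show ?thesis using pr actW[OF g] actW'[OF g] by (simp add: act_add[OF g])
    qed
    show "pr v = v" if "v \<in> W" for v
      using pr[OF that subspace_0[OF W(2)]] by simp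
  qed
qed

lemma sum_fun_apply: "(\<Sum>i\<in>I. f i) x = (\<Sum>i\<in>I. f i x)"
  by (induction I rule: infinite_finite_induct) auto

lemma (in group) mem_l_coset_iff:
  assumes "x \<in> carrier G" "g \<in> carrier G" "y \<subseteq> carrier G"
  shows "g \<in> x <# y \<longleftrightarrow> inv x \<otimes> g \<in> y"
proof
  assume "g \<in> x <# y"
  then obtain h where "h \<in> y" "g = x \<otimes> h" by (auto simp: l_coset_def)
  then show "inv x \<otimes> g \<in> y" using assms by (auto simp: m_assoc[symmetric] subset_iff)
next
  assume *: "inv x \<otimes> g \<in> y"
  have "g = x \<otimes> (inv x \<otimes> g)" using assms by (simp add: m_assoc[symmetric])
  then show "g \<in> x <# y" using * by (auto simp: l_coset_def)
qed

lemma (in group) lcoset_mult_right_iff: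
  assumes "subgroup Q G" "y \<in> lcosets Q" "g \<in> carrier G" "q \<in> Q"
  shows "g \<otimes> q \<in> y \<longleftrightarrow> g \<in> y"
proof -
  interpret Q: subgroup Q G by fact
  obtain a where a: "a \<in> carrier G" "y = a <# Q" using assms by (auto simp: lcosets_iff)
  have q: "q \<in> carrier G" using assms by auto
  have "inv a \<otimes> (g \<otimes> q) \<in> Q \<longleftrightarrow> inv a \<otimes> g \<in> Q"
  proof
    assume "inv a \<otimes> (g \<otimes> q) \<in> Q"
    then have "inv a \<otimes> (g \<otimes> q) \<otimes> inv q \<in> Q" using assms by auto
    then show "inv a \<otimes> g \<in> Q" using a q assms by (simp add: m_assoc)
  next
    assume "inv a \<otimes> g \<in> Q"
    then have "inv a \<otimes> g \<otimes> q \<in> Q" using assms by auto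
    then show "inv a \<otimes> (g \<otimes> q) \<in> Q" using a q assms by (simp add: m_assoc)
  qed
  then show ?thesis using a q assms Q.subset by (simp add: mem_l_coset_iff)
qed

text \<open>
  In an induced module the restrictions of functions to the left cosets of \<open>Q\<close> form such a
  decomposition of the identity, and it can be cut down to any direct summand.
\<close>

lemma (in fg_mod) trace_decomposition_if_relatively_projective:
  assumes "finite (carrier G)" "subgroup Q G" "fg_relatively_projective G Q M"
  obtains F where "trace_decomposition G Q M F"
proof -
  interpret Q: subgroup Q G by fact
  obtain U :: "('f, 'g, nat \<Rightarrow> 'f) fg" where U: "fg_module (G\<lparr>carrier := Q\<rparr>) U"
    and "fg_direct_summand G M (fg_induced G Q U)"
    using assms(3) by (auto simp: fg_relatively_projective_def)
  interpret U: fg_mod "G\<lparr>carrier := Q\<rparr>" U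
    using U by (simp add: fg_mod_def fg_mod_axioms_def fg_module_def)
  define N where "N = fg_induced G Q U"
  obtain W W' where ds: "fg_direct_sum G N W W'" and iso: "fg_isomorphic G M (N\<lparr>fg_space := W\<rparr>)"
    using \<open>fg_direct_summand G M (fg_induced G Q U)\<close> by (auto simp: fg_direct_summand_def N_def)
  obtain \<phi> where bij: "bij_betw \<phi> V W"
    and \<phi>_add: "\<And>v w. v \<in> V \<Longrightarrow> w \<in> V \<Longrightarrow> \<phi> (v + w) = \<phi> v + \<phi> w"
    and \<phi>_scale: "\<And>c v. v \<in> V \<Longrightarrow> \<phi> (scale c v) = fg_scale N c (\<phi> v)"
    and \<phi>_act: "\<And>g v. g \<in> carrier G \<Longrightarrow> v \<in> V \<Longrightarrow> \<phi> (act g v) = fg_act N g (\<phi> v)"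
    using iso by (auto simp: fg_isomorphic_def)
  have vsN: "vector_space (fg_scale N)"
    unfolding N_def by (rule induced_vector_space[OF U.vector_space_axioms])
  interpret N: vector_space "fg_scale N" by (rule vsN)
  have WN: "W \<subseteq> fg_space N" "N.subspace W" "\<And>g w. g \<in> carrier G \<Longrightarrow> w \<in> W \<Longrightarrow> fg_act N g w \<in> W"
    using ds by (auto simp: fg_direct_sum_def fg_submodule_def)
  note spN = induced_space_iff[of _ G Q U, folded N_def]
  note scN = induced_scale_apply[of G Q U, folded N_def]
  note acN = induced_act_apply[of G Q U, folded N_def]
  have acN_add: "fg_act N x (f + h) = fg_act N x f + fg_act N x h" if "x \<in> carrier G" for x f h
    by (simp add: fun_eq_iff acN)
  obtain pr where pr: "\<And>v. v \<in> fg_space N \<Longrightarrow> pr v \<in> W"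
    "\<And>v w. v \<in> fg_space N \<Longrightarrow> w \<in> fg_space N \<Longrightarrow> pr (v + w) = pr v + pr w"
    "\<And>c v. v \<in> fg_space N \<Longrightarrow> pr (fg_scale N c v) = fg_scale N c (pr v)"
    "\<And>g v. g \<in> carrier G \<Longrightarrow> v \<in> fg_space N \<Longrightarrow> pr (fg_act N g v) = fg_act N g (pr v)"
    "\<And>v. v \<in> W \<Longrightarrow> pr v = v"
    by (rule direct_sum_projection[OF vsN ds acN_add]) (assumption+, rule that, assumption+)
  define \<psi> where "\<psi> = inv_into V \<phi>"
  have \<psi>V: "\<psi> w \<in> V" and \<phi>\<psi>: "\<phi> (\<psi> w) = w" if "w \<in> W" for w
    using that bij by (auto simp: \<psi>_def bij_betw_def inv_into_into f_inv_into_f)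
  have \<psi>\<phi>: "\<psi> (\<phi> v) = v" if "v \<in> V" for v
    using that bij by (auto simp: \<psi>_def bij_betw_def)
  have \<phi>W: "\<phi> v \<in> W" if "v \<in> V" for v using that bij by (auto simp: bij_betw_def)
  have inj: "a = b" if "\<phi> a = \<phi> b" "a \<in> V" "b \<in> V" for a b
    using that bij by (auto simp: bij_betw_def inj_on_def)
  have \<psi>_add: "\<psi> (v + w) = \<psi> v + \<psi> w" if "v \<in> W" "w \<in> W" for v w
    by (rule inj) (use that in \<open>auto simp: \<phi>_add \<phi>\<psi> \<psi>V add_V N.subspace_add[OF WN(2)]\<close>)
  have \<psi>_scale: "\<psi> (fg_scale N c v) = scale c (\<psi> v)" if "v \<in> W" for c v
    by (rule inj) (use that in \<open>auto simp: \<phi>_scale \<phi>\<psi> \<psi>V scale_V N.subspace_scale[OF WN(2)]\<close>)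
  have \<psi>_act: "\<psi> (fg_act N g v) = act g (\<psi> v)" if "g \<in> carrier G" "v \<in> W" for g v
    by (rule inj) (use that in \<open>auto simp: \<phi>_act \<phi>\<psi> \<psi>V act_V WN(3)\<close>)
  have \<psi>_0: "\<psi> 0 = 0"
    using \<psi>_scale[of 0 0] N.subspace_0[OF WN(2)] by (simp only: N.scale_zero_left scale_zero_left)
  have \<psi>_sum: "\<psi> (\<Sum>i\<in>I. v i) = (\<Sum>i\<in>I. \<psi> (v i))" if "\<And>i. i \<in> I \<Longrightarrow> v i \<in> W" for v :: "'g set \<Rightarrow> _" and I
    by (rule sum_additive_on[where S = W])
      (rule N.subspace_0[OF WN(2)] N.subspace_add[OF WN(2)] \<psi>_0 \<psi>_add that; assumption)+
  define E where "E y f = (\<lambda>g. if g \<in> y then f g else 0)" for y :: "'g set" and f :: "'g \<Rightarrow> nat \<Rightarrow> 'f"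
  have EN: "E y f \<in> fg_space N" if "y \<in> lcosets Q" "f \<in> fg_space N" for y f
  proof -
    have "E y f (g \<otimes> q) = U.act (inv q) (E y f g)" if "g \<in> carrier G" "q \<in> Q" for g q
      using lcoset_mult_right_iff[OF assms(2) \<open>y \<in> _\<close> that] U.act_0[of "inv q"] that \<open>f \<in> _\<close>
      by (auto simp: E_def spN)
    then show ?thesis using that by (auto simp: spN E_def)
  qed
  have spN_sub: "N.subspace (fg_space N)"
    unfolding N_def by (rule induced_space_subspace[OF is_group assms(2) U])
  have pr_sum: "pr (\<Sum>i\<in>I. v i) = (\<Sum>i\<in>I. pr (v i))" if "\<And>i. i \<in> I \<Longrightarrow> v i \<in> fg_space N" for v :: "'g set \<Rightarrow> _" and I
    by (rule sum_additive_on[where S = "fg_space N"])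
      (rule N.subspace_0[OF spN_sub] N.subspace_add[OF spN_sub] pr(5)[OF N.subspace_0[OF WN(2)]]
        pr(2) that; assumption)+
  define F where "F y v = \<psi> (pr (E y (\<phi> v)))" for y v
  have \<phi>N: "\<phi> v \<in> fg_space N" if "v \<in> V" for v using that \<phi>W WN(1) by auto
  have "linear_endo M (F y)" if y: "y \<in> lcosets Q" for y
  proof -
    have "E y (f + h) = E y f + E y h" for f h by (auto simp: E_def fun_eq_iff)
    moreover have "E y (fg_scale N c f) = fg_scale N c (E y f)" for c f
      by (auto simp: E_def fun_eq_iff scN)
    ultimately show ?thesis
      using EN[OF y \<phi>N] unfolding linear_endo_def F_def
      by (auto simp: \<psi>V pr \<phi>_add \<phi>_scale \<psi>_add \<psi>_scale)
  qed
  moreover have "F (x <# y) (act x v) = act x (F y v)"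
    if "x \<in> carrier G" "y \<in> lcosets Q" "v \<in> V" for x y v
  proof -
    have ys: "y \<subseteq> carrier G" using lcosets_transl(2)[OF Q.subset that(1,2)] .
    then have "x <# y \<subseteq> carrier G" using that(1) l_coset_subset_G by simp
    then have "E (x <# y) (fg_act N x f) = fg_act N x (E y f)" if "f \<in> fg_space N" for f
      using that ys mem_l_coset_iff[OF \<open>x \<in> carrier G\<close> _ ys] by (auto simp: E_def fun_eq_iff acN)
    then show ?thesis
      using that EN[OF that(2) \<phi>N[OF that(3)]] \<phi>N[OF that(3)]
      by (simp add: F_def \<phi>_act pr \<psi>_act)
  qed
  moreover have "(\<Sum>y\<in>lcosets Q. F y v) = v" if "v \<in> V" for v
  proof -
    have fin: "finite (lcosets Q)" using assms(1) by (simp add: LCOSETS_def)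
    have "(\<Sum>y\<in>lcosets Q. E y f) g = f g" if f: "f \<in> fg_space N" for f g
    proof (cases "g \<in> carrier G")
      case True
      then have *: "y = g <# Q" if "y \<in> lcosets Q" "g \<in> y" for y
        using that assms(2) l_repr_independence by (auto simp: lcosets_iff)
      have self: "g \<in> g <# Q" using True assms(2) lcos_self by blast
      have "E y f g = (if y = g <# Q then f g else 0)" if "y \<in> lcosets Q" for y
        using *[OF that] self unfolding E_def by metis
      then have "(\<Sum>y\<in>lcosets Q. E y f g) = (\<Sum>y\<in>lcosets Q. if y = g <# Q then f g else 0)"
        by (rule sum.cong[OF refl])
      also have "\<dots> = f g" using fin True by (subst sum.delta) (auto simp: lcosets_iff)
      finally show ?thesis by (simp add: sum_fun_apply)
    next
      case False
      then show ?thesis using f by (auto simp: sum_fun_apply E_def spN intro!: sum.neutral)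
    qed
    then have 1: "(\<Sum>y\<in>lcosets Q. E y (\<phi> v)) = \<phi> v" using \<phi>N[OF that] by (simp add: fun_eq_iff)
    have "(\<Sum>y\<in>lcosets Q. F y v) = \<psi> (pr (\<Sum>y\<in>lcosets Q. E y (\<phi> v)))"
      unfolding F_def using EN \<phi>N[OF that] pr(1) by (simp add: pr_sum \<psi>_sum)
    also have "\<dots> = v" using 1 pr(5) \<phi>W \<psi>\<phi> that by simp
    finally show ?thesis .
  qed
  ultimately have "trace_decomposition G Q M F" by (auto simp: trace_decomposition_def)
  then show thesis by (rule that)
qed

lemma (in fg_mod) finite_coordinates:
  "\<exists>(d::nat) b. (\<forall>i<d. b i \<in> V) \<and>
     bij_betw (\<lambda>c. \<Sum>i<d. scale (c i) (b i)) {c. \<forall>i\<ge>d. c i = 0} V"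
proof -
  obtain B0 where "finite B0" "V = span B0" using is_fg_module by (auto simp: fg_module_def)
  obtain B where B: "B \<subseteq> B0" "independent B" "span B0 \<subseteq> span B"
    using maximal_independent_subset[of B0] by (metis span_superset span_minimal subspace_span)
  have "finite B" using \<open>finite B0\<close> B finite_subset by blast
  have VB: "V = span B" using B \<open>V = span B0\<close> span_mono[OF B(1)] by blast
  obtain b where b: "bij_betw b {..<card B} B"
    using ex_bij_betw_nat_finite[OF \<open>finite B\<close>] by (metis lessThan_atLeast0)
  let ?d = "card B"
  define comb where "comb c = (\<Sum>i<?d. scale (c i) (b i))" for c
  have bV: "b i \<in> V" if "i < ?d" for i
  proof -
    have "b i \<in> B" using that b by (auto simp: bij_betw_def)
    then show ?thesis unfolding VB by (rule span_base)
  qed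
  have comb_B: "comb c = (\<Sum>v\<in>B. scale (c (inv_into {..<?d} b v)) v)" for c
    unfolding comb_def
    by (subst sum.reindex_bij_betw[OF b, symmetric], rule sum.cong)
      (use b in \<open>auto simp: bij_betw_def\<close>)
  have "inj_on comb {c. \<forall>i\<ge>?d. c i = 0}"
  proof (rule inj_onI)
    fix c c' assume c: "c \<in> {c. \<forall>i\<ge>?d. c i = 0}" "c' \<in> {c. \<forall>i\<ge>?d. c i = 0}" and eq: "comb c = comb c'"
    let ?k = "\<lambda>v. inv_into {..<?d} b v"
    have s0: "(\<Sum>v\<in>B. scale (c (?k v) - c' (?k v)) v) = 0"
      using eq by (simp add: comb_B scale_left_diff_distrib sum_subtractf)
    have z: "c (?k v) - c' (?k v) = 0" if "v \<in> B" for v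
      by (rule independentD[OF B(2) \<open>finite B\<close> subset_refl s0 that])
    show "c = c'"
    proof
      fix i
      show "c i = c' i"
      proof (cases "i < ?d")
        case True
        then have "b i \<in> B" "?k (b i) = i" using b by (auto simp: bij_betw_def)
        then show ?thesis using z[of "b i"] by simp
      qed (use c in auto)
    qed
  qed
  moreover have "comb ` {c. \<forall>i\<ge>?d. c i = 0} = V"
  proof
    show "comb ` {c. \<forall>i\<ge>?d. c i = 0} \<subseteq> V"
      unfolding comb_def using bV by (auto intro!: sum_V scale_V)
    show "V \<subseteq> comb ` {c. \<forall>i\<ge>?d. c i = 0}"
    proof
      fix v assume "v \<in> V"
      then obtain u where u: "v = (\<Sum>a\<in>B. scale (u a) a)"
        using VB span_finite[OF \<open>finite B\<close>] by auto
      let ?c = "\<lambda>i. if i < ?d then u (b i) else 0"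
      have "comb ?c = (\<Sum>i<?d. scale (u (b i)) (b i))" by (simp add: comb_def)
      also have "\<dots> = v" unfolding u by (rule sum.reindex_bij_betw[OF b])
      finally show "v \<in> comb ` {c. \<forall>i\<ge>?d. c i = 0}"
        by (intro image_eqI[of _ _ ?c]) auto
    qed
  qed
  ultimately have "bij_betw comb {c. \<forall>i\<ge>?d. c i = 0} V" by (simp add: bij_betw_def)
  then show ?thesis
    using bV unfolding comb_def by (intro exI[of _ ?d] exI[of _ b] conjI) auto
qed

lemma (in fg_mod) fg_mod_restrict:
  assumes "subgroup Q G" shows "fg_mod (G\<lparr>carrier := Q\<rparr>) M"
proof -
  interpret Q: subgroup Q G by fact
  have "group (G\<lparr>carrier := Q\<rparr>)" using subgroup_imp_group[OF assms] .
  then show ?thesis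
    using is_fg_module by (auto simp: fg_mod_def fg_mod_axioms_def fg_module_def)
qed

text \<open>
  Relative projectivity refers to modules whose vectors have type \<open>nat \<Rightarrow> 'f\<close>. Coordinates with respect to
  a basis provide an isomorphic copy of this type; \<open>\<theta>\<close> and \<open>\<eta>\<close> are the mutually inverse isomorphisms.
\<close>
lemma (in fg_mod) coordinate_module:
  obtains U :: "('f, 'g, nat \<Rightarrow> 'f) fg" and \<theta> \<eta> where
    "fg_module G U"
    "\<And>v. v \<in> V \<Longrightarrow> \<theta> v \<in> fg_space U" "\<And>u. u \<in> fg_space U \<Longrightarrow> \<eta> u \<in> V"
    "\<And>v. v \<in> V \<Longrightarrow> \<eta> (\<theta> v) = v" "\<And>u. u \<in> fg_space U \<Longrightarrow> \<theta> (\<eta> u) = u"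
    "\<And>v w. v \<in> V \<Longrightarrow> w \<in> V \<Longrightarrow> \<theta> (v + w) = \<theta> v + \<theta> w"
    "\<And>c v. v \<in> V \<Longrightarrow> \<theta> (scale c v) = fg_scale U c (\<theta> v)"
    "\<And>u u'. \<eta> (u + u') = \<eta> u + \<eta> u'"
    "\<And>c u. \<eta> (fg_scale U c u) = scale c (\<eta> u)"
    "\<And>g v. g \<in> carrier G \<Longrightarrow> v \<in> V \<Longrightarrow> \<theta> (act g v) = fg_act U g (\<theta> v)"
    "\<And>g u. g \<in> carrier G \<Longrightarrow> u \<in> fg_space U \<Longrightarrow> \<eta> (fg_act U g u) = act g (\<eta> u)"
proof -
  obtain d and b :: "nat \<Rightarrow> 'v" where bV: "\<And>i. i < d \<Longrightarrow> b i \<in> V"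
    and bij: "bij_betw (\<lambda>c. \<Sum>i<d. scale (c i) (b i)) {c. \<forall>i\<ge>d. c i = 0} V"
    using finite_coordinates by blast
  define C :: "(nat \<Rightarrow> 'f) set" where "C = {c. \<forall>i\<ge>d. c i = 0}"
  define \<eta> where "\<eta> c = (\<Sum>i<d. scale (c i) (b i))" for c
  define \<theta> where "\<theta> = inv_into C \<eta>"
  define sc where "sc = (\<lambda>(a::'f) (c::nat \<Rightarrow> 'f) i. a * c i)"
  have bij: "bij_betw \<eta> C V" using bij unfolding \<eta>_def C_def .
  have \<theta>C: "\<theta> v \<in> C" and \<eta>\<theta>: "\<eta> (\<theta> v) = v" if "v \<in> V" for v
    using that bij by (auto simp: \<theta>_def bij_betw_def inv_into_into f_inv_into_f)
  have \<theta>\<eta>: "\<theta> (\<eta> u) = u" and \<eta>V: "\<eta> u \<in> V" if "u \<in> C" for u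
    using that bij by (auto simp: \<theta>_def bij_betw_def)
  have \<eta>_add: "\<eta> (u + u') = \<eta> u + \<eta> u'" for u u'
    by (simp add: \<eta>_def scale_left_distrib sum.distrib)
  have \<eta>_scale: "\<eta> (sc c u) = scale c (\<eta> u)" for c u
    by (simp add: \<eta>_def sc_def scale_sum_right)
  have inj: "u = u'" if "\<eta> u = \<eta> u'" "u \<in> C" "u' \<in> C" for u u'
    using that \<theta>\<eta> by metis
  have C_add: "u + u' \<in> C" if "u \<in> C" "u' \<in> C" for u u' using that by (simp add: C_def)
  have C_scale: "sc c u \<in> C" if "u \<in> C" for c u using that by (simp add: C_def sc_def)
  have \<theta>_add: "\<theta> (v + w) = \<theta> v + \<theta> w" if "v \<in> V" "w \<in> V" for v w
    by (rule inj) (simp_all add: that \<eta>\<theta> \<theta>C \<eta>_add add_V C_add)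
  have \<theta>_scale: "\<theta> (scale c v) = sc c (\<theta> v)" if "v \<in> V" for c v
    by (rule inj) (simp_all add: that \<eta>\<theta> \<theta>C \<eta>_scale scale_V C_scale)
  define U where "U = \<lparr>fg_space = C, fg_scale = sc, fg_act = (\<lambda>g c. \<theta> (act g (\<eta> c)))\<rparr>"
  have U: "fg_space U = C" "fg_scale U = sc" "fg_act U g c = \<theta> (act g (\<eta> c))" for g c
    by (simp_all add: U_def)
  interpret U: vector_space sc
    by standard (auto simp: sc_def fun_eq_iff algebra_simps)
  have "U.subspace C" by (intro U.subspaceI) (auto simp: C_add C_scale, simp add: C_def)
  have C_span: "C = U.span ((\<lambda>i j. if j = i then 1 else 0) ` {..<d})"
  proof
    show "C \<subseteq> U.span ((\<lambda>i j. if j = i then 1 else 0) ` {..<d})"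
    proof
      fix c assume c: "c \<in> C"
      have "c = (\<Sum>i<d. sc (c i) (\<lambda>j. if j = i then 1 else 0))"
      proof
        fix j
        show "c j = (\<Sum>i<d. sc (c i) (\<lambda>j. if j = i then 1 else 0)) j"
          using c by (simp add: sum_fun_apply sc_def C_def mult_delta_right not_less)
      qed
      then show "c \<in> U.span ((\<lambda>i j. if j = i then 1 else 0) ` {..<d})"
        by (rule ssubst) (intro U.span_sum U.span_scale U.span_base imageI)
    qed
    show "U.span ((\<lambda>i j. if j = i then 1 else 0) ` {..<d}) \<subseteq> C"
      by (rule U.span_minimal) (use \<open>U.subspace C\<close> in \<open>auto simp: C_def\<close>)
  qed
  have "\<exists>B. finite B \<and> C = U.span B"
    by (rule exI, rule conjI[OF _ C_span]) simp
  with \<open>U.subspace C\<close> have "fg_module G U"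
    unfolding fg_module_def U
    using U.vector_space_axioms is_group
    by (auto simp: \<eta>V \<theta>C act_V \<eta>_add \<eta>_scale act_add act_scale \<theta>_add \<theta>_scale act_one act_mult \<theta>\<eta> \<eta>\<theta>)
  then show thesis
    by (rule that[of U \<theta> \<eta>]) (auto simp: U \<theta>C \<eta>V \<eta>\<theta> \<theta>\<eta> \<theta>_add \<theta>_scale \<eta>_add \<eta>_scale act_V)
qed

lemma (in group) lcoset_fixed:
  assumes "subgroup Q G" "q \<in> Q" shows "q <# Q = Q"
proof -
  interpret Q: subgroup Q G by fact
  show ?thesis using assms(2) Q.subset lcos_mult_one[OF Q.subset]
    l_repr_independence[of q \<one> Q] assms by (simp add: Q.mem_carrier)
qed

lemma (in group) lcoset_eq_of_mem:
  assumes "subgroup Q G" "y \<in> lcosets Q" "g \<in> y" shows "g \<in> carrier G" "y = g <# Q"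
  using assms l_repr_independence lcosets_transl(2)[OF subgroup.subset[OF assms(1)] one_closed assms(2)]
  by (auto simp: lcosets_iff)

text \<open>
  The module embeds into the module induced from its own restriction to \<open>Q\<close>, by
  \<open>v \<mapsto> (g \<mapsto> f (g\<^sup>-\<^sup>1 v))\<close> with \<open>f = F Q\<close>. The natural map back sends a function \<open>u\<close> to the sum of
  \<open>g (u g)\<close> over coset representatives \<open>g\<close>, and the composition \<open>\<Sum>g. g f g\<^sup>-\<^sup>1\<close> is the identity, so the
  embedding splits.
\<close>

lemma (in fg_mod) relatively_projective_if_trace_decomposition:
  assumes "finite (carrier G)" "subgroup Q G" and F: "trace_decomposition G Q M F"
  shows "fg_relatively_projective G Q M"
proof -
  interpret Q: subgroup Q G by fact
  have F_endo: "\<And>y. y \<in> lcosets Q \<Longrightarrow> linear_endo M (F y)"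
    and F_act: "\<And>x y v. x \<in> carrier G \<Longrightarrow> y \<in> lcosets Q \<Longrightarrow> v \<in> V \<Longrightarrow> F (x <# y) (act x v) = act x (F y v)"
    and F_sum: "\<And>v. v \<in> V \<Longrightarrow> (\<Sum>y\<in>lcosets Q. F y v) = v"
    using F by (auto simp: trace_decomposition_def)
  have Qc: "Q \<in> lcosets Q" using lcos_mult_one[OF Q.subset] by (auto simp: lcosets_iff intro!: bexI[of _ \<one>])
  interpret R: fg_mod "G\<lparr>carrier := Q\<rparr>" M by (rule fg_mod_restrict[OF assms(2)])
  obtain U :: "('f, 'g, nat \<Rightarrow> 'f) fg" and \<theta> \<eta> where U: "fg_module (G\<lparr>carrier := Q\<rparr>) U"
    and \<theta>U: "\<And>v. v \<in> V \<Longrightarrow> \<theta> v \<in> fg_space U" and \<eta>V: "\<And>u. u \<in> fg_space U \<Longrightarrow> \<eta> u \<in> V"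
    and \<eta>\<theta>: "\<And>v. v \<in> V \<Longrightarrow> \<eta> (\<theta> v) = v" and \<theta>\<eta>: "\<And>u. u \<in> fg_space U \<Longrightarrow> \<theta> (\<eta> u) = u"
    and \<theta>_add: "\<And>v w. v \<in> V \<Longrightarrow> w \<in> V \<Longrightarrow> \<theta> (v + w) = \<theta> v + \<theta> w"
    and \<theta>_scale: "\<And>c v. v \<in> V \<Longrightarrow> \<theta> (scale c v) = fg_scale U c (\<theta> v)"
    and \<eta>_add: "\<And>u u'. \<eta> (u + u') = \<eta> u + \<eta> u'"
    and \<eta>_scale: "\<And>c u. \<eta> (fg_scale U c u) = scale c (\<eta> u)"
    and \<theta>_act: "\<And>g v. g \<in> carrier (G\<lparr>carrier := Q\<rparr>) \<Longrightarrow> v \<in> V \<Longrightarrow> \<theta> (act g v) = fg_act U g (\<theta> v)"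
    and \<eta>_act: "\<And>g u. g \<in> carrier (G\<lparr>carrier := Q\<rparr>) \<Longrightarrow> u \<in> fg_space U \<Longrightarrow> \<eta> (fg_act U g u) = act g (\<eta> u)"
    by (rule R.coordinate_module) (rule that; assumption)
  interpret U: fg_mod "G\<lparr>carrier := Q\<rparr>" U
    using U by (simp add: fg_mod_def fg_mod_axioms_def fg_module_def)
  define N where "N = fg_induced G Q U"
  have vsN: "vector_space (fg_scale N)"
    unfolding N_def by (rule induced_vector_space[OF U.vector_space_axioms])
  interpret N: vector_space "fg_scale N" by (rule vsN)
  note spN = induced_space_iff[of _ G Q U, folded N_def]
  note scN = induced_scale_apply[of G Q U, folded N_def]
  note acN = induced_act_apply[of G Q U, folded N_def]
  have spN_sub: "N.subspace (fg_space N)"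
    unfolding N_def by (rule induced_space_subspace[OF is_group assms(2) U])
  have spN_act: "fg_act N x f \<in> fg_space N" if "x \<in> carrier G" "f \<in> fg_space N" for x f
  proof -
    have "f (inv x \<otimes> (g \<otimes> q)) = U.act (inv q) (f (inv x \<otimes> g))" if "g \<in> carrier G" "q \<in> Q" for g q
      using \<open>f \<in> _\<close> that \<open>x \<in> _\<close> Q.subset by (simp add: spN m_assoc[symmetric] subset_iff)
    then show ?thesis using that Q.subset by (auto simp: spN acN subset_iff)
  qed
  define i where "i v = (\<lambda>g. if g \<in> carrier G then \<theta> (F Q (act (inv g) v)) else 0)" for v
  have FV: "F y v \<in> V" if "y \<in> lcosets Q" "v \<in> V" for y v
    using F_endo that by (auto simp: linear_endo_def)
  have F_add: "F y (v + w) = F y v + F y w" if "y \<in> lcosets Q" "v \<in> V" "w \<in> V" for y v w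
    using F_endo that by (auto simp: linear_endo_def)
  have F_scale: "F y (scale c v) = scale c (F y v)" if "y \<in> lcosets Q" "v \<in> V" for c y v
    using F_endo that by (auto simp: linear_endo_def)
  have iN: "i v \<in> fg_space N" if v: "v \<in> V" for v
  proof -
    have "i v (g \<otimes> q) = U.act (inv q) (i v g)" if g: "g \<in> carrier G" and q: "q \<in> Q" for g q
    proof -
      have qc: "q \<in> carrier G" using q by auto
      have "F Q (act (inv q) (act (inv g) v)) = F (inv q <# Q) (act (inv q) (act (inv g) v))"
        using lcoset_fixed[OF assms(2), of "inv q"] q by simp
      also have "\<dots> = act (inv q) (F Q (act (inv g) v))"
        using Qc g qc v act_V by (intro F_act) auto
      finally show ?thesis
        using g q qc v FV Qc act_V by (simp add: i_def inv_mult_group act_mult \<theta>_act)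
    qed
    then show ?thesis using v FV Qc act_V \<theta>U by (auto simp: spN) (auto simp: i_def)
  qed
  have i_add: "i (v + w) = i v + i w" if "v \<in> V" "w \<in> V" for v w
    using that Qc by (auto simp: i_def fun_eq_iff act_add F_add act_V \<theta>_add FV)
  have i_scale: "i (scale c v) = fg_scale N c (i v)" if "v \<in> V" for c v
    using that Qc by (auto simp: i_def fun_eq_iff act_scale F_scale act_V \<theta>_scale FV scN)
  have i_act: "i (act x v) = fg_act N x (i v)" if "x \<in> carrier G" "v \<in> V" for x v
    using that by (auto simp: i_def fun_eq_iff acN inv_mult_group act_mult[symmetric])
  \<comment> \<open>This depends only on the coset of \<open>g\<close>, by \<open>e_coset\<close> below.\<close>
  define e where "e f g = act g (\<eta> (f g))" for f g
  define rep where "rep y = (SOME g. g \<in> y)" for y :: "'g set"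
  have rep: "rep y \<in> y" if y: "y \<in> lcosets Q" for y
  proof -
    obtain a where "a \<in> carrier G" "y = a <# Q" using y by (auto simp: lcosets_iff)
    then have "a \<in> y" using lcos_self assms(2) by blast
    then show ?thesis unfolding rep_def by (rule someI)
  qed
  have e_coset: "e f g = e f (rep y)" if y: "y \<in> lcosets Q" and "g \<in> y" and f: "f \<in> fg_space N" for f g y
  proof -
    have g: "g \<in> carrier G" "y = g <# Q"
      using lcoset_eq_of_mem[OF assms(2) y \<open>g \<in> y\<close>] by auto
    obtain q where q: "q \<in> Q" "rep y = g \<otimes> q" using rep[OF y] g by (auto simp: l_coset_def)
    have qc: "q \<in> carrier G" using q by auto
    have fg: "f g \<in> fg_space U" using f g by (simp add: spN)
    have "f (g \<otimes> q) = U.act (inv q) (f g)" using f g q by (simp add: spN)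
    then have "e f (rep y) = act (g \<otimes> q) (act (inv q) (\<eta> (f g)))"
      using q fg by (simp add: e_def \<eta>_act)
    also have "\<dots> = e f g"
      using g qc \<eta>V[OF fg] act_V by (simp add: act_mult e_def)
    finally show ?thesis by simp
  qed
  define r where "r f = (\<Sum>y\<in>lcosets Q. e f (rep y))" for f
  have rep_c: "rep y \<in> carrier G" if "y \<in> lcosets Q" for y
    using lcoset_eq_of_mem[OF assms(2) that rep[OF that]] by simp
  have fU: "f g \<in> fg_space U" if "f \<in> fg_space N" "g \<in> carrier G" for f g
    using that by (simp add: spN)
  have rV: "r f \<in> V" if "f \<in> fg_space N" for f
    unfolding r_def using that rep_c by (auto simp: e_def intro!: sum_V act_V \<eta>V fU)
  have r_add: "r (f + h) = r f + r h" if "f \<in> fg_space N" "h \<in> fg_space N" for f h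
  proof -
    have "e (f + h) (rep y) = e f (rep y) + e h (rep y)" if "y \<in> lcosets Q" for y
      using rep_c[OF that] fU \<open>f \<in> _\<close> \<open>h \<in> _\<close> \<eta>V by (simp add: e_def \<eta>_add act_add)
    then show ?thesis by (simp add: r_def sum.distrib)
  qed
  have r_scale: "r (fg_scale N c f) = scale c (r f)" if "f \<in> fg_space N" for c f
  proof -
    have "e (fg_scale N c f) (rep y) = scale c (e f (rep y))" if "y \<in> lcosets Q" for y
      using rep_c[OF that] fU \<open>f \<in> _\<close> \<eta>V by (simp add: e_def scN \<eta>_scale act_scale)
    then show ?thesis by (simp add: r_def scale_sum_right)
  qed
  have transl_bij: "bij_betw (\<lambda>y. x <# y) (lcosets Q) (lcosets Q)" if x: "x \<in> carrier G" for x
  proof (rule bij_betw_byWitness[where f' = "\<lambda>y. inv x <# y"])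
    show "\<forall>y\<in>lcosets Q. inv x <# (x <# y) = y" "\<forall>y\<in>lcosets Q. x <# (inv x <# y) = y"
      using x lcosets_transl(2)[OF Q.subset x] by (auto simp: lcos_m_assoc lcos_mult_one)
  qed (use x lcosets_transl(1)[OF Q.subset] in auto)
  have r_act: "r (fg_act N x f) = act x (r f)" if x: "x \<in> carrier G" and f: "f \<in> fg_space N" for x f
  proof -
    have "r (fg_act N x f) = (\<Sum>y\<in>lcosets Q. e (fg_act N x f) (rep (x <# y)))"
      unfolding r_def by (rule sum.reindex_bij_betw[OF transl_bij[OF x], symmetric])
    also have "\<dots> = (\<Sum>y\<in>lcosets Q. act x (e f (rep y)))"
    proof (rule sum.cong[OF refl])
      fix y assume y: "y \<in> lcosets Q"
      have xy: "x \<otimes> rep y \<in> x <# y" using rep[OF y] by (auto simp: l_coset_def)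
      have "e (fg_act N x f) (rep (x <# y)) = e (fg_act N x f) (x \<otimes> rep y)"
        using e_coset[OF lcosets_transl(1)[OF Q.subset x y] xy spN_act[OF x f]] by simp
      also have "\<dots> = act x (e f (rep y))"
        using x rep_c[OF y] fU[OF f rep_c[OF y]] \<eta>V
        by (simp add: e_def acN act_mult m_assoc[symmetric])
      finally show "e (fg_act N x f) (rep (x <# y)) = act x (e f (rep y))" .
    qed
    also have "\<dots> = act x (r f)"
      unfolding r_def using x f by (subst act_sum) (auto simp: e_def intro!: act_V \<eta>V fU rep_c)
    finally show ?thesis .
  qed
  have r_i: "r (i v) = v" if v: "v \<in> V" for v
  proof -
    have "e (i v) (rep y) = F y v" if y: "y \<in> lcosets Q" for y
    proof -
      have g: "rep y \<in> carrier G" "y = rep y <# Q"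
        using lcoset_eq_of_mem[OF assms(2) y rep[OF y]] by auto
      have "e (i v) (rep y) = act (rep y) (F Q (act (inv (rep y)) v))"
        using g v Qc by (simp add: e_def i_def \<eta>\<theta> FV act_V)
      also have "\<dots> = F (rep y <# Q) (act (rep y) (act (inv (rep y)) v))"
        using g v Qc act_V by (intro F_act[symmetric]) auto
      finally show ?thesis using g v by simp
    qed
    then show ?thesis unfolding r_def using F_sum[OF v] by simp
  qed
  define W where "W = i ` V"
  define W' where "W' = {f \<in> fg_space N. r f = 0}"
  have W_sub: "N.subspace W"
  proof (rule N.subspaceI)
    have "i 0 = 0" using i_scale[of 0 0] by (simp only: scale_zero_left N.scale_zero_left zero_V)
    then show "0 \<in> W" unfolding W_def using zero_V by (metis imageI)
    show "a + b \<in> W" if ab: "a \<in> W" "b \<in> W" for a b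
    proof -
      obtain v v' where v: "v \<in> V" "a = i v" "v' \<in> V" "b = i v'" using ab by (auto simp: W_def)
      then have "a + b = i (v + v')" by (simp only: i_add)
      then show ?thesis using add_V[OF v(1,3)] unfolding W_def by blast
    qed
    show "fg_scale N c a \<in> W" if a: "a \<in> W" for c a
    proof -
      obtain v where v: "v \<in> V" "a = i v" using a by (auto simp: W_def)
      then have "fg_scale N c a = i (scale c v)" by (simp only: i_scale)
      then show ?thesis using scale_V[OF v(1)] unfolding W_def by blast
    qed
  qed
  have r0: "r 0 = 0" using r_scale[OF N.subspace_0[OF spN_sub], of 0]
    by (simp only: scale_zero_left N.scale_zero_left)
  have W'_sub: "N.subspace W'"
  proof (rule N.subspaceI)
    show "0 \<in> W'" unfolding W'_def using r0 N.subspace_0[OF spN_sub] by blast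
    show "a + b \<in> W'" if "a \<in> W'" "b \<in> W'" for a b
    proof -
      have ab: "a \<in> fg_space N" "b \<in> fg_space N" "r a = 0" "r b = 0" using that by (auto simp: W'_def)
      then have "r (a + b) = 0" by (simp only: r_add add_0)
      then show ?thesis unfolding W'_def using N.subspace_add[OF spN_sub ab(1,2)] by blast
    qed
    show "fg_scale N c a \<in> W'" if "a \<in> W'" for c a
      using that N.subspace_scale[OF spN_sub] by (simp add: W'_def r_scale)
  qed
  have W_inv: "fg_act N g w \<in> W" if "g \<in> carrier G" "w \<in> W" for g w
    using that act_V by (auto simp: W_def i_act[symmetric])
  have W'_inv: "fg_act N g w \<in> W'" if "g \<in> carrier G" "w \<in> W'" for g w
    using that by (simp add: W'_def spN_act r_act act_0)
  have WN: "W \<subseteq> fg_space N" unfolding W_def using iN by blast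
  have int: "W \<inter> W' = {0}"
  proof -
    have "w = 0" if w: "w \<in> W" "w \<in> W'" for w
    proof -
      obtain v where v: "v \<in> V" "w = i v" using w(1) by (auto simp: W_def)
      then have "v = 0" using w(2) r_i by (auto simp: W'_def)
      then show ?thesis using v i_scale[of 0 0] by (simp only: scale_zero_left N.scale_zero_left zero_V)
    qed
    then show ?thesis using N.subspace_0[OF W_sub] N.subspace_0[OF W'_sub] by blast
  qed
  have dec: "fg_space N = {w + w' | w w'. w \<in> W \<and> w' \<in> W'}"
  proof
    show "{w + w' | w w'. w \<in> W \<and> w' \<in> W'} \<subseteq> fg_space N"
      using WN N.subspace_add[OF spN_sub] unfolding W'_def by blast
    show "fg_space N \<subseteq> {w + w' | w w'. w \<in> W \<and> w' \<in> W'}"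
    proof
      fix f assume f: "f \<in> fg_space N"
      have ir: "i (r f) \<in> W" using rV[OF f] by (simp add: W_def)
      have d: "f - i (r f) \<in> fg_space N" using N.subspace_diff[OF spN_sub f] ir WN by blast
      have "r f = r ((f - i (r f)) + i (r f))" by (simp only: diff_add_cancel)
      also have "\<dots> = r (f - i (r f)) + r (i (r f))" using d ir WN by (intro r_add) auto
      also have "r (i (r f)) = r f" using r_i rV[OF f] by blast
      finally have eq: "r f = r (f - i (r f)) + r f" .
      have cancel: "b = 0" if "a = b + a" for a b :: 'v using that by simp
      have "r (f - i (r f)) = 0" by (rule cancel[OF eq])
      then have "f - i (r f) \<in> W'" using d by (simp add: W'_def)
      moreover have "f = i (r f) + (f - i (r f))" by (rule ext) simp
      ultimately show "f \<in> {w + w' | w w'. w \<in> W \<and> w' \<in> W'}" using ir by blast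
    qed
  qed
  have "fg_direct_sum G N W W'"
    unfolding fg_direct_sum_def fg_submodule_def
  proof (intro conjI ballI)
    show "W' \<subseteq> fg_space N" by (auto simp: W'_def)
  qed (fact WN W_sub W'_sub int dec | (rule W_inv W'_inv; assumption))+
  moreover have "fg_isomorphic G M (N\<lparr>fg_space := W\<rparr>)"
    unfolding fg_isomorphic_def
  proof (intro exI[of _ i] conjI)
    have "inj_on i V" by (rule inj_on_inverseI[of _ r]) (rule r_i)
    then show "bij_betw i V (fg_space (N\<lparr>fg_space := W\<rparr>))" by (simp add: bij_betw_def W_def)
  qed (simp_all add: i_add i_scale i_act)
  ultimately show ?thesis
    using U unfolding fg_relatively_projective_def fg_direct_summand_def N_def by blast
qed

context group
begin

lemma conjugate_subgroup:
  assumes "subgroup Q G" "g \<in> carrier G"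
  shows "subgroup ((\<lambda>q. g \<otimes> q \<otimes> inv g) ` Q) G"
proof -
  interpret Q: subgroup Q G by fact
  show ?thesis
  proof (rule subgroupI)
    show "(\<lambda>q. g \<otimes> q \<otimes> inv g) ` Q \<subseteq> carrier G" using assms(2) Q.subset by auto
    show "(\<lambda>q. g \<otimes> q \<otimes> inv g) ` Q \<noteq> {}" using Q.one_closed by blast
    show "inv a \<in> (\<lambda>q. g \<otimes> q \<otimes> inv g) ` Q" if "a \<in> (\<lambda>q. g \<otimes> q \<otimes> inv g) ` Q" for a
    proof -
      obtain q where q: "q \<in> Q" "a = g \<otimes> q \<otimes> inv g" using \<open>a \<in> _\<close> by blast
      then have "inv a = g \<otimes> inv q \<otimes> inv g" using assms(2) Q.subset
        by (simp add: inv_mult_group m_assoc subset_iff)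
      then show ?thesis using q by blast
    qed
    show "a \<otimes> b \<in> (\<lambda>q. g \<otimes> q \<otimes> inv g) ` Q"
      if "a \<in> (\<lambda>q. g \<otimes> q \<otimes> inv g) ` Q" "b \<in> (\<lambda>q. g \<otimes> q \<otimes> inv g) ` Q" for a b
    proof -
      obtain q r where q: "q \<in> Q" "a = g \<otimes> q \<otimes> inv g" "r \<in> Q" "b = g \<otimes> r \<otimes> inv g"
        using \<open>a \<in> _\<close> \<open>b \<in> _\<close> by blast
      have c: "q \<in> carrier G" "r \<in> carrier G" using q Q.subset by auto
      have "a \<otimes> b = g \<otimes> (q \<otimes> r) \<otimes> inv g"
        using assms(2) c by (simp add: q(2,4) m_assoc[symmetric]) (simp add: m_assoc)
      then show ?thesis using q by blast
    qed
  qed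
qed

lemma l_coset_r_coset:
  assumes "x \<in> carrier G" "y \<subseteq> carrier G" "g \<in> carrier G"
  shows "(x <# y) #> g = x <# (y #> g)"
  using assms by (force simp: l_coset_def r_coset_def m_assoc)

text \<open>
  The coset \<open>x (g Q g\<^sup>-\<^sup>1)\<close> becomes \<open>(x g) Q\<close> after multiplication by \<open>g\<close> on the right, which commutes
  with all left translations.
\<close>

lemma conjugate_lcosets_bij:
  assumes "subgroup Q G" "g \<in> carrier G"
  shows "bij_betw (\<lambda>y. y #> g) (lcosets ((\<lambda>q. g \<otimes> q \<otimes> inv g) ` Q)) (lcosets Q)"
proof -
  interpret Q: subgroup Q G by fact
  let ?Q' = "(\<lambda>q. g \<otimes> q \<otimes> inv g) ` Q"
  have Q': "?Q' \<subseteq> carrier G" using assms(2) Q.subset by auto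
  have Q'g: "?Q' #> g = g <# Q"
  proof -
    have "g \<otimes> q \<otimes> inv g \<otimes> g = g \<otimes> q" if "q \<in> Q" for q
      using that assms(2) Q.subset by (simp add: m_assoc subset_iff)
    then show ?thesis by (force simp: l_coset_def r_coset_def)
  qed
  have 1: "(x <# ?Q') #> g = (x \<otimes> g) <# Q" if "x \<in> carrier G" for x
    using l_coset_r_coset[OF that Q' assms(2)] lcos_m_assoc[OF Q.subset that assms(2)] Q'g by simp
  have 2: "(x <# Q) #> inv g = (x \<otimes> inv g) <# ?Q'" if "x \<in> carrier G" for x
  proof -
    have "(((x \<otimes> inv g) <# ?Q') #> g) #> inv g = (x \<otimes> inv g) <# ?Q'"
      using that assms(2) Q' by (simp add: coset_mult_assoc l_coset_subset_G)
    moreover have "((x \<otimes> inv g) <# ?Q') #> g = x <# Q"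
      using 1[of "x \<otimes> inv g"] that assms(2) by (simp add: m_assoc)
    ultimately show ?thesis by simp
  qed
  show ?thesis
  proof (rule bij_betw_byWitness[where f' = "\<lambda>y. y #> inv g"])
    show "\<forall>y\<in>lcosets ?Q'. y #> g #> inv g = y"
      using lcosets_transl(2)[OF Q' one_closed] assms(2) by (simp add: coset_mult_assoc)
    show "\<forall>y\<in>lcosets Q. y #> inv g #> g = y"
      using lcosets_transl(2)[OF Q.subset one_closed] assms(2) by (simp add: coset_mult_assoc)
    show "(\<lambda>y. y #> g) ` (lcosets ?Q') \<subseteq> lcosets Q"
      using assms(2) by (auto simp: lcosets_iff 1 intro!: bexI[of _ "_ \<otimes> g"])
    show "(\<lambda>y. y #> inv g) ` (lcosets Q) \<subseteq> lcosets ?Q'"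
      using assms(2) by (auto simp: lcosets_iff 2 intro!: bexI[of _ "_ \<otimes> inv g"])
  qed
qed

lemma lcoset_pow_fixed:
  assumes "x \<in> carrier G" "y \<subseteq> carrier G"
  shows "((\<lambda>y. x <# y) ^^ j) y = (x [^] j) <# y"
proof (induction j)
  case 0
  then show ?case using assms by (simp add: lcos_mult_one)
next
  case (Suc j)
  have "x <# ((x [^] j) <# y) = (x \<otimes> x [^] j) <# y" using assms by (simp add: lcos_m_assoc)
  also have "x \<otimes> x [^] j = x [^] Suc j" using assms nat_pow_Suc2 by simp
  finally show ?case using Suc by simp
qed

end

context fg_mod
begin

lemma trace_decomposition_conjugate:
  assumes "subgroup Q G" "g \<in> carrier G" "trace_decomposition G Q M F"
  shows "trace_decomposition G ((\<lambda>q. g \<otimes> q \<otimes> inv g) ` Q) M (\<lambda>y. F (y #> g))"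
proof -
  let ?Q' = "(\<lambda>q. g \<otimes> q \<otimes> inv g) ` Q"
  note bij = conjugate_lcosets_bij[OF assms(1,2)]
  have in_l: "y #> g \<in> lcosets Q" if "y \<in> lcosets ?Q'" for y
    using bij_betwE[OF bij] that by blast
  have "(\<Sum>y\<in>lcosets ?Q'. F (y #> g) v) = (\<Sum>y\<in>lcosets Q. F y v)" for v
    by (rule sum.reindex_bij_betw[OF bij])
  moreover have "F ((x <# y) #> g) (act x v) = act x (F (y #> g) v)"
    if "x \<in> carrier G" "y \<in> lcosets ?Q'" "v \<in> V" for x y v
  proof -
    have "y \<subseteq> carrier G"
      using lcosets_transl(2)[OF subgroup.subset[OF conjugate_subgroup[OF assms(1,2)]] one_closed that(2)] .
    then show ?thesis
      using assms(3) that in_l[OF that(2)] assms(2)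
      by (simp add: l_coset_r_coset trace_decomposition_def)
  qed
  ultimately show ?thesis
    using assms(3) in_l by (auto simp: trace_decomposition_def)
qed

lemma trace_decomposition_self: "trace_decomposition G (carrier G) M (\<lambda>_ v. v)"
proof -
  have "lcosets (carrier G) = {carrier G}"
    using lcoset_fixed[OF subgroup_self] one_closed by (auto simp: LCOSETS_def)
  then show ?thesis by (simp add: trace_decomposition_def linear_endo_def)
qed

text \<open>
  A subgroup \<open>Q\<close> of least order among those to which the module is relatively projective is a vertex,
  and so is each of its conjugates. An element that fixes the coset \<open>g Q\<close> lies in \<open>g Q g\<^sup>-\<^sup>1\<close>.
\<close>

lemma vertex_containing:
  assumes fin: "finite (carrier G)" and "fg_indecomposable G M" and "X \<subseteq> carrier G"
    and fixed: "\<And>Q F. subgroup Q G \<Longrightarrow> trace_decomposition G Q M F \<Longrightarrow>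
      \<exists>y\<in>lcosets Q. \<forall>x\<in>X. x <# y = y"
  shows "\<exists>Q. is_vertex G M Q \<and> X \<subseteq> Q"
proof -
  define P where "P Q \<longleftrightarrow> subgroup Q G \<and> fg_relatively_projective G Q M" for Q
  have "P (carrier G)"
    unfolding P_def
    using relatively_projective_if_trace_decomposition[OF fin subgroup_self trace_decomposition_self]
      subgroup_self by blast
  \<comment> \<open>Least order is used instead of minimality for inclusion, as it passes to conjugates.\<close>
  then obtain Q where Q: "P Q" and min: "\<And>R. P R \<Longrightarrow> card Q \<le> card R"
    using ex_has_least_nat[of P "carrier G" card] by blast
  have sQ: "subgroup Q G" using Q by (simp add: P_def)
  interpret Q: subgroup Q G by (rule sQ)
  obtain F where F: "trace_decomposition G Q M F"
    using trace_decomposition_if_relatively_projective[OF fin sQ] Q by (auto simp: P_def)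
  obtain g where g: "g \<in> carrier G" and gX: "\<And>x. x \<in> X \<Longrightarrow> x <# (g <# Q) = g <# Q"
    using fixed[OF sQ F] by (auto simp: lcosets_iff)
  define Q' where "Q' = (\<lambda>q. g \<otimes> q \<otimes> inv g) ` Q"
  have sQ': "subgroup Q' G" unfolding Q'_def by (rule conjugate_subgroup[OF sQ g])
  have "fg_relatively_projective G Q' M"
    using relatively_projective_if_trace_decomposition[OF fin sQ'] trace_decomposition_conjugate[OF sQ g F]
    unfolding Q'_def by blast
  moreover have "card Q' \<le> card Q"
    unfolding Q'_def using finite_subset[OF Q.subset fin] by (rule card_image_le)
  then have "\<not> fg_relatively_projective G R M" if "subgroup R G" "R \<subset> Q'" for R
  proof -
    have "card R < card Q'"
      using that finite_subset[OF subgroup.subset[OF sQ'] fin] by (simp add: psubset_card_mono)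
    then show ?thesis using min[of R] that \<open>card Q' \<le> card Q\<close> by (auto simp: P_def)
  qed
  moreover have "X \<subseteq> Q'"
  proof
    fix x assume x: "x \<in> X"
    then have xc: "x \<in> carrier G" using assms(3) by blast
    have "x \<otimes> g \<in> x <# (g <# Q)" using lcos_self[OF g sQ] unfolding l_coset_def[of G x] by blast
    then have "x \<otimes> g \<in> g <# Q" using gX[OF x] by simp
    then obtain q where q: "q \<in> Q" "x \<otimes> g = g \<otimes> q" by (auto simp: l_coset_def)
    then have "x = g \<otimes> q \<otimes> inv g" using xc g Q.subset by (metis inv_solve_right m_closed subsetD)
    then show "x \<in> Q'" using q by (auto simp: Q'_def)
  qed
  ultimately show ?thesis
    using sQ' is_fg_module assms(2) unfolding is_vertex_def by blast
qed

text \<open>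
  The counting argument. Without a common fixed coset, \<open>\<phi> z = (\<Sum>y. \<phi> (F y z))\<close> reduces first to the
  cosets fixed by \<open>X\<close>, where \<open>F y\<close> commutes with \<open>X\<close>, and then to \<open>d\<close>-orbits of such cosets. As
  \<open>F (d\<^sup>j y) = d\<^sup>j (F y) d\<^sup>-\<^sup>j\<close>, such an orbit contributes an average of the kind assumed to vanish.
\<close>

lemma fixed_coset_exists:
  assumes p: "prime p" "CHAR('f) = p" and fin: "finite (carrier G)"
    and Q: "subgroup Q G" and F: "trace_decomposition G Q M F"
    and X: "X \<subseteq> carrier G" "d \<in> carrier G"
    and order: "\<And>x. x \<in> insert d X \<Longrightarrow> x [^] p = \<one>"
    and comm: "\<And>x y. x \<in> insert d X \<Longrightarrow> y \<in> X \<Longrightarrow> x \<otimes> y = y \<otimes> x"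
    and \<phi>_add: "\<And>v w. v \<in> V \<Longrightarrow> w \<in> V \<Longrightarrow> \<phi> (v + w) = \<phi> v + (\<phi> w :: 'f)"
    and \<phi>_inv: "\<And>x v. x \<in> X \<Longrightarrow> v \<in> V \<Longrightarrow> \<phi> (act x v) = \<phi> v"
    and z: "z \<in> V" "\<And>x. x \<in> X \<Longrightarrow> act x z = z" "\<phi> z \<noteq> 0"
    and avg: "\<And>f. linear_endo M f \<Longrightarrow> (\<And>x v. x \<in> X \<Longrightarrow> v \<in> V \<Longrightarrow> f (act x v) = act x (f v)) \<Longrightarrow>
      (\<Sum>j<p. \<phi> (act (d [^] j) (f (act (inv (d [^] j)) z)))) = 0"
  shows "\<exists>y\<in>lcosets Q. \<forall>x\<in>insert d X. x <# y = y"
proof (rule ccontr)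
  assume none: "\<not> ?thesis"
  interpret Q: subgroup Q G by (rule Q)
  have endo: "\<And>y. y \<in> lcosets Q \<Longrightarrow> linear_endo M (F y)"
    and F_act: "\<And>x y v. x \<in> carrier G \<Longrightarrow> y \<in> lcosets Q \<Longrightarrow> v \<in> V \<Longrightarrow> F (x <# y) (act x v) = act x (F y v)"
    and F_sum: "\<And>v. v \<in> V \<Longrightarrow> (\<Sum>y\<in>lcosets Q. F y v) = v"
    using F by (auto simp: trace_decomposition_def)
  have FV: "F y v \<in> V" if "y \<in> lcosets Q" "v \<in> V" for y v
    using endo that by (auto simp: linear_endo_def)
  have sub: "y \<subseteq> carrier G" if "y \<in> lcosets Q" for y
    using lcosets_transl(2)[OF Q.subset one_closed that] .
  define a where "a y = \<phi> (F y z)" for y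
  have finl: "finite (lcosets Q)" using fin by (simp add: LCOSETS_def)
  have "\<phi> (0 + 0) = \<phi> 0 + \<phi> 0" by (rule \<phi>_add) auto
  then have \<phi>0: "\<phi> 0 = 0" by (simp only: add_0_right add_cancel_right_right)
  have "\<phi> z = \<phi> (\<Sum>y\<in>lcosets Q. F y z)" using F_sum z by simp
  also have "\<dots> = sum a (lcosets Q)"
    unfolding a_def
    by (rule sum_additive_on[where S = V]) (use \<phi>0 \<phi>_add add_V FV z in auto)
  also have "\<dots> = sum a {y \<in> lcosets Q. \<forall>x\<in>X. x <# y = y}"
  proof (rule sum_commuting_invariant[OF p finl])
    show "finite X" using X(1) fin finite_subset by blast
    show "x <# y \<in> lcosets Q" if "x \<in> X" "y \<in> lcosets Q" for x y
      using lcosets_transl(1)[OF Q.subset] that X by blast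
    show "((\<lambda>y. x <# y) ^^ p) y = y" if "x \<in> X" "y \<in> lcosets Q" for x y
      using lcoset_pow_fixed[of x y p] that X sub[of y] order[of x] by (auto simp: lcos_mult_one)
    show "x <# (x' <# y) = x' <# (x <# y)" if "x \<in> X" "x' \<in> X" "y \<in> lcosets Q" for x x' y
      using that X sub[of y] comm[of x x'] by (simp add: lcos_m_assoc subsetD)
    show "a (x <# y) = a y" if "x \<in> X" "y \<in> lcosets Q" for x y
    proof -
      have "a (x <# y) = \<phi> (F (x <# y) (act x z))" using z(2)[OF that(1)] by (simp add: a_def)
      also have "\<dots> = \<phi> (act x (F y z))" using F_act that X z(1) by (simp add: subset_iff)
      also have "\<dots> = a y" using \<phi>_inv that FV z(1) by (simp add: a_def)
      finally show ?thesis .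
    qed
  qed
  also have "\<dots> = sum a {y \<in> {y \<in> lcosets Q. \<forall>x\<in>X. x <# y = y}. d <# y = y}"
  proof (rule sum_prime_cyclic[OF p(1)])
    fix y assume "y \<in> {y \<in> lcosets Q. \<forall>x\<in>X. x <# y = y}"
    then have y: "y \<in> lcosets Q" "\<And>x. x \<in> X \<Longrightarrow> x <# y = y" by auto
    show "((\<lambda>y. d <# y) ^^ p) y = y"
      using lcoset_pow_fixed[of d y p] X sub[of y] y order[of d] by (auto simp: lcos_mult_one)
    have "x <# (d <# y) = d <# y" if "x \<in> X" for x
    proof -
      have "x <# (d <# y) = d <# (x <# y)"
        using that X sub[OF y(1)] comm[of d x] by (simp add: lcos_m_assoc subsetD)
      then show ?thesis using y(2)[OF that] by simp
    qed
    then show "d <# y \<in> {y \<in> lcosets Q. \<forall>x\<in>X. x <# y = y}"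
      using lcosets_transl(1)[OF Q.subset X(2) y(1)] by simp
    have "a (((\<lambda>y. d <# y) ^^ j) y) = \<phi> (act (d [^] j) (F y (act (inv (d [^] j)) z)))" for j
    proof -
      have dj: "d [^] j \<in> carrier G" using X(2) by simp
      have "a (((\<lambda>y. d <# y) ^^ j) y) = \<phi> (F ((d [^] j) <# y) (act (d [^] j) (act (inv (d [^] j)) z)))"
        using lcoset_pow_fixed[OF X(2) sub[OF y(1)]] dj z(1) by (simp add: a_def)
      then show ?thesis
        using F_act[OF dj y(1) act_V[OF inv_closed[OF dj] z(1)]] by simp
    qed
    moreover have "F y (act x v) = act x (F y v)" if "x \<in> X" "v \<in> V" for x v
      using F_act[of x y v] y(2)[OF that(1)] y(1) that X by auto
    ultimately show "(\<Sum>j<p. a (((\<lambda>y. d <# y) ^^ j) y)) = 0"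
      using avg[OF endo[OF y(1)]] by simp
  qed (use finl in auto)
  also have "{y \<in> {y \<in> lcosets Q. \<forall>x\<in>X. x <# y = y}. d <# y = y} = {}" using none by auto
  finally show False using z(3) by simp
qed

end

section \<open>Hook Specht modules as spaces of alternating functions\<close>

text \<open>
  The hook partition \<open>(n - r, 1\<^sup>r)\<close>. Its first column has \<open>r + 1\<close> boxes; the \<open>r\<close> boxes below the first
  row are \<open>(Suc i, 0)\<close> for \<open>i < r\<close>.
\<close>

locale hook =
  fixes n r :: nat
  assumes r_pos: "0 < r" and r_less: "r < n"
begin

definition lam :: "nat list" where "lam = (n - r) # replicate r 1"

lemma sum_lam: "sum_list lam = n"
  using r_less by (simp add: lam_def sum_list_replicate)

lemma diagram_iff: "(i, j) \<in> diagram lam \<longleftrightarrow> (i = 0 \<and> j < n - r) \<or> (\<exists>i'<r. i = Suc i' \<and> j = 0)"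
  by (cases i) (auto simp: diagram_def lam_def)

lemma diagram_eq: "diagram lam = (\<lambda>j. (0, j)) ` {..<n - r} \<union> (\<lambda>i. (Suc i, 0)) ` {..<r}"
  by (auto simp: diagram_iff)

text \<open>
  A tabloid of hook shape is determined by the entries \<open>u 0, \<dots>, u (r - 1)\<close> of its lower rows, which are
  \<open>r\<close> distinct points. For other \<open>u\<close> the set \<open>tabloid_with u\<close> below is empty, hence not a tabloid, so that
  functions supported on tabloids vanish there.
\<close>

definition admissible :: "(nat \<Rightarrow> nat) \<Rightarrow> bool" where
  "admissible u \<longleftrightarrow> inj_on u {..<r} \<and> u ` {..<r} \<subseteq> {1..n}"

definition tabloid_with :: "(nat \<Rightarrow> nat) \<Rightarrow> tabl" where
  "tabloid_with u = {t. tableau lam t \<and> (\<forall>i<r. t (Suc i, 0) = u i)}"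

lemma tabloid_with_cong: "(\<And>i. i < r \<Longrightarrow> u i = u' i) \<Longrightarrow> tabloid_with u = tabloid_with u'"
  by (auto simp: tabloid_with_def)

lemma tableau_inj: "tableau lam t \<Longrightarrow> inj_on t (diagram lam)"
  and tableau_range: "tableau lam t \<Longrightarrow> b \<in> diagram lam \<Longrightarrow> t b \<in> {1..n}"
  unfolding tableau_def sum_lam by (auto simp: bij_betw_def simp del: One_nat_def)

lemma tableau_outside: "tableau lam t \<Longrightarrow> b \<notin> diagram lam \<Longrightarrow> t b = 0"
  unfolding tableau_def by blast

lemma admissible_lower:
  assumes "tableau lam t" shows "admissible (\<lambda>i. t (Suc i, 0))"
proof -
  have "inj_on (\<lambda>i. t (Suc i, 0)) {..<r}"
  proof (rule inj_onI)
    fix i j assume "i \<in> {..<r}" "j \<in> {..<r}" "t (Suc i, 0) = t (Suc j, 0)"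
    then show "i = j" using inj_onD[OF tableau_inj[OF assms], of "(Suc i, 0)" "(Suc j, 0)"]
      by (auto simp: diagram_iff)
  qed
  moreover have "t (Suc i, 0) \<in> {1..n}" if "i < r" for i
    using tableau_range[OF assms] that by (simp add: diagram_iff)
  ultimately show ?thesis by (auto simp: admissible_def)
qed

lemma tableau_exists:
  assumes "admissible u" and y: "y \<in> {1..n} - u ` {..<r}"
  obtains t where "tableau lam t" "\<And>i. i < r \<Longrightarrow> t (Suc i, 0) = u i" "t (0, 0) = y"
proof -
  define B where "B = {1..n} - u ` {..<r}"
  have "card (u ` {..<r}) = r" using assms(1) by (simp add: admissible_def card_image)
  then have "card B = n - r" using assms(1) by (simp add: B_def admissible_def card_Diff_subset)
  then obtain \<beta>0 where \<beta>0: "bij_betw \<beta>0 {..<n - r} B"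
    using ex_bij_betw_nat_finite[of B] by (auto simp: B_def atLeast0LessThan)
  have 0: "0 < n - r" using r_less by simp
  have B0: "\<beta>0 0 \<in> B" using \<beta>0 0 by (auto simp: bij_betw_def)
  have "transpose y (\<beta>0 0) permutes B" using y B0 by (intro permutes_swap_id) (auto simp: B_def)
  then have \<beta>: "bij_betw (transpose y (\<beta>0 0) \<circ> \<beta>0) {..<n - r} B"
    using \<beta>0 permutes_imp_bij bij_betw_trans by blast
  define t where "t b = (if fst b = 0 then (if snd b < n - r then transpose y (\<beta>0 0) (\<beta>0 (snd b)) else 0)
      else if fst b \<le> r \<and> snd b = 0 then u (fst b - 1) else 0)" for b :: "nat \<times> nat"
  have "bij_betw t ((\<lambda>j. (0, j)) ` {..<n - r}) B"
  proof -
    have "bij_betw (t \<circ> (\<lambda>j. (0, j))) {..<n - r} B"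
      using \<beta> by (rule bij_betw_cong[THEN iffD1, rotated]) (simp add: t_def)
    then show ?thesis by (subst bij_betw_comp_iff[of "\<lambda>j. (0, j)"]) (auto simp: bij_betw_def inj_on_def)
  qed
  moreover have "bij_betw t ((\<lambda>i. (Suc i, 0)) ` {..<r}) (u ` {..<r})"
  proof -
    have "bij_betw u {..<r} (u ` {..<r})" using assms(1) by (simp add: admissible_def bij_betw_def)
    then have "bij_betw (t \<circ> (\<lambda>i. (Suc i, 0))) {..<r} (u ` {..<r})"
      by (rule bij_betw_cong[THEN iffD1, rotated]) (simp add: t_def)
    then show ?thesis by (subst bij_betw_comp_iff[of "\<lambda>i. (Suc i, 0)"]) (auto simp: bij_betw_def inj_on_def)
  qed
  ultimately have "bij_betw t (diagram lam) (B \<union> u ` {..<r})"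
    unfolding diagram_eq by (rule bij_betw_combine) (auto simp: B_def)
  moreover have "B \<union> u ` {..<r} = {1..n}" using assms(1) by (auto simp: B_def admissible_def)
  moreover have "t b = 0" if "b \<notin> diagram lam" for b
    using that by (cases b, cases "fst b") (auto simp: t_def diagram_iff)
  ultimately have "tableau lam t" unfolding tableau_def sum_lam by auto
  moreover have "t (Suc i, 0) = u i" if "i < r" for i using that by (simp add: t_def)
  moreover have "t (0, 0) = y" using 0 by (simp add: t_def)
  ultimately show thesis by (rule that)
qed

lemma admissible_complement:
  assumes "admissible u" obtains y where "y \<in> {1..n} - u ` {..<r}"
proof -
  have "card (u ` {..<r}) < card {1..n}"
    using assms r_less by (simp add: admissible_def card_image)
  then have "\<not> {1..n} \<subseteq> u ` {..<r}" using card_mono[of "u ` {..<r}" "{1..n}"] by force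
  then show thesis using that by blast
qed

lemma tabloid_with_nonempty_iff: "tabloid_with u \<noteq> {} \<longleftrightarrow> admissible u"
proof
  assume "tabloid_with u \<noteq> {}"
  then obtain t where t: "tableau lam t" "\<And>i. i < r \<Longrightarrow> t (Suc i, 0) = u i" by (auto simp: tabloid_with_def)
  have "inj_on (\<lambda>i. t (Suc i, 0)) {..<r} = inj_on u {..<r}" by (rule inj_on_cong) (simp add: t)
  moreover have "(\<lambda>i. t (Suc i, 0)) ` {..<r} = u ` {..<r}" by (rule image_cong) (simp_all add: t)
  ultimately show "admissible u" using admissible_lower[OF t(1)] by (simp add: admissible_def)
next
  assume "admissible u"
  then obtain y where "y \<in> {1..n} - u ` {..<r}" by (rule admissible_complement)
  then obtain t where "tableau lam t" "\<And>i. i < r \<Longrightarrow> t (Suc i, 0) = u i"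
    using tableau_exists[OF \<open>admissible u\<close>] by metis
  then show "tabloid_with u \<noteq> {}" by (auto simp: tabloid_with_def)
qed

lemma tabloid_with_eq_iff: "admissible u \<Longrightarrow> tabloid_with u = tabloid_with u' \<longleftrightarrow> (\<forall>i<r. u i = u' i)"
proof
  assume "admissible u" "tabloid_with u = tabloid_with u'"
  then obtain t where "t \<in> tabloid_with u" "t \<in> tabloid_with u'" using tabloid_with_nonempty_iff by blast
  then show "\<forall>i<r. u i = u' i" by (auto simp: tabloid_with_def)
qed (rule tabloid_with_cong, simp)

lemma tableau_image: "tableau lam t \<Longrightarrow> t ` diagram lam = {1..n}"
  unfolding tableau_def sum_lam by (simp add: bij_betw_def)

lemma tableaux_differ_by_permutation:
  assumes t: "tableau lam t" and s: "tableau lam s"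
  obtains \<pi> where "\<pi> permutes {1..n}" "s = \<pi> \<circ> t"
proof -
  define k where "k = inv_into (diagram lam) t"
  have bt: "bij_betw t (diagram lam) {1..n}" and bs: "bij_betw s (diagram lam) {1..n}"
    using t s unfolding tableau_def sum_lam by auto
  define \<pi> where "\<pi> = (\<lambda>x. if x \<in> {1..n} then s (k x) else x)"
  have "bij_betw (s \<circ> k) {1..n} {1..n}"
    unfolding k_def using bij_betw_inv_into[OF bt] bs by (rule bij_betw_trans)
  then have "bij_betw \<pi> {1..n} {1..n}"
    by (rule bij_betw_cong[THEN iffD1, rotated]) (simp add: \<pi>_def)
  then have \<pi>: "\<pi> permutes {1..n}" by (rule bij_imp_permutes) (auto simp: \<pi>_def)
  have "s b = \<pi> (t b)" for b
  proof (cases "b \<in> diagram lam")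
    case True
    then show ?thesis using tableau_range[OF t True] tableau_inj[OF t] by (simp add: \<pi>_def k_def)
  next
    case False
    then show ?thesis
      using tableau_outside[OF s] tableau_outside[OF t] permutes_not_in[OF \<pi>, of 0] by simp
  qed
  then show thesis using that[OF \<pi>] by (simp add: fun_eq_iff)
qed

text \<open>
  The row stabilizer of \<open>t\<close> fixes the entries of the rows of length one; conversely a permutation that
  relates two tableaux with the same lower entries preserves the set of entries of the first row.
\<close>

lemma tabloid_eq_tabloid_with:
  assumes "tableau lam t" shows "tabloid lam t = tabloid_with (\<lambda>i. t (Suc i, 0))"
proof
  show "tabloid lam t \<subseteq> tabloid_with (\<lambda>i. t (Suc i, 0))"
  proof
    fix s assume "s \<in> tabloid lam t"
    then obtain \<pi> where s: "s = \<pi> \<circ> t" and \<pi>: "\<pi> permutes {1..n}"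
      and row: "\<And>i j. (i, j) \<in> diagram lam \<Longrightarrow> \<exists>j'. (i, j') \<in> diagram lam \<and> \<pi> (t (i, j)) = t (i, j')"
      unfolding tabloid_def row_stabilizer_def sum_lam by blast
    have "\<pi> (t (Suc i, 0)) = t (Suc i, 0)" if "i < r" for i
      using row[of "Suc i" 0] that by (auto simp: diagram_iff)
    moreover have "bij_betw s (diagram lam) {1..n}"
      using assms permutes_imp_bij[OF \<pi>] unfolding s tableau_def sum_lam
      by (blast intro: bij_betw_trans)
    moreover have "s b = 0" if "b \<notin> diagram lam" for b
      using tableau_outside[OF assms that] permutes_not_in[OF \<pi>, of 0] by (simp add: s)
    ultimately show "s \<in> tabloid_with (\<lambda>i. t (Suc i, 0))"
      by (auto simp: tabloid_with_def tableau_def sum_lam s)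
  qed
  show "tabloid_with (\<lambda>i. t (Suc i, 0)) \<subseteq> tabloid lam t"
  proof
    fix s assume "s \<in> tabloid_with (\<lambda>i. t (Suc i, 0))"
    then have s: "tableau lam s" and low: "\<And>i. i < r \<Longrightarrow> s (Suc i, 0) = t (Suc i, 0)" by (auto simp: tabloid_with_def)
    obtain \<pi> where \<pi>: "\<pi> permutes {1..n}" and st: "s = \<pi> \<circ> t"
      by (rule tableaux_differ_by_permutation[OF assms s])
    have \<pi>t: "\<pi> (t b) = s b" for b by (simp add: st)
    have "\<exists>j'. (i, j') \<in> diagram lam \<and> \<pi> (t (i, j)) = t (i, j')" if ij: "(i, j) \<in> diagram lam" for i j
    proof (cases i)
      case 0
      have "s (0, j) \<in> t ` diagram lam"
        using tableau_range[OF s] ij 0 tableau_image[OF assms] by simp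
      then obtain i' j' where ij': "(i', j') \<in> diagram lam" "s (0, j) = t (i', j')" by auto
      have "i' = 0"
      proof (rule ccontr)
        assume "i' \<noteq> 0"
        then obtain a where a: "a < r" "i' = Suc a" "j' = 0" using ij' by (auto simp: diagram_iff)
        then have "s (0, j) = s (Suc a, 0)" using ij' low by simp
        then show False using inj_onD[OF tableau_inj[OF s], of "(0, j)" "(Suc a, 0)"] ij 0 a
          by (auto simp: diagram_iff)
      qed
      then show ?thesis using ij' \<pi>t 0 by auto
    next
      case (Suc a)
      then have "a < r" "j = 0" using ij by (auto simp: diagram_iff)
      then show ?thesis using \<pi>t low[of a] ij Suc by auto
    qed
    then have "\<pi> \<in> row_stabilizer lam t" unfolding row_stabilizer_def sum_lam using \<pi> by auto
    then show "s \<in> tabloid lam t" unfolding tabloid_def using st by blast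
  qed
qed

lemma tabloids_eq: "tabloids lam = tabloid_with ` {u. admissible u}"
proof
  show "tabloids lam \<subseteq> tabloid_with ` {u. admissible u}"
    unfolding tabloids_def using tabloid_eq_tabloid_with admissible_lower by auto
  show "tabloid_with ` {u. admissible u} \<subseteq> tabloids lam"
  proof
    fix S assume "S \<in> tabloid_with ` {u. admissible u}"
    then obtain u where u: "S = tabloid_with u" "admissible u" by blast
    then obtain t where t: "tableau lam t" "\<And>i. i < r \<Longrightarrow> t (Suc i, 0) = u i"
      using tabloid_with_nonempty_iff[of u] by (auto simp: tabloid_with_def)
    then have "tabloid_with u = tabloid lam t" using tabloid_eq_tabloid_with[OF t(1)] tabloid_with_cong[of u "\<lambda>i. t (Suc i, 0)"] by simp
    then show "S \<in> tabloids lam" unfolding tabloids_def u using t(1) by blast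
  qed
qed

lemma tabloid_with_in_tabloids_iff: "tabloid_with u \<in> tabloids lam \<longleftrightarrow> admissible u"
proof
  assume "tabloid_with u \<in> tabloids lam"
  then obtain u' where "admissible u'" "tabloid_with u = tabloid_with u'" by (auto simp: tabloids_eq)
  then show "admissible u" using tabloid_with_nonempty_iff by metis
qed (auto simp: tabloids_eq)

lemma act_tabloid_with:
  assumes "\<pi> permutes {1..n}" shows "act_tabloid \<pi> (tabloid_with u) = tabloid_with (\<pi> \<circ> u)"
proof -
  have sub: "act_tabloid \<pi> (tabloid_with u) \<subseteq> tabloid_with (\<pi> \<circ> u)" if \<pi>: "\<pi> permutes {1..n}" for \<pi> u
  proof
    fix s assume "s \<in> act_tabloid \<pi> (tabloid_with u)"
    then obtain t where t: "tableau lam t" "\<And>i. i < r \<Longrightarrow> t (Suc i, 0) = u i" "s = \<pi> \<circ> t"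
      by (auto simp: act_tabloid_def tabloid_with_def)
    have "bij_betw s (diagram lam) {1..n}"
      using t(1) permutes_imp_bij[OF \<pi>] unfolding t(3) tableau_def sum_lam
      by (blast intro: bij_betw_trans)
    moreover have "s b = 0" if "b \<notin> diagram lam" for b
      using tableau_outside[OF t(1) that] permutes_not_in[OF \<pi>, of 0] by (simp add: t(3))
    ultimately show "s \<in> tabloid_with (\<pi> \<circ> u)" using t by (auto simp: tabloid_with_def tableau_def sum_lam)
  qed
  show ?thesis
  proof
    show "act_tabloid \<pi> (tabloid_with u) \<subseteq> tabloid_with (\<pi> \<circ> u)" using sub assms .
    show "tabloid_with (\<pi> \<circ> u) \<subseteq> act_tabloid \<pi> (tabloid_with u)"
    proof
      fix s assume s: "s \<in> tabloid_with (\<pi> \<circ> u)"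
      have "inv' \<pi> \<circ> s \<in> tabloid_with (inv' \<pi> \<circ> (\<pi> \<circ> u))"
        using sub[OF permutes_inv[OF assms], of "\<pi> \<circ> u"] s by (auto simp: act_tabloid_def)
      then have "inv' \<pi> \<circ> s \<in> tabloid_with u" using permutes_inv_o(2)[OF assms] by (simp add: o_assoc)
      moreover have "s = \<pi> \<circ> (inv' \<pi> \<circ> s)" using permutes_inv_o(1)[OF assms] by (simp add: o_assoc)
      ultimately show "s \<in> act_tabloid \<pi> (tabloid_with u)" unfolding act_tabloid_def by blast
    qed
  qed
qed

text \<open>
  Only the first column has more than one box.
\<close>

lemma column_stabilizer_eq:
  assumes "tableau lam t"
  shows "column_stabilizer lam t = {\<pi>. \<pi> permutes (\<lambda>i. t (i, 0)) ` {..r}}" (is "_ = {\<pi>. \<pi> permutes ?Y}")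
proof -
  have dg: "(i, 0) \<in> diagram lam \<longleftrightarrow> i \<le> r" for i
    using r_less by (cases i) (auto simp: diagram_iff)
  have Y: "?Y \<subseteq> {1..n}" using tableau_range[OF assms] dg by auto
  show ?thesis
  proof (rule Set.set_eqI, rule iffI)
    fix \<pi> assume "\<pi> \<in> column_stabilizer lam t"
    then have \<pi>: "\<pi> permutes {1..n}"
      and col: "\<And>i j. (i, j) \<in> diagram lam \<Longrightarrow> \<exists>i'. (i', j) \<in> diagram lam \<and> \<pi> (t (i, j)) = t (i', j)"
      unfolding column_stabilizer_def sum_lam by blast+
    have "\<pi> x = x" if x: "x \<in> {1..n} - ?Y" for x
    proof -
      have "x \<in> t ` diagram lam" using x assms unfolding tableau_def sum_lam by (auto simp: bij_betw_def)
      then obtain i j where ij: "(i, j) \<in> diagram lam" "x = t (i, j)" by auto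
      have "j \<noteq> 0" using x ij dg by auto
      then show ?thesis using col[OF ij(1)] ij by (auto simp: diagram_iff)
    qed
    then show "\<pi> \<in> {\<pi>. \<pi> permutes ?Y}" using permutes_superset[OF \<pi>] by blast
  next
    fix \<pi> assume "\<pi> \<in> {\<pi>. \<pi> permutes ?Y}"
    then have \<pi>: "\<pi> permutes ?Y" by simp
    have "\<exists>i'. (i', j) \<in> diagram lam \<and> \<pi> (t (i, j)) = t (i', j)" if ij: "(i, j) \<in> diagram lam" for i j
    proof (cases "j = 0")
      case True
      then have "t (i, j) \<in> ?Y" using ij dg by auto
      then have "\<pi> (t (i, j)) \<in> ?Y" using permutes_in_image[OF \<pi>] by blast
      then show ?thesis using True dg by auto
    next
      case False
      have "t (i, j) \<notin> ?Y"
        using inj_onD[OF tableau_inj[OF assms], of "(i, j)"] ij dg False by auto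
      then show ?thesis using permutes_not_in[OF \<pi>] ij by auto
    qed
    then show "\<pi> \<in> column_stabilizer lam t"
      unfolding column_stabilizer_def sum_lam using permutes_subset[OF \<pi> Y] by auto
  qed
qed

end

lemma eq_uminus_self_iff:
  fixes a :: "'f::field" assumes "(2::'f) \<noteq> 0" shows "a = - a \<longleftrightarrow> a = 0"
proof
  assume "a = - a"
  then have "a + a = 0" by (metis add.right_inverse)
  then have "2 * a = 0" by (simp only: mult_2)
  then show "a = 0" using assms by simp
qed simp

context hook
begin

lemma scale_vector_space: "vector_space (\<lambda>(c::'f::field) (v :: tabl \<Rightarrow> 'f) S. c * v S)"
  by standard (auto simp: fun_eq_iff algebra_simps)

text \<open>
  A function \<open>z\<close> on tabloids is read as the function \<open>u \<mapsto> z (tabloid_with u)\<close> of \<open>r\<close> points. The cycles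
  are those that are alternating and whose sum over the argument at position 0, hence at any position,
  is zero. In terms of the simplex with vertices \<open>1, \<dots>, n\<close> they are the simplicial \<open>r - 1\<close>-cycles, and
  a polytabloid is the boundary of the face spanned by a first column.
\<close>

definition cycles :: "(tabl \<Rightarrow> 'f::field) set" where
  "cycles = {z. (\<forall>S. S \<notin> tabloids lam \<longrightarrow> z S = 0) \<and>
     (\<forall>u i j. i < r \<longrightarrow> j < r \<longrightarrow> i \<noteq> j \<longrightarrow> z (tabloid_with (u \<circ> transpose i j)) = - z (tabloid_with u)) \<and>
     (\<forall>u. (\<Sum>x\<in>{1..n}. z (tabloid_with (u(0 := x)))) = 0)}"

lemma cycles_outside: "z \<in> cycles \<Longrightarrow> S \<notin> tabloids lam \<Longrightarrow> z S = 0"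
  and cycles_transpose: "z \<in> cycles \<Longrightarrow> i < r \<Longrightarrow> j < r \<Longrightarrow> i \<noteq> j \<Longrightarrow> z (tabloid_with (u \<circ> transpose i j)) = - z (tabloid_with u)"
  and cycles_closed: "z \<in> cycles \<Longrightarrow> (\<Sum>x\<in>{1..n}. z (tabloid_with (u(0 := x)))) = 0"
  by (simp_all add: cycles_def)

lemma cycles_bad: "z \<in> cycles \<Longrightarrow> \<not> admissible u \<Longrightarrow> z (tabloid_with u) = 0"
  using cycles_outside tabloid_with_in_tabloids_iff by blast

lemma cycles_eqI:
  assumes "z \<in> cycles" "w \<in> cycles" "\<And>u. admissible u \<Longrightarrow> z (tabloid_with u) = w (tabloid_with u)" shows "z = w"
proof
  fix S
  show "z S = w S"
  proof (cases "S \<in> tabloids lam")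
    case True
    then show ?thesis using assms(3) by (auto simp: tabloids_eq)
  qed (simp add: cycles_outside assms)
qed

lemma cycles_subspace:
  "module.subspace (\<lambda>(c::'f::field) (v :: tabl \<Rightarrow> 'f) S. c * v S) cycles"
proof -
  interpret vector_space "\<lambda>(c::'f) (v :: tabl \<Rightarrow> 'f) S. c * v S" by (rule scale_vector_space)
  show ?thesis
    by (rule subspaceI) (simp_all add: cycles_def sum.distrib sum_distrib_left[symmetric])
qed

lemma cycles_permute:
  assumes z: "z \<in> (cycles :: (tabl \<Rightarrow> 'f::field) set)" and "\<tau> permutes {..<r}"
  shows "z (tabloid_with (u \<circ> \<tau>)) = of_int (sign \<tau>) * z (tabloid_with u)"
  using assms(2) finite_lessThan[of r]
proof (induction \<tau> arbitrary: u rule: permutes_induct)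
  case id
  then show ?case by simp
next
  case (swap a b p)
  show ?case
  proof (cases "a = b")
    case False
    have "permutation p" using swap permutes_imp_permutation[of "{..<r}"] by blast
    then have "sign (transpose a b \<circ> p) = - sign p"
      using False by (simp add: sign_compose permutation_swap_id sign_swap_id)
    moreover have "z (tabloid_with (u \<circ> (transpose a b \<circ> p))) = of_int (sign p) * z (tabloid_with (u \<circ> transpose a b))"
      using swap.IH[of "u \<circ> transpose a b"] by (simp only: o_assoc)
    moreover have "z (tabloid_with (u \<circ> transpose a b)) = - z (tabloid_with u)"
      using swap(1,2) False by (intro cycles_transpose[OF z]) auto
    ultimately show ?thesis by (simp only: of_int_minus mult_minus_left mult_minus_right)
  qed (use swap in simp)
qed

text \<open>
  The hypothesis on the images says that \<open>u'\<close> is a rearrangement of \<open>u\<close>, so the two values agree up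
  to sign.
\<close>

lemma cycles_same_set:
  assumes z: "z \<in> (cycles :: (tabl \<Rightarrow> 'f::field) set)" and "admissible u" "u' ` {..<r} = u ` {..<r}" "admissible u'" "z (tabloid_with u) = 0"
  shows "z (tabloid_with u') = 0"
proof -
  define \<tau> where "\<tau> i = (if i \<in> {..<r} then inv_into {..<r} u (u' i) else i)" for i
  have bu: "bij_betw u {..<r} (u ` {..<r})" using assms by (simp add: admissible_def bij_betw_def)
  have bu': "bij_betw u' {..<r} (u ` {..<r})" using assms by (simp add: admissible_def bij_betw_def)
  have "bij_betw (inv_into {..<r} u \<circ> u') {..<r} {..<r}"
    using bu' bij_betw_inv_into[OF bu] by (rule bij_betw_trans)
  then have "bij_betw \<tau> {..<r} {..<r}"
    by (rule bij_betw_cong[THEN iffD1, rotated]) (simp add: \<tau>_def)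
  then have \<tau>: "\<tau> permutes {..<r}" by (rule bij_imp_permutes) (auto simp: \<tau>_def)
  have "u' i = (u \<circ> \<tau>) i" if "i < r" for i
  proof -
    have "u' i \<in> u ` {..<r}" using that assms(3) by blast
    then show ?thesis using that by (simp add: \<tau>_def f_inv_into_f)
  qed
  then have "tabloid_with u' = tabloid_with (u \<circ> \<tau>)" by (rule tabloid_with_cong)
  then show ?thesis using cycles_permute[OF z \<tau>, of u] assms(5) by simp
qed

lemma first_column_iff: "(i, 0) \<in> diagram lam \<longleftrightarrow> i \<le> r"
  using r_less by (cases i) (auto simp: diagram_iff)

lemma first_column_range: "tableau lam t \<Longrightarrow> i \<le> r \<Longrightarrow> t (i, 0) \<in> {1..n}"
  using tableau_range first_column_iff by blast

lemma column_permuted_tabloid: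
  assumes t: "tableau lam t" and \<pi>: "\<pi> permutes (\<lambda>i. t (i, 0)) ` {..r}"
  shows "admissible (\<pi> \<circ> (\<lambda>i. t (Suc i, 0)))"
    and "act_tabloid \<pi> (tabloid lam t) = tabloid_with (\<pi> \<circ> (\<lambda>i. t (Suc i, 0)))"
proof -
  have Y: "(\<lambda>i. t (i, 0)) ` {..r} \<subseteq> {1..n}" using first_column_range[OF t] by auto
  have \<pi>: "\<pi> permutes {1..n}" using permutes_subset[OF \<pi> Y] .
  show "admissible (\<pi> \<circ> (\<lambda>i. t (Suc i, 0)))"
    using admissible_lower[OF t] permutes_inj[OF \<pi>] permutes_in_image[OF \<pi>]
    by (auto simp: admissible_def inj_on_def image_subset_iff dest: injD)
  show "act_tabloid \<pi> (tabloid lam t) = tabloid_with (\<pi> \<circ> (\<lambda>i. t (Suc i, 0)))"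
    using act_tabloid_with[OF \<pi>] tabloid_eq_tabloid_with[OF t] by simp
qed

lemma polytabloid_eval:
  assumes t: "tableau lam t"
  shows "polytabloid lam t (tabloid_with u) =
    (\<Sum>\<pi> | \<pi> permutes (\<lambda>i. t (i, 0)) ` {..r}.
      of_int (sign \<pi>) * (if \<forall>i<r. u i = \<pi> (t (Suc i, 0)) then 1 else (0::'f::field)))"
proof -
  have "tabloid_with u = act_tabloid \<pi> (tabloid lam t) \<longleftrightarrow> (\<forall>i<r. u i = \<pi> (t (Suc i, 0)))"
    if "\<pi> permutes (\<lambda>i. t (i, 0)) ` {..r}" for \<pi>
    using column_permuted_tabloid[OF t that] tabloid_with_eq_iff[of "\<pi> \<circ> (\<lambda>i. t (Suc i, 0))" u]
    by (auto simp: eq_commute)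
  then show ?thesis
    unfolding polytabloid_def column_stabilizer_eq[OF t] sum_fun_apply tabloid_vec_def
    by (intro sum.cong) auto
qed

lemma polytabloid_outside:
  assumes t: "tableau lam t" and "S \<notin> tabloids lam" shows "polytabloid lam t S = 0"
proof -
  have "S \<noteq> act_tabloid \<pi> (tabloid lam t)" if "\<pi> permutes (\<lambda>i. t (i, 0)) ` {..r}" for \<pi>
    using column_permuted_tabloid[OF t that] tabloid_with_in_tabloids_iff assms(2) by auto
  then show ?thesis
    unfolding polytabloid_def column_stabilizer_eq[OF t] sum_fun_apply tabloid_vec_def
    by (intro sum.neutral) auto
qed

lemma first_column_inj: "tableau lam t \<Longrightarrow> inj_on (\<lambda>i. t (i, 0)) {..r}"
  using inj_on_subset[OF tableau_inj, of t "(\<lambda>i. (i, 0)) ` {..r}"] first_column_iff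
  by (auto simp: inj_on_def)

text \<open>
  Both properties come from composing the permutations of the first column with a transposition: of
  two lower entries for the alternation, and of the top entry with the first lower entry for the
  sum over the argument at position 0, which that transposition leaves unchanged up to sign.
\<close>

lemma polytabloid_cycles:
  assumes two: "(2::'f::field) \<noteq> 0" and t: "tableau lam t"
  shows "polytabloid lam t \<in> (cycles :: (tabl \<Rightarrow> 'f) set)"
proof -
  define y where "y i = t (i, 0)" for i
  define Y where "Y = y ` {..r}"
  have yinj: "y i = y j \<longleftrightarrow> i = j" if "i \<le> r" "j \<le> r" for i j
    using first_column_inj[OF t] that by (auto simp: y_def inj_on_def)
  define E where "E u \<pi> = of_int (sign \<pi>) * (if \<forall>i<r. u i = \<pi> (y (Suc i)) then 1 else (0::'f))"
    for u and \<pi> :: "nat \<Rightarrow> nat"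
  have PT: "polytabloid lam t (tabloid_with u) = (\<Sum>\<pi> | \<pi> permutes Y. E u \<pi>)" for u
    using polytabloid_eval[OF t, of u] by (simp add: E_def Y_def y_def)
  have sgn: "sign (\<pi> \<circ> transpose (y a) (y b)) = - sign \<pi>" if "\<pi> permutes Y" "a \<le> r" "b \<le> r" "a \<noteq> b" for \<pi> a b
  proof -
    have "permutation \<pi>" using that(1) permutes_imp_permutation[of Y] by (auto simp: Y_def)
    then show ?thesis using yinj that by (simp add: sign_compose permutation_swap_id sign_swap_id)
  qed
  have yY: "transpose (y a) (y b) permutes Y" if "a \<le> r" "b \<le> r" for a b
    using that by (intro permutes_swap_id) (auto simp: Y_def)
  have tr: "transpose (y (Suc a)) (y (Suc b)) (y (Suc i)) = y (Suc (transpose a b i))"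
    if "a < r" "b < r" "i < r" for a b i
    using that yinj by (auto simp: transpose_def Suc_le_eq)
  have alt: "polytabloid lam t (tabloid_with (u \<circ> transpose a b)) = - (polytabloid lam t (tabloid_with u) :: 'f)"
    if ab: "a < r" "b < r" "a \<noteq> b" for u a b
  proof -
    let ?\<sigma> = "transpose (y (Suc a)) (y (Suc b))"
    have "E u (\<pi> \<circ> ?\<sigma>) = - E (u \<circ> transpose a b) \<pi>" if "\<pi> permutes Y" for \<pi>
    proof -
      have "(\<forall>i<r. u i = (\<pi> \<circ> ?\<sigma>) (y (Suc i))) \<longleftrightarrow> (\<forall>i<r. u i = \<pi> (y (Suc (transpose a b i))))"
        using tr ab by simp
      also have "\<dots> \<longleftrightarrow> (\<forall>i<r. u (transpose a b i) = \<pi> (y (Suc i)))"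
      proof -
        have "transpose a b i < r" if "i < r" for i using ab that by (simp add: transpose_def)
        then show ?thesis by (metis transpose_involutory)
      qed
      finally show ?thesis using sgn[OF that, of "Suc a" "Suc b"] ab by (simp add: E_def)
    qed
    moreover have "(\<Sum>\<pi> | \<pi> permutes Y. E u \<pi>) = (\<Sum>\<pi> | \<pi> permutes Y. E u (\<pi> \<circ> ?\<sigma>))"
      using ab by (intro sum_permutations_compose_right yY) auto
    ultimately show ?thesis unfolding PT by (simp add: sum_negf)
  qed
  have closed: "(\<Sum>x\<in>{1..n}. polytabloid lam t (tabloid_with (u(0 := x)))) = (0::'f)" for u
  proof -
    define D where "D \<pi> = of_int (sign \<pi>) * (if \<forall>i<r. 0 < i \<longrightarrow> u i = \<pi> (y (Suc i)) then 1 else (0::'f))"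
      for \<pi> :: "nat \<Rightarrow> nat"
    have Yn: "Y \<subseteq> {1..n}" using first_column_range[OF t] by (auto simp: Y_def y_def)
    have "(\<Sum>x\<in>{1..n}. E (u(0 := x)) \<pi>) = D \<pi>" if "\<pi> permutes Y" for \<pi>
    proof -
      have r1: "Suc 0 \<le> r" using r_pos by simp
      have "\<pi> (y (Suc 0)) \<in> Y" using permutes_in_image[OF that] r1 by (auto simp: Y_def)
      then have mem: "\<pi> (y (Suc 0)) \<in> {1..n}" using Yn by blast
      have "E (u(0 := x)) \<pi> = (if x = \<pi> (y (Suc 0)) then D \<pi> else 0)" for x
      proof -
        have "(\<forall>i<r. (u(0 := x)) i = \<pi> (y (Suc i))) \<longleftrightarrow>
            x = \<pi> (y (Suc 0)) \<and> (\<forall>i<r. 0 < i \<longrightarrow> u i = \<pi> (y (Suc i)))"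
          using r_pos by (auto split: if_splits)
        then show ?thesis by (simp add: E_def D_def)
      qed
      then show ?thesis using mem by simp
    qed
    then have "(\<Sum>x\<in>{1..n}. polytabloid lam t (tabloid_with (u(0 := x)))) = (\<Sum>\<pi> | \<pi> permutes Y. D \<pi>)"
      unfolding PT by (subst sum.swap) simp
    also have "\<dots> = 0"
    proof -
      let ?\<sigma> = "transpose (y 0) (y (Suc 0))"
      have "D (\<pi> \<circ> ?\<sigma>) = - D \<pi>" if "\<pi> permutes Y" for \<pi>
      proof -
        have "?\<sigma> (y (Suc i)) = y (Suc i)" if "i < r" "0 < i" for i
          using that yinj[of "Suc i" 0] yinj[of "Suc i" "Suc 0"] by (simp add: transpose_def)
        then have "(\<forall>i<r. 0 < i \<longrightarrow> u i = (\<pi> \<circ> ?\<sigma>) (y (Suc i))) \<longleftrightarrow>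
            (\<forall>i<r. 0 < i \<longrightarrow> u i = \<pi> (y (Suc i)))" by simp
        then show ?thesis using sgn[OF that, of 0 "Suc 0"] r_pos by (simp add: D_def)
      qed
      moreover have "(\<Sum>\<pi> | \<pi> permutes Y. D \<pi>) = (\<Sum>\<pi> | \<pi> permutes Y. D (\<pi> \<circ> ?\<sigma>))"
        using r_pos by (intro sum_permutations_compose_right yY) auto
      ultimately have "(\<Sum>\<pi> | \<pi> permutes Y. D \<pi>) = - (\<Sum>\<pi> | \<pi> permutes Y. D \<pi>)"
        by (simp add: sum_negf)
      then show ?thesis using eq_uminus_self_iff[OF two] by blast
    qed
    finally show ?thesis .
  qed
  show ?thesis
    unfolding cycles_def using polytabloid_outside[OF t] alt closed by blast
qed

lemma polytabloid_eq_0: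
  assumes t: "tableau lam t" and "\<not> u ` {..<r} \<subseteq> (\<lambda>i. t (i, 0)) ` {..r}"
  shows "polytabloid lam t (tabloid_with u) = (0::'f::field)"
  unfolding polytabloid_eval[OF t]
proof (intro sum.neutral ballI)
  fix \<pi> assume "\<pi> \<in> {\<pi>. \<pi> permutes (\<lambda>i. t (i, 0)) ` {..r}}"
  then have \<pi>: "\<pi> permutes (\<lambda>i. t (i, 0)) ` {..r}" by simp
  have "u i \<in> (\<lambda>i. t (i, 0)) ` {..r}" if "\<forall>i<r. u i = \<pi> (t (Suc i, 0))" "i < r" for i
  proof -
    have "t (Suc i, 0) \<in> (\<lambda>i. t (i, 0)) ` {..r}" using \<open>i < r\<close> by (intro image_eqI[of _ _ "Suc i"]) auto
    then show ?thesis using that permutes_in_image[OF \<pi>] by auto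
  qed
  then have "\<not> (\<forall>i<r. u i = \<pi> (t (Suc i, 0)))" using assms(2) by blast
  then show "of_int (sign \<pi>) * (if \<forall>i<r. u i = \<pi> (t (Suc i, 0)) then 1 else (0::'f)) = 0"
    by (simp only: if_False mult_zero_right)
qed

text \<open>
  A permutation of the first column is determined by its values at the lower entries, so a single
  term of the sum survives.
\<close>

lemma polytabloid_eq_sign:
  assumes t: "tableau lam t" and \<sigma>: "\<sigma> permutes (\<lambda>i. t (i, 0)) ` {..r}"
  shows "polytabloid lam t (tabloid_with (\<lambda>i. \<sigma> (t (Suc i, 0)))) = (of_int (sign \<sigma>) :: 'f::field)"
proof -
  let ?Y = "(\<lambda>i. t (i, 0)) ` {..r}"
  have "(\<forall>i<r. \<sigma> (t (Suc i, 0)) = \<pi> (t (Suc i, 0))) \<longleftrightarrow> \<pi> = \<sigma>" if \<pi>: "\<pi> permutes ?Y" for \<pi>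
  proof
    assume eq: "\<forall>i<r. \<sigma> (t (Suc i, 0)) = \<pi> (t (Suc i, 0))"
    define \<rho> where "\<rho> = inv' \<sigma> \<circ> \<pi>"
    have \<rho>: "\<rho> permutes ?Y" unfolding \<rho>_def using permutes_compose[OF \<pi> permutes_inv[OF \<sigma>]] .
    have fx: "\<rho> (t (Suc i, 0)) = t (Suc i, 0)" if "i < r" for i
      using eq that permutes_inverses(2)[OF \<sigma>] by (simp add: \<rho>_def flip: eq)
    have "\<rho> x = x" if x: "x \<in> ?Y - {t (0, 0)}" for x
    proof -
      obtain i where i: "i \<le> r" "x = t (i, 0)" "i \<noteq> 0" using x by auto
      then obtain j where "i = Suc j" using not0_implies_Suc by blast
      then show ?thesis using fx[of j] i by simp
    qed
    then have "\<rho> permutes {t (0, 0)}" using permutes_superset[OF \<rho>] by blast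
    then have "\<rho> = id" by simp
    then have "\<sigma> \<circ> \<rho> = \<sigma>" by simp
    then show "\<pi> = \<sigma>" using permutes_inv_o(1)[OF \<sigma>] by (simp add: \<rho>_def o_assoc)
  qed simp
  then have "polytabloid lam t (tabloid_with (\<lambda>i. \<sigma> (t (Suc i, 0)))) =
      (\<Sum>\<pi> | \<pi> permutes ?Y. if \<pi> = \<sigma> then of_int (sign \<sigma>) else (0::'f))"
    unfolding polytabloid_eval[OF t] by (intro sum.cong) auto
  also have "\<dots> = of_int (sign \<sigma>)" using \<sigma> by (subst sum.delta) (auto intro: finite_permutations)
  finally show ?thesis .
qed

lemma polytabloid_lower_eq_1:
  assumes "tableau lam t" "\<And>i. i < r \<Longrightarrow> u i = t (Suc i, 0)"
  shows "polytabloid lam t (tabloid_with u) = (1::'f::field)"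
  using polytabloid_eq_sign[OF assms(1) permutes_id] tabloid_with_cong[of u "\<lambda>i. t (Suc i, 0)"] assms(2) by simp

abbreviation specht :: "('f::field, nat \<Rightarrow> nat, tabl \<Rightarrow> 'f) fg" where
  "specht \<equiv> specht_module lam"

lemma specht_scale: "fg_scale (specht :: ('f::field, nat \<Rightarrow> nat, tabl \<Rightarrow> 'f) fg) = (\<lambda>c v S. c * v S)"
  and specht_act: "fg_act (specht :: ('f, nat \<Rightarrow> nat, tabl \<Rightarrow> 'f) fg) = (\<lambda>\<pi> v S. v (act_tabloid (inv' \<pi>) S))"
  by (simp_all add: specht_module_def tabloid_module_def)

lemma specht_act_eval:
  "\<pi> permutes {1..n} \<Longrightarrow>
    fg_act (specht :: ('f::field, nat \<Rightarrow> nat, tabl \<Rightarrow> 'f) fg) \<pi> v (tabloid_with u) = v (tabloid_with (inv' \<pi> \<circ> u))"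
  by (simp only: specht_act act_tabloid_with[OF permutes_inv])

lemma ex_enumeration:
  assumes "A \<subseteq> {1..n}" "card A = r" shows "\<exists>u. admissible u \<and> u ` {..<r} = A"
proof -
  have "finite A" using assms(1) finite_subset by blast
  then obtain u where "bij_betw u {..<r} A"
    using ex_bij_betw_nat_finite[of A] assms(2) by (auto simp: atLeast0LessThan)
  then show ?thesis using assms(1) by (auto simp: admissible_def bij_betw_def)
qed

text \<open>
  This is the exactness of the simplicial chain complex of a simplex: a cycle is determined by its values
  at the \<open>r\<close>-subsets \<open>A\<close> that avoid the vertex 1, because the sum over one argument expresses every other
  value by these. Hence it is the combination, with these values as coefficients, of the polytabloids
  whose first column consists of 1 on top of the elements of \<open>A\<close>.
\<close>

lemma specht_space:
  assumes two: "(2::'f::field) \<noteq> 0"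
  shows "fg_space (specht :: ('f, nat \<Rightarrow> nat, tabl \<Rightarrow> 'f) fg) = cycles"
proof -
  interpret vector_space "\<lambda>(c::'f) (v :: tabl \<Rightarrow> 'f) S. c * v S" by (rule scale_vector_space)
  let ?P = "{polytabloid lam t | t. tableau lam t} :: (tabl \<Rightarrow> 'f) set"
  have sp: "fg_space (specht :: ('f, nat \<Rightarrow> nat, tabl \<Rightarrow> 'f) fg) = span ?P"
    by (simp add: specht_module_def tabloid_module_def)
  have "span ?P \<subseteq> cycles"
    by (rule span_minimal) (use polytabloid_cycles[OF two] cycles_subspace in auto)
  moreover have "cycles \<subseteq> span ?P"
  proof
    fix z :: "tabl \<Rightarrow> 'f" assume z: "z \<in> cycles"
    define \<A> where "\<A> = {A. A \<subseteq> {2..n} \<and> card A = r}"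
    have fin: "finite \<A>" by (rule finite_subset[of _ "Pow {2..n}"]) (auto simp: \<A>_def)
    have "\<exists>u. admissible u \<and> u ` {..<r} = A" if "A \<in> \<A>" for A
      using that by (intro ex_enumeration) (auto simp: \<A>_def)
    then obtain en where en: "\<And>A. A \<in> \<A> \<Longrightarrow> admissible (en A)" "\<And>A. A \<in> \<A> \<Longrightarrow> en A ` {..<r} = A" by metis
    have "\<exists>t. tableau lam t \<and> (\<forall>i<r. t (Suc i, 0) = en A i) \<and> t (0, 0) = 1" if "A \<in> \<A>" for A
    proof -
      have "1 \<in> {1..n} - en A ` {..<r}" using en(2)[OF that] that r_less by (auto simp: \<A>_def)
      then show ?thesis using tableau_exists[OF en(1)[OF that]] by metis
    qed
    then obtain ta where ta: "\<And>A. A \<in> \<A> \<Longrightarrow> tableau lam (ta A)"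
      "\<And>A i. A \<in> \<A> \<Longrightarrow> i < r \<Longrightarrow> ta A (Suc i, 0) = en A i" "\<And>A. A \<in> \<A> \<Longrightarrow> ta A (0, 0) = 1"
      by metis
    define w where "w = (\<Sum>A\<in>\<A>. (\<lambda>S. z (tabloid_with (en A)) * polytabloid lam (ta A) S))"
    have w_span: "w \<in> span ?P"
      unfolding w_def by (intro span_sum span_scale span_base) (use ta(1) in auto)
    then have w: "w \<in> cycles" using \<open>span ?P \<subseteq> cycles\<close> by blast
    define d where "d = z - w"
    have d: "d \<in> cycles" unfolding d_def using z w cycles_subspace subspace_diff by blast
    \<comment> \<open>The difference \<open>d\<close> vanishes at the chosen orderings of the sets in \<open>\<A>\<close>, then at all orderings, and finally at the sets that contain 1.\<close>
    have zero1: "d (tabloid_with (en A)) = 0" if A: "A \<in> \<A>" for A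
    proof -
      have "polytabloid lam (ta B) (tabloid_with (en A)) = (if B = A then 1 else (0::'f))" if B: "B \<in> \<A>" for B
      proof (cases "B = A")
        case True
        then show ?thesis using polytabloid_lower_eq_1[OF ta(1)[OF A], of "en A"] ta(2)[OF A] by simp
      next
        case False
        have col: "(\<lambda>i. ta B (i, 0)) ` {..r} = insert 1 B"
        proof -
          have "{..r} = insert 0 (Suc ` {..<r})"
            by (auto simp: image_iff Bex_def less_eq_Suc_le gr0_conv_Suc) (metis not0_implies_Suc)
          then have "(\<lambda>i. ta B (i, 0)) ` {..r} = insert 1 ((\<lambda>i. ta B (Suc i, 0)) ` {..<r})"
            using ta(3)[OF B] by (simp add: image_image)
          also have "(\<lambda>i. ta B (Suc i, 0)) ` {..<r} = B"
            using ta(2)[OF B] en(2)[OF B] by (metis (mono_tags, lifting) image_cong lessThan_iff)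
          finally show ?thesis .
        qed
        have "\<not> A \<subseteq> insert 1 B"
        proof
          assume "A \<subseteq> insert 1 B"
          then have "A \<subseteq> B" using A by (auto simp: \<A>_def)
          moreover have "finite B" "card A = card B" using A B finite_subset[of B "{2..n}"] by (auto simp: \<A>_def)
          ultimately have "A = B" using card_subset_eq by blast
          then show False using False by simp
        qed
        then show ?thesis using polytabloid_eq_0[OF ta(1)[OF B], of "en A"] en(2)[OF A] col False by simp
      qed
      then have "w (tabloid_with (en A)) = (\<Sum>B\<in>\<A>. z (tabloid_with (en B)) * (if B = A then 1 else 0))"
        unfolding w_def sum_fun_apply by (intro sum.cong) auto
      also have "\<dots> = z (tabloid_with (en A))" using fin A by (simp add: mult_delta_right)
      finally show ?thesis by (simp add: d_def)
    qed
    have zero2: "d (tabloid_with u) = 0" if u: "admissible u" "1 \<notin> u ` {..<r}" for u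
    proof -
      have "u ` {..<r} \<subseteq> {2..n}"
      proof
        fix x assume x: "x \<in> u ` {..<r}"
        have "x \<in> {1..n}" using x u(1) unfolding admissible_def by blast
        moreover have "x \<noteq> 1" using x u(2) by metis
        ultimately show "x \<in> {2..n}" by auto
      qed
      then have A: "u ` {..<r} \<in> \<A>" using u by (simp add: \<A>_def admissible_def card_image)
      show ?thesis
        by (rule cycles_same_set[OF d en(1)[OF A] _ u(1) zero1[OF A]]) (simp add: en(2)[OF A])
    qed
    have zero3: "d (tabloid_with u) = 0" if u: "admissible u" "u 0 = 1" for u
    proof -
      have inj: "inj_on u {..<r}" using u by (simp add: admissible_def)
      have "d (tabloid_with (u(0 := x))) = 0" if "x \<noteq> 1" for x
      proof (cases "admissible (u(0 := x))")
        case True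
        have "1 \<notin> (u(0 := x)) ` {..<r}"
        proof
          assume "1 \<in> (u(0 := x)) ` {..<r}"
          then obtain i where i: "i < r" "(u(0 := x)) i = 1" by auto
          then have "i \<noteq> 0" "u i = u 0" using that u(2) by (auto split: if_splits)
          then show False using inj_onD[OF inj, of i 0] i r_pos by simp
        qed
        then show ?thesis using zero2 True by blast
      qed (simp add: cycles_bad[OF d])
      then have "(\<Sum>x\<in>{1..n}. d (tabloid_with (u(0 := x)))) = (\<Sum>x\<in>{1..n}. if x = 1 then d (tabloid_with (u(0 := 1))) else 0)"
        by (intro sum.cong) auto
      also have "\<dots> = d (tabloid_with u)" using u(2) r_less by (simp add: fun_upd_idem)
      finally show ?thesis using cycles_closed[OF d, of u] by simp
    qed
    have "d (tabloid_with u) = 0" if u: "admissible u" for u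
    proof (cases "1 \<in> u ` {..<r}")
      case True
      then obtain i where i: "i < r" "u i = 1" by auto
      have tp: "transpose 0 i permutes {..<r}" using i r_pos by (intro permutes_swap_id) auto
      have g: "admissible (u \<circ> transpose 0 i)"
        using u permutes_inj_on[OF tp] permutes_image[OF tp]
        by (auto simp: admissible_def image_comp[symmetric] intro!: comp_inj_on simp del: image_comp)
      have "d (tabloid_with (u \<circ> transpose 0 i)) = 0" by (rule zero3[OF g]) (use i in simp)
      then show ?thesis
        by (rule cycles_same_set[OF d g _ u, rotated])
          (simp only: image_comp[symmetric] permutes_image[OF tp])
    qed (use zero2 u in blast)
    then have "d = 0" using d subspace_0[OF cycles_subspace] by (intro cycles_eqI) auto
    then have "z = w" by (simp add: d_def)
    then show "z \<in> span ?P" using w_span by simp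
  qed
  ultimately show ?thesis using sp by blast
qed

lemma finite_tableaux: "finite {t. tableau lam t}"
proof -
  have "finite (diagram lam)" by (simp add: diagram_eq)
  then have "finite {t. \<forall>b. (b \<in> diagram lam \<longrightarrow> t b \<in> {1..n}) \<and> (b \<notin> diagram lam \<longrightarrow> t b = 0)}"
    by (rule finite_set_of_finite_funs) simp
  then show ?thesis
    by (rule finite_subset[rotated]) (use tableau_range tableau_outside in blast)
qed

lemma act_tabloid_inv:
  assumes "\<pi> permutes {1..n}" shows "act_tabloid \<pi> (act_tabloid (inv' \<pi>) S) = S"
  using permutes_inv_o(1)[OF assms] by (simp add: act_tabloid_def image_image o_assoc)

lemma admissible_permute:
  assumes "\<pi> permutes {1..n}" "admissible u" shows "admissible (\<pi> \<circ> u)"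
  using assms(2) permutes_inj[OF assms(1)] permutes_in_image[OF assms(1)]
  by (auto simp: admissible_def inj_on_def image_subset_iff dest: injD)

lemma act_tabloid_inv_outside:
  assumes "\<pi> permutes {1..n}" "S \<notin> tabloids lam" shows "act_tabloid (inv' \<pi>) S \<notin> tabloids lam"
proof
  assume "act_tabloid (inv' \<pi>) S \<in> tabloids lam"
  then obtain u where u: "admissible u" "act_tabloid (inv' \<pi>) S = tabloid_with u" by (auto simp: tabloids_eq)
  then have "S = tabloid_with (\<pi> \<circ> u)" using act_tabloid_inv[OF assms(1), of S] act_tabloid_with[OF assms(1)] by simp
  then show False using admissible_permute[OF assms(1) u(1)] assms(2) tabloid_with_in_tabloids_iff by blast
qed

lemma specht_act_cycles:
  assumes \<pi>: "\<pi> permutes {1..n}" and z: "z \<in> (cycles :: (tabl \<Rightarrow> 'f::field) set)"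
  shows "fg_act (specht :: ('f, nat \<Rightarrow> nat, tabl \<Rightarrow> 'f) fg) \<pi> z \<in> cycles"
proof -
  let ?z = "fg_act (specht :: ('f, nat \<Rightarrow> nat, tabl \<Rightarrow> 'f) fg) \<pi> z"
  have eval: "?z (tabloid_with u) = z (tabloid_with (inv' \<pi> \<circ> u))" for u by (rule specht_act_eval[OF \<pi>])
  have "?z S = 0" if "S \<notin> tabloids lam" for S
  proof -
    have "act_tabloid (inv' \<pi>) S \<notin> tabloids lam"
      using act_tabloid_inv_outside[OF \<pi>] that by blast
    then show ?thesis using cycles_outside[OF z] by (simp add: specht_act)
  qed
  moreover have "?z (tabloid_with (u \<circ> transpose i j)) = - ?z (tabloid_with u)" if "i < r" "j < r" "i \<noteq> j" for u i j
    using cycles_transpose[OF z that, of "inv' \<pi> \<circ> u"] by (simp only: eval o_assoc)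
  moreover have "(\<Sum>x\<in>{1..n}. ?z (tabloid_with (u(0 := x)))) = 0" for u
  proof -
    have "inv' \<pi> \<circ> u(0 := x) = (inv' \<pi> \<circ> u)(0 := inv' \<pi> x)" for x by (simp add: fun_eq_iff)
    then have "(\<Sum>x\<in>{1..n}. ?z (tabloid_with (u(0 := x)))) = (\<Sum>x\<in>{1..n}. z (tabloid_with ((inv' \<pi> \<circ> u)(0 := inv' \<pi> x))))"
      by (simp only: eval)
    also have "\<dots> = (\<Sum>x\<in>{1..n}. z (tabloid_with ((inv' \<pi> \<circ> u)(0 := x))))"
      by (rule sum.reindex_bij_betw[OF permutes_imp_bij[OF permutes_inv[OF \<pi>]]])
    also have "\<dots> = 0" by (rule cycles_closed[OF z])
    finally show ?thesis .
  qed
  ultimately show ?thesis unfolding cycles_def by blast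
qed

lemma specht_fg_mod:
  assumes two: "(2::'f::field) \<noteq> 0"
  shows "fg_mod (sym_group n) (specht :: ('f, nat \<Rightarrow> nat, tabl \<Rightarrow> 'f) fg)"
proof -
  let ?P = "{polytabloid lam t | t. tableau lam t} :: (tabl \<Rightarrow> 'f) set"
  have "fg_module (sym_group n) (specht :: ('f, nat \<Rightarrow> nat, tabl \<Rightarrow> 'f) fg)"
    unfolding fg_module_def specht_space[OF two] specht_scale
  proof (intro conjI ballI allI)
    show "group (sym_group n)" by (rule sym_group_is_group)
    show "vector_space (\<lambda>(c::'f) (v :: tabl \<Rightarrow> 'f) S. c * v S)" by (rule scale_vector_space)
    show "module.subspace (\<lambda>(c::'f) (v :: tabl \<Rightarrow> 'f) S. c * v S) cycles" by (rule cycles_subspace)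
    have "?P = polytabloid lam ` {t. tableau lam t}" by blast
    then have "finite ?P" using finite_tableaux by simp
    moreover have "cycles = module.span (\<lambda>(c::'f) (v :: tabl \<Rightarrow> 'f) S. c * v S) ?P"
      unfolding specht_space[OF two, symmetric] by (simp add: specht_module_def tabloid_module_def)
    ultimately show "\<exists>B. finite B \<and> cycles = module.span (\<lambda>(c::'f) (v :: tabl \<Rightarrow> 'f) S. c * v S) B"
      by blast
  next
    fix g h :: "nat \<Rightarrow> nat" and v :: "tabl \<Rightarrow> 'f"
    assume g: "g \<in> carrier (sym_group n)" and h: "h \<in> carrier (sym_group n)"
    have "bij g" "bij h" using g h permutes_bij by (auto simp: sym_group_carrier)
    then have "inv' (g \<circ> h) = inv' h \<circ> inv' g" by (rule o_inv_distrib)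
    then show "fg_act specht (g \<otimes>\<^bsub>sym_group n\<^esub> h) v = fg_act specht g (fg_act specht h v)"
      by (simp add: specht_act sym_group_mult act_tabloid_def image_image o_assoc)
  next
    fix g and v :: "tabl \<Rightarrow> 'f"
    assume "g \<in> carrier (sym_group n)" "v \<in> cycles"
    then show "fg_act specht g v \<in> cycles" using specht_act_cycles by (simp only: sym_group_carrier)
  next
    fix v :: "tabl \<Rightarrow> 'f"
    show "fg_act specht \<one>\<^bsub>sym_group n\<^esub> v = v"
      by (simp add: specht_act sym_group_one act_tabloid_def)
  qed (simp_all add: specht_act fun_eq_iff)
  then show ?thesis by (simp add: fg_mod_def fg_mod_axioms_def sym_group_is_group)
qed

lemma tableau_permute:
  assumes "\<pi> permutes {1..n}" "tableau lam t" shows "tableau lam (\<pi> \<circ> t)"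
  using assms(2) permutes_imp_bij[OF assms(1)] permutes_not_in[OF assms(1), of 0]
  unfolding tableau_def sum_lam by (auto intro: bij_betw_trans)

lemma polytabloid_transpose:
  assumes t: "tableau lam t" and ab: "a \<le> r" "b \<le> r" "a \<noteq> b"
  shows "fg_act specht (transpose (t (a, 0)) (t (b, 0))) (polytabloid lam t) S = (- polytabloid lam t S :: 'f::field)"
proof -
  let ?Y = "(\<lambda>i. t (i, 0)) ` {..r}" and ?\<sigma> = "transpose (t (a, 0)) (t (b, 0))"
  have \<sigma>Y: "?\<sigma> permutes ?Y" using ab by (intro permutes_swap_id) auto
  have \<sigma>: "?\<sigma> permutes {1..n}" using ab first_column_range[OF t] by (intro permutes_swap_id) auto
  have ne: "t (a, 0) \<noteq> t (b, 0)" using first_column_inj[OF t] ab by (auto simp: inj_on_def)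
  show ?thesis
  proof (cases "S \<in> tabloids lam")
    case True
    then obtain u where S: "S = tabloid_with u" by (auto simp: tabloids_eq)
    define E where "E u \<pi> = of_int (sign \<pi>) * (if \<forall>i<r. u i = \<pi> (t (Suc i, 0)) then 1 else (0::'f))"
      for u and \<pi> :: "nat \<Rightarrow> nat"
    have E: "polytabloid lam t (tabloid_with u) = (\<Sum>\<pi> | \<pi> permutes ?Y. E u \<pi>)" for u
      unfolding E_def by (rule polytabloid_eval[OF t])
    have "E (?\<sigma> \<circ> u) (?\<sigma> \<circ> \<pi>) = - E u \<pi>" if "\<pi> permutes ?Y" for \<pi>
    proof -
      have "permutation \<pi>" using that permutes_imp_permutation[of ?Y] by auto
      then have "sign (?\<sigma> \<circ> \<pi>) = - sign \<pi>"
        using ne by (simp add: sign_compose permutation_swap_id sign_swap_id)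
      moreover have "?\<sigma> x = ?\<sigma> y \<longleftrightarrow> x = y" for x y by (simp add: inj_eq)
      ultimately show ?thesis by (simp add: E_def)
    qed
    then have "(\<Sum>\<pi> | \<pi> permutes ?Y. E (?\<sigma> \<circ> u) (?\<sigma> \<circ> \<pi>)) = - polytabloid lam t (tabloid_with u)"
      unfolding E by (simp add: sum_negf[symmetric] del: o_apply)
    moreover have "(\<Sum>\<pi> | \<pi> permutes ?Y. E (?\<sigma> \<circ> u) (?\<sigma> \<circ> \<pi>)) = polytabloid lam t (tabloid_with (?\<sigma> \<circ> u))"
      unfolding E by (rule setum_permutations_compose_left[OF \<sigma>Y, symmetric])
    ultimately show ?thesis unfolding S specht_act_eval[OF \<sigma>] by simp
  next
    case False
    then show ?thesis
      using act_tabloid_inv_outside[OF \<sigma> False] t by (simp add: specht_act polytabloid_outside)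
  qed
qed

text \<open>
  A set of \<open>r\<close> points not contained in the first column \<open>Y\<close> misses at least two elements of \<open>Y\<close>; their
  transposition fixes the argument but changes the sign of the value, which is therefore zero. The
  other arguments are the \<open>r\<close>-subsets of \<open>Y\<close>, on which the values are determined by one of them.
\<close>

lemma column_antisymmetric_eq_multiple:
  assumes two: "(2::'f::field) \<noteq> 0" and t: "tableau lam t" and z: "z \<in> (cycles :: (tabl \<Rightarrow> 'f) set)"
    and anti: "\<And>a b S. a \<le> r \<Longrightarrow> b \<le> r \<Longrightarrow> a \<noteq> b \<Longrightarrow>
      fg_act specht (transpose (t (a, 0)) (t (b, 0))) z S = - z S"
  shows "\<exists>c. z = (\<lambda>S. c * polytabloid lam t S)"
proof -
  interpret vector_space "\<lambda>(c::'f) (v :: tabl \<Rightarrow> 'f) S. c * v S" by (rule scale_vector_space)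
  define y where "y i = t (i, 0)" for i :: nat
  define Y where "Y = y ` {..r}"
  let ?low = "\<lambda>i. y (Suc i)"
  define c where "c = z (tabloid_with ?low)"
  have "y = (\<lambda>i. t (i, 0))" by (simp add: y_def fun_eq_iff)
  then have yinj: "inj_on y {..r}" using first_column_inj[OF t] by simp
  have Yn: "Y \<subseteq> {1..n}" using first_column_range[OF t] by (auto simp: Y_def y_def)
  have cardY: "card Y = Suc r" using yinj by (simp add: Y_def card_image)
  define d where "d = z - (\<lambda>S. c * polytabloid lam t S)"
  have d: "d \<in> cycles"
    unfolding d_def using z polytabloid_cycles[OF two t] cycles_subspace subspace_diff subspace_scale by blast
  have glow: "admissible ?low" using admissible_lower[OF t] by (simp add: y_def)
  have "d (tabloid_with ?low) = 0"
    using polytabloid_lower_eq_1[OF t, of ?low, where 'f = 'f] by (simp add: d_def c_def y_def)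
  have flip: "d (tabloid_with (transpose a b \<circ> u)) = - d (tabloid_with u)" if ab: "a \<in> Y" "b \<in> Y" "a \<noteq> b" for a b u
  proof -
    obtain i j where ij: "i \<le> r" "j \<le> r" "a = t (i, 0)" "b = t (j, 0)"
      using ab(1,2) by (auto simp: Y_def y_def)
    have \<sigma>: "transpose a b permutes {1..n}" using ab Yn by (intro permutes_swap_id) auto
    have "fg_act specht (transpose a b) v (tabloid_with u) = v (tabloid_with (transpose a b \<circ> u))" for v :: "tabl \<Rightarrow> 'f"
      using specht_act_eval[OF \<sigma>, of v u] by simp
    moreover have "i \<noteq> j" using ij ab(3) by auto
    ultimately have "z (tabloid_with (transpose a b \<circ> u)) = - z (tabloid_with u)"
      "polytabloid lam t (tabloid_with (transpose a b \<circ> u)) = (- polytabloid lam t (tabloid_with u) :: 'f)"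
      using anti[OF ij(1,2), of "tabloid_with u"] polytabloid_transpose[OF t ij(1,2), of "tabloid_with u", where 'f = 'f] ij(3,4)
      by simp_all
    then show ?thesis by (simp only: d_def minus_apply mult_minus_right) simp
  qed
  have "d (tabloid_with u) = 0" if u: "admissible u" for u
  proof (cases "u ` {..<r} \<subseteq> Y")
    case True
    have "card (Y - u ` {..<r}) = 1"
      using True u cardY by (subst card_Diff_subset) (auto simp: admissible_def card_image)
    then obtain m where m: "Y - u ` {..<r} = {m}" using card_1_singletonE by blast
    then have uY: "u ` {..<r} = Y - {m}" using True by blast
    have mY: "m \<in> Y" using m by blast
    have lowY: "?low ` {..<r} = Y - {y 0}"
    proof
      show "?low ` {..<r} \<subseteq> Y - {y 0}" using yinj by (auto simp: Y_def inj_on_def)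
      show "Y - {y 0} \<subseteq> ?low ` {..<r}"
      proof
        fix x assume "x \<in> Y - {y 0}"
        then obtain i where "i \<le> r" "x = y i" "i \<noteq> 0" by (auto simp: Y_def)
        then show "x \<in> ?low ` {..<r}" by (intro image_eqI[of _ _ "i - 1"]) auto
      qed
    qed
    have y0: "y 0 \<in> Y" by (auto simp: Y_def)
    show ?thesis
    proof (cases "m = y 0")
      case True
      then show ?thesis using cycles_same_set[OF d glow _ u \<open>d (tabloid_with ?low) = 0\<close>] uY lowY by simp
    next
      case False
      let ?\<sigma> = "transpose m (y 0)"
      have \<sigma>: "?\<sigma> permutes {1..n}" using mY y0 Yn by (intro permutes_swap_id) auto
      have g: "admissible (?\<sigma> \<circ> ?low)" by (rule admissible_permute[OF \<sigma> glow])
      have "(?\<sigma> \<circ> ?low) ` {..<r} = ?\<sigma> ` (Y - {y 0})" by (simp only: image_comp[symmetric] lowY)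
      also have "\<dots> = Y - {m}" using mY y0 False by (auto simp: transpose_def image_iff)
      finally have im: "(?\<sigma> \<circ> ?low) ` {..<r} = Y - {m}" .
      have "d (tabloid_with (?\<sigma> \<circ> ?low)) = 0" using flip[OF mY y0 False] \<open>d (tabloid_with ?low) = 0\<close> by simp
      then show ?thesis using cycles_same_set[OF d g _ u] uY im by simp
    qed
  next
    case False
    have "finite Y" by (simp add: Y_def)
    have "u ` {..<r} \<inter> Y \<subset> u ` {..<r}" using False by blast
    then have "card (u ` {..<r} \<inter> Y) < card (u ` {..<r})" by (intro psubset_card_mono) auto
    also have "\<dots> = r" using u by (simp add: admissible_def card_image)
    finally have "2 \<le> card (Y - u ` {..<r})"
      using cardY card_Diff_subset_Int[of Y "u ` {..<r}"] by (simp add: Int_commute)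
    then obtain B where "B \<subseteq> Y - u ` {..<r}" "card B = 2"
      by (rule obtain_subset_with_card_n)
    then obtain a b where ab: "a \<in> Y - u ` {..<r}" "b \<in> Y - u ` {..<r}" "a \<noteq> b"
      by (auto simp: card_2_iff)
    have "tabloid_with (transpose a b \<circ> u) = tabloid_with u" using ab by (intro tabloid_with_cong) (auto simp: transpose_def)
    then have "d (tabloid_with u) = - d (tabloid_with u)" using flip[of a b u] ab by auto
    then show ?thesis using eq_uminus_self_iff[OF two] by blast
  qed
  then have "d = 0" using d subspace_0[OF cycles_subspace] by (intro cycles_eqI) auto
  then have "z = (\<lambda>S. c * polytabloid lam t S)" by (simp add: d_def)
  then show ?thesis by blast
qed

text \<open>
  The translate of a polytabloid is antisymmetric under the transpositions of the translated column,
  so it is a multiple of the translated polytabloid, and one value shows that the factor is 1.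
\<close>

lemma act_polytabloid:
  assumes two: "(2::'f::field) \<noteq> 0" and \<pi>: "\<pi> permutes {1..n}" and t: "tableau lam t"
  shows "fg_act specht \<pi> (polytabloid lam t) = (polytabloid lam (\<pi> \<circ> t) :: tabl \<Rightarrow> 'f)"
proof -
  let ?M = "specht :: ('f, nat \<Rightarrow> nat, tabl \<Rightarrow> 'f) fg" and ?e = "polytabloid lam t :: tabl \<Rightarrow> 'f"
  interpret fg_mod "sym_group n" ?M by (rule specht_fg_mod[OF two])
  have eV: "?e \<in> V" using polytabloid_cycles[OF two t] by (simp add: specht_space[OF two])
  have t': "tableau lam (\<pi> \<circ> t)" by (rule tableau_permute[OF \<pi> t])
  have anti: "act (transpose ((\<pi> \<circ> t) (a, 0)) ((\<pi> \<circ> t) (b, 0))) (act \<pi> ?e) S = - act \<pi> ?e S"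
    if ab: "a \<le> r" "b \<le> r" "a \<noteq> b" for a b S
  proof -
    let ?\<sigma> = "transpose (t (a, 0)) (t (b, 0))" and ?\<sigma>' = "transpose (\<pi> (t (a, 0))) (\<pi> (t (b, 0)))"
    have \<sigma>: "?\<sigma> permutes {1..n}" "?\<sigma>' permutes {1..n}"
      using ab first_column_range[OF t] permutes_in_image[OF \<pi>] by (auto intro!: permutes_swap_id)
    have "?\<sigma>' \<circ> \<pi> = \<pi> \<circ> ?\<sigma>"
      using permutes_inj[OF \<pi>] by (auto simp: fun_eq_iff transpose_def inj_eq)
    then have "act ?\<sigma>' (act \<pi> ?e) = act \<pi> (act ?\<sigma> ?e)"
      using act_mult[of ?\<sigma>' \<pi> ?e] act_mult[of \<pi> ?\<sigma> ?e] \<sigma> \<pi> eV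
      by (simp add: sym_group_carrier sym_group_mult)
    moreover have "act \<pi> v S = v (act_tabloid (inv' \<pi>) S)" for v :: "tabl \<Rightarrow> 'f"
      by (simp only: specht_act)
    ultimately show ?thesis by (simp only: o_apply polytabloid_transpose[OF t ab])
  qed
  obtain c where c: "act \<pi> ?e = (\<lambda>S. c * polytabloid lam (\<pi> \<circ> t) S)"
    using column_antisymmetric_eq_multiple[OF two t' specht_act_cycles[OF \<pi> polytabloid_cycles[OF two t]] anti]
    by blast
  let ?u = "\<lambda>i. (\<pi> \<circ> t) (Suc i, 0)"
  have "act \<pi> ?e (tabloid_with ?u) = ?e (tabloid_with (inv' \<pi> \<circ> ?u))" by (rule specht_act_eval[OF \<pi>])
  also have "\<dots> = 1"
    by (rule polytabloid_lower_eq_1[OF t]) (simp add: permutes_inverses(2)[OF \<pi>])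
  finally have "c = 1" using polytabloid_lower_eq_1[OF t', of ?u, where 'f = 'f] by (simp add: c)
  then show ?thesis using c by simp
qed

lemma submodule_contains_specht:
  assumes two: "(2::'f::field) \<noteq> 0" and t: "tableau lam t"
    and W: "fg_submodule (sym_group n) W (specht :: ('f, nat \<Rightarrow> nat, tabl \<Rightarrow> 'f) fg)"
    and tW: "polytabloid lam t \<in> W"
  shows "cycles \<subseteq> W"
proof -
  interpret vector_space "\<lambda>(c::'f) (v :: tabl \<Rightarrow> 'f) S. c * v S" by (rule scale_vector_space)
  have W: "subspace W" "\<And>g w. g permutes {1..n} \<Longrightarrow> w \<in> W \<Longrightarrow> fg_act specht g w \<in> W"
    using W by (auto simp: fg_submodule_def specht_scale sym_group_carrier)
  have "polytabloid lam s \<in> W" if s: "tableau lam s" for s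
  proof -
    obtain \<pi> where \<pi>: "\<pi> permutes {1..n}" and st: "s = \<pi> \<circ> t"
      by (rule tableaux_differ_by_permutation[OF t s])
    then have "polytabloid lam (\<pi> \<circ> t) = (polytabloid lam s :: tabl \<Rightarrow> 'f)" by simp
    then show ?thesis using W(2)[OF \<pi> tW] act_polytabloid[OF two \<pi> t] by simp
  qed
  then have "{polytabloid lam t | t. tableau lam t} \<subseteq> W" by blast
  then have "span {polytabloid lam t | t. tableau lam t} \<subseteq> W" using W(1) by (rule span_minimal)
  then show ?thesis
    unfolding specht_space[OF two, symmetric] by (simp add: specht_module_def tabloid_module_def)
qed

lemma ex_tableau: "\<exists>t. tableau lam t"
proof -
  obtain u where u: "admissible u" using ex_enumeration[of "{1..r}"] r_less by auto
  obtain y where "y \<in> {1..n} - u ` {..<r}" by (rule admissible_complement[OF u])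
  then show ?thesis using tableau_exists[OF u] by metis
qed

text \<open>
  The summands of a polytabloid \<open>e\<close> in a direct decomposition have the same antisymmetry as \<open>e\<close>, hence are
  multiples of \<open>e\<close>. So one of the two submodules contains \<open>e\<close>, and with it the whole Specht module.
\<close>

lemma specht_indecomposable:
  assumes two: "(2::'f::field) \<noteq> 0"
  shows "fg_indecomposable (sym_group n) (specht :: ('f, nat \<Rightarrow> nat, tabl \<Rightarrow> 'f) fg)"
proof -
  interpret fg_mod "sym_group n" "specht :: ('f, nat \<Rightarrow> nat, tabl \<Rightarrow> 'f) fg"
    by (rule specht_fg_mod[OF two])
  obtain t where t: "tableau lam t" using ex_tableau by blast
  let ?e = "polytabloid lam t :: tabl \<Rightarrow> 'f"
  have e1: "?e (tabloid_with (\<lambda>i. t (Suc i, 0))) = 1" by (rule polytabloid_lower_eq_1[OF t]) simp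
  have eC: "?e \<in> cycles" by (rule polytabloid_cycles[OF two t])
  have "W = {0} \<or> W' = {0}" if ds: "fg_direct_sum (sym_group n) specht W W'" for W W' :: "(tabl \<Rightarrow> 'f) set"
  proof -
    have sub: "fg_submodule (sym_group n) W (specht :: ('f, nat \<Rightarrow> nat, tabl \<Rightarrow> 'f) fg)"
      "fg_submodule (sym_group n) W' (specht :: ('f, nat \<Rightarrow> nat, tabl \<Rightarrow> 'f) fg)"
      and int: "W \<inter> W' = {0}" and dec: "cycles = {w + w' | w w'. w \<in> W \<and> w' \<in> W'}"
      using ds by (auto simp: fg_direct_sum_def specht_space[OF two])
    have WC: "W \<subseteq> cycles" "W' \<subseteq> cycles" "subspace W" "subspace W'"
      and Wact: "\<And>g w. g permutes {1..n} \<Longrightarrow> w \<in> W \<Longrightarrow> act g w \<in> W"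
        "\<And>g w. g permutes {1..n} \<Longrightarrow> w \<in> W' \<Longrightarrow> act g w \<in> W'"
      using sub by (auto simp: fg_submodule_def specht_space[OF two] sym_group_carrier)
    obtain a b where ab: "?e = a + b" "a \<in> W" "b \<in> W'" using eC unfolding dec by blast
    have anti: "act (transpose (t (i, 0)) (t (j, 0))) a S = - a S" if ij: "i \<le> r" "j \<le> r" "i \<noteq> j" for i j S
    proof -
      let ?\<sigma> = "transpose (t (i, 0)) (t (j, 0))"
      have \<sigma>: "?\<sigma> permutes {1..n}" using ij first_column_range[OF t] by (intro permutes_swap_id) auto
      have eq: "act ?\<sigma> a + a = - (act ?\<sigma> b + b)"
      proof
        fix S
        have "act ?\<sigma> ?e S = - ?e S" by (rule polytabloid_transpose[OF t ij])
        moreover have "act ?\<sigma> ?e S = act ?\<sigma> a S + act ?\<sigma> b S" unfolding ab(1) by (simp add: specht_act)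
        moreover have "?e S = a S + b S" unfolding ab(1) by simp
        ultimately have "act ?\<sigma> a S + act ?\<sigma> b S = - (a S + b S)" by simp
        then have "(act ?\<sigma> a S + a S) + (act ?\<sigma> b S + b S) = 0"
          unfolding eq_neg_iff_add_eq_0 by (simp only: ac_simps)
        then show "(act ?\<sigma> a + a) S = (- (act ?\<sigma> b + b)) S"
          by (simp only: eq_neg_iff_add_eq_0[symmetric] plus_fun_apply uminus_apply)
      qed
      have "act ?\<sigma> a + a \<in> W" using subspace_add[OF WC(3) Wact(1)[OF \<sigma> ab(2)] ab(2)] .
      moreover have "act ?\<sigma> a + a \<in> W'"
        unfolding eq using subspace_neg[OF WC(4) subspace_add[OF WC(4) Wact(2)[OF \<sigma> ab(3)] ab(3)]] .
      ultimately have "act ?\<sigma> a + a = 0" using int by blast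
      then have "(act ?\<sigma> a + a) S = 0" by (simp only: zero_fun_apply)
      then show ?thesis by (simp add: eq_neg_iff_add_eq_0)
    qed
    obtain c where c: "a = (\<lambda>S. c * ?e S)"
      using column_antisymmetric_eq_multiple[OF two t _ anti] ab(2) WC(1) by blast
    show ?thesis
    proof (cases "c = 0")
      case True
      then have "a = 0" using c by (simp add: fun_eq_iff)
      then have "?e = b" using ab(1) by (simp only: add_0_left)
      then have "cycles \<subseteq> W'" using submodule_contains_specht[OF two t sub(2)] ab(3) by simp
      then have "W \<subseteq> {0}" using WC(1) int by blast
      then show ?thesis using subspace_0[OF WC(3)] by blast
    next
      case False
      have "scale (inverse c) a \<in> W" using subspace_scale[OF WC(3) ab(2)] .
      moreover have "scale (inverse c) a = ?e" using False by (simp add: c specht_scale fun_eq_iff)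
      ultimately have "cycles \<subseteq> W" using submodule_contains_specht[OF two t sub(1)] by simp
      then have "W' \<subseteq> {0}" using WC(2) int by blast
      then show ?thesis using subspace_0[OF WC(4)] by blast
    qed
  qed
  moreover have "?e \<noteq> 0" using e1 by (metis zero_fun_apply zero_neq_one)
  then have "cycles \<noteq> {0 :: tabl \<Rightarrow> 'f}" using eC by blast
  ultimately show ?thesis unfolding fg_indecomposable_def specht_space[OF two] by blast
qed

end

section \<open>Cyclic shifts\<close>

definition rot :: "nat \<Rightarrow> nat \<Rightarrow> nat" where
  "rot p i = (if i < p then (i + 1) mod p else i)"

lemma rot_less: "i < p \<Longrightarrow> rot p i < p"
  by (simp add: rot_def)

lemma rot_pow: "i < p \<Longrightarrow> (rot p ^^ k) i = (i + k) mod p"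
proof (induction k)
  case (Suc k)
  then have "(rot p ^^ Suc k) i = rot p ((i + k) mod p)" by simp
  also have "\<dots> = ((i + k) mod p + 1) mod p" using Suc.prems by (simp add: rot_def)
  also have "\<dots> = (i + Suc k) mod p" by (simp add: mod_simps)
  finally show ?case .
qed simp

lemma rot_permutes: "rot p permutes {..<p}"
proof (rule bij_imp_permutes)
  have "(rot p ^^ p) i = i" if "i < p" for i using rot_pow[OF that, of p] that by simp
  then have *: "(rot p ^^ (p - 1)) (rot p i) = i" if "i < p" for i
  proof -
    have "(rot p ^^ Suc (p - 1)) i = i" using \<open>\<And>i. i < p \<Longrightarrow> (rot p ^^ p) i = i\<close>[OF that] that by simp
    then show ?thesis by (simp only: funpow_Suc_right o_apply)
  qed
  have "inj_on (rot p) {..<p}" by (rule inj_on_inverseI[of _ "rot p ^^ (p - 1)"]) (use * in auto)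
  moreover have "rot p ` {..<p} \<subseteq> {..<p}" using rot_less by auto
  ultimately show "bij_betw (rot p) {..<p} {..<p}"
    by (simp add: bij_betw_def endo_inj_surj)
qed (simp add: rot_def)

lemma sign_rot:
  assumes "odd p" shows "sign (rot p) = 1"
proof -
  have perm: "permutation (rot p)" using rot_permutes permutes_imp_permutation by blast
  have "rot p ^^ p = id"
  proof
    fix i show "(rot p ^^ p) i = id i"
    proof (cases "i < p")
      case False
      then have "(rot p ^^ k) i = i" for k by (induction k) (auto simp: rot_def)
      then show ?thesis by simp
    qed (simp add: rot_pow)
  qed
  have "permutation (rot p ^^ k) \<and> sign (rot p ^^ k) = sign (rot p) ^ k" for k
    by (induction k) (simp_all add: sign_compose permutation_compose perm del: o_apply)
  from this[of p] have "sign (rot p) ^ p = 1" using \<open>rot p ^^ p = id\<close> by simp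
  then show ?thesis using assms by (cases "rot p" rule: sign_cases) auto
qed

text \<open>
  Shifting the arguments of \<open>J\<close> cyclically is a map of order \<open>p\<close>, and its fixed points are the constant
  functions.
\<close>

lemma sum_PiE_cyclic:
  fixes a :: "(nat \<Rightarrow> nat) \<Rightarrow> 'f::semiring_1"
  assumes p: "prime p" "CHAR('f) = p"
    and inv: "\<And>J. J \<in> {..<p} \<rightarrow>\<^sub>E {..<p} \<Longrightarrow> a (J \<circ> rot p) = a J"
  shows "(\<Sum>J\<in>{..<p} \<rightarrow>\<^sub>E {..<p}. a J) = (\<Sum>j<p. a (\<lambda>i\<in>{..<p}. j))"
proof -
  let ?P = "{..<p} \<rightarrow>\<^sub>E {..<p}"
  have p0: "p > 0" using p(1) prime_gt_0_nat by blast
  have pw: "((\<lambda>J. J \<circ> rot p) ^^ k) J = J \<circ> (rot p ^^ k)" for k and J :: "nat \<Rightarrow> nat"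
  proof (induction k)
    case (Suc k)
    have "((\<lambda>J. J \<circ> rot p) ^^ Suc k) J = (J \<circ> (rot p ^^ k)) \<circ> rot p"
      by (rule ext) (simp only: funpow.simps o_apply Suc)
    also have "\<dots> = J \<circ> (rot p ^^ Suc k)" by (simp only: funpow_Suc_right o_assoc)
    finally show ?case .
  qed simp
  have cl: "J \<circ> rot p \<in> ?P" if "J \<in> ?P" for J
    using that rot_less by (auto simp: PiE_iff extensional_def rot_def)
  have "sum a ?P = sum a {J \<in> ?P. J \<circ> rot p = J}"
  proof (rule sum_prime_cyclic_invariant[OF p])
    show "finite ?P" by (intro finite_PiE) auto
    show "((\<lambda>J. J \<circ> rot p) ^^ p) J = J" if "J \<in> ?P" for J
    proof -
      have "J ((rot p ^^ p) i) = J i" for i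
      proof (cases "i < p")
        case False
        then have "(rot p ^^ k) i = i" for k by (induction k) (auto simp: rot_def)
        then show ?thesis by simp
      qed (simp add: rot_pow)
      then show ?thesis unfolding pw by (simp add: fun_eq_iff)
    qed
  qed (use cl inv in auto)
  also have "{J \<in> ?P. J \<circ> rot p = J} = (\<lambda>j. \<lambda>i\<in>{..<p}. j) ` {..<p}"
  proof (intro equalityI subsetI)
    fix J assume "J \<in> {J \<in> ?P. J \<circ> rot p = J}"
    then have J: "J \<in> ?P" "J \<circ> rot p = J" by auto
    have c: "J i = J 0" if "i < p" for i
      using that
    proof (induction i)
      case (Suc i)
      then have "J (Suc i) = (J \<circ> rot p) i" by (simp add: rot_def)
      then show ?case using Suc J(2) by simp
    qed simp
    have "J = (\<lambda>i\<in>{..<p}. J 0)"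
    proof
      fix i show "J i = (\<lambda>i\<in>{..<p}. J 0) i"
      proof (cases "i < p")
        case True
        then show ?thesis using c[OF True] by simp
      next
        case False
        then show ?thesis using J(1) by (simp add: PiE_iff extensional_def)
      qed
    qed
    moreover have "J 0 \<in> {..<p}" using J(1) p0 by (auto simp: PiE_iff)
    ultimately show "J \<in> (\<lambda>j. \<lambda>i\<in>{..<p}. j) ` {..<p}" by blast
  next
    fix J assume "J \<in> (\<lambda>j. \<lambda>i\<in>{..<p}. j) ` {..<p}"
    then obtain j where j: "j < p" "J = (\<lambda>i\<in>{..<p}. j)" by blast
    have "J (rot p i) = J i" for i by (simp add: j(2) rot_def)
    then have "J \<circ> rot p = J" by (simp add: fun_eq_iff)
    then show "J \<in> {J \<in> ?P. J \<circ> rot p = J}" using j by auto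
  qed
  also have "sum a ((\<lambda>j. \<lambda>i\<in>{..<p}. j) ` {..<p}) = (\<Sum>j<p. a (\<lambda>i\<in>{..<p}. j))"
  proof (rule sum.reindex_cong[of "\<lambda>j. \<lambda>i\<in>{..<p}. j"])
    show "inj_on (\<lambda>j. \<lambda>i\<in>{..<p}. j) {..<p}"
      by (rule inj_on_inverseI[of _ "\<lambda>J. J 0"]) (use p0 in auto)
  qed auto
  finally show ?thesis .
qed

section \<open>Exterior products of functions\<close>

text \<open>
  The determinant of the matrix \<open>f i (u j)\<close>, which is the coefficient of the exterior product of the
  functions \<open>f 0, \<dots>, f (r - 1)\<close> at the points \<open>u 0, \<dots>, u (r - 1)\<close>.
\<close>

definition wedge_coeff :: "nat \<Rightarrow> (nat \<Rightarrow> 'a \<Rightarrow> 'f::comm_ring_1) \<Rightarrow> (nat \<Rightarrow> 'a) \<Rightarrow> 'f" where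
  "wedge_coeff r f u = (\<Sum>\<pi> | \<pi> permutes {..<r}. of_int (sign \<pi>) * (\<Prod>i<r. f i (u (\<pi> i))))"

lemma sign_compose_permutes:
  "\<pi> permutes {..<r::nat} \<Longrightarrow> \<sigma> permutes {..<r} \<Longrightarrow> sign (\<pi> \<circ> \<sigma>) = sign \<pi> * sign \<sigma>"
  using sign_compose permutes_imp_permutation[of "{..<r}"] by blast

lemma wedge_coeff_cong:
  assumes "\<And>i j. i < r \<Longrightarrow> j < r \<Longrightarrow> f i (u j) = g i (v j)"
  shows "wedge_coeff r f u = wedge_coeff r g v"
  unfolding wedge_coeff_def
proof (intro sum.cong refl, simp only: mem_Collect_eq)
  fix \<pi> assume \<pi>: "\<pi> permutes {..<r}"
  have "(\<Prod>i<r. f i (u (\<pi> i))) = (\<Prod>i<r. g i (v (\<pi> i)))"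
    using permutes_in_image[OF \<pi>] by (intro prod.cong) (auto intro!: assms)
  then show "of_int (sign \<pi>) * (\<Prod>i<r. f i (u (\<pi> i))) = of_int (sign \<pi>) * (\<Prod>i<r. g i (v (\<pi> i)))" by simp
qed

lemma wedge_coeff_permute_points:
  fixes f :: "nat \<Rightarrow> 'a \<Rightarrow> 'f::comm_ring_1"
  assumes \<sigma>: "\<sigma> permutes {..<r}"
  shows "wedge_coeff r f (u \<circ> \<sigma>) = of_int (sign \<sigma>) * wedge_coeff r f u"
proof -
  have "wedge_coeff r f u =
      (\<Sum>\<pi> | \<pi> permutes {..<r}. of_int (sign (\<sigma> \<circ> \<pi>)) * (\<Prod>i<r. f i (u ((\<sigma> \<circ> \<pi>) i))))"
    unfolding wedge_coeff_def by (rule setum_permutations_compose_left[OF \<sigma>])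
  also have "\<dots> = (\<Sum>\<pi> | \<pi> permutes {..<r}. of_int (sign \<sigma>) * (of_int (sign \<pi>) * (\<Prod>i<r. f i ((u \<circ> \<sigma>) (\<pi> i)))))"
    by (intro sum.cong refl) (simp add: sign_compose_permutes[OF \<sigma>] mult.assoc)
  also have "\<dots> = of_int (sign \<sigma>) * wedge_coeff r f (u \<circ> \<sigma>)"
    by (simp add: wedge_coeff_def sum_distrib_left)
  finally have "wedge_coeff r f u = of_int (sign \<sigma>) * wedge_coeff r f (u \<circ> \<sigma>)" .
  moreover have "of_int (sign \<sigma>) * of_int (sign \<sigma>) = (1 :: 'f)" by (simp flip: of_int_mult)
  ultimately show ?thesis by (simp add: mult.assoc[symmetric])
qed

lemma wedge_coeff_permute_factors:
  assumes \<sigma>: "\<sigma> permutes {..<r}"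
  shows "wedge_coeff r (\<lambda>i. f (\<sigma> i)) u = of_int (sign \<sigma>) * wedge_coeff r f u"
proof -
  have "wedge_coeff r (\<lambda>i. f (\<sigma> i)) u =
      (\<Sum>\<pi> | \<pi> permutes {..<r}. of_int (sign (\<pi> \<circ> \<sigma>)) * (\<Prod>i<r. f (\<sigma> i) (u ((\<pi> \<circ> \<sigma>) i))))"
    unfolding wedge_coeff_def by (rule sum_permutations_compose_right[OF \<sigma>])
  also have "\<dots> = (\<Sum>\<pi> | \<pi> permutes {..<r}. of_int (sign \<sigma>) * (of_int (sign \<pi>) * (\<Prod>i<r. f i (u (\<pi> i)))))"
  proof (intro sum.cong refl, simp only: mem_Collect_eq)
    fix \<pi> assume \<pi>: "\<pi> permutes {..<r}"
    have "(\<Prod>i<r. f (\<sigma> i) (u ((\<pi> \<circ> \<sigma>) i))) = (\<Prod>i<r. f i (u (\<pi> i)))"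
      using prod.reindex_bij_betw[OF permutes_imp_bij[OF \<sigma>], of "\<lambda>i. f i (u (\<pi> i))"] by simp
    then show "of_int (sign (\<pi> \<circ> \<sigma>)) * (\<Prod>i<r. f (\<sigma> i) (u ((\<pi> \<circ> \<sigma>) i))) =
      of_int (sign \<sigma>) * (of_int (sign \<pi>) * (\<Prod>i<r. f i (u (\<pi> i))))"
      by (simp only: sign_compose_permutes[OF \<pi> \<sigma>] of_int_mult ac_simps)
  qed
  also have "\<dots> = of_int (sign \<sigma>) * wedge_coeff r f u"
    by (simp add: wedge_coeff_def sum_distrib_left)
  finally show ?thesis .
qed

lemma wedge_coeff_equal_factors:
  fixes f :: "nat \<Rightarrow> 'a \<Rightarrow> 'f::field"
  assumes two: "(2::'f) \<noteq> 0" and ij: "i < r" "j < r" "i \<noteq> j" "f i = f j"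
  shows "wedge_coeff r f u = 0"
proof -
  have "(\<lambda>k. f (transpose i j k)) = f" using ij(4) by (auto simp: transpose_def fun_eq_iff)
  then have "wedge_coeff r f u = - wedge_coeff r f u"
    using wedge_coeff_permute_factors[OF permutes_swap_id, of i r j f u] ij by (simp add: sign_swap_id)
  then show ?thesis using eq_uminus_self_iff[OF two] by blast
qed

lemma wedge_coeff_equal_points:
  fixes f :: "nat \<Rightarrow> 'a \<Rightarrow> 'f::field"
  assumes two: "(2::'f) \<noteq> 0" and ij: "i < r" "j < r" "i \<noteq> j" "u i = u j"
  shows "wedge_coeff r f u = 0"
proof -
  have "u \<circ> transpose i j = u" using ij(4) by (auto simp: transpose_def fun_eq_iff)
  then have "wedge_coeff r f u = - wedge_coeff r f u"
    using wedge_coeff_permute_points[OF permutes_swap_id, of i r j f u] ij by (simp add: sign_swap_id)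
  then show ?thesis using eq_uminus_self_iff[OF two] by blast
qed

lemma wedge_coeff_diagonal:
  assumes "\<And>i j. i < r \<Longrightarrow> j < r \<Longrightarrow> f i (u j) = (if i = j then 1 else 0)"
  shows "wedge_coeff r f u = 1"
proof -
  have "of_int (sign \<pi>) * (\<Prod>i<r. f i (u (\<pi> i))) = (if \<pi> = id then 1 else 0)" if \<pi>: "\<pi> permutes {..<r}" for \<pi>
  proof (cases "\<pi> = id")
    case False
    then obtain i where i: "\<pi> i \<noteq> i" by (auto simp: fun_eq_iff)
    then have "i < r" using permutes_not_in[OF \<pi>] by auto
    moreover have "\<pi> i < r" using permutes_in_image[OF \<pi>] \<open>i < r\<close> by auto
    ultimately have "f i (u (\<pi> i)) = 0" using assms i by auto
    then have "(\<Prod>i<r. f i (u (\<pi> i))) = 0" using \<open>i < r\<close> by (intro prod_zero) auto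
    then show ?thesis using False by simp
  qed (simp add: assms)
  then have "wedge_coeff r f u = (\<Sum>\<pi> | \<pi> permutes {..<r}. if \<pi> = id then 1 else 0)"
    unfolding wedge_coeff_def by (intro sum.cong) auto
  also have "\<dots> = 1" by (subst sum.delta) (auto simp: finite_permutations)
  finally show ?thesis .
qed

lemma wedge_coeff_sum:
  fixes g :: "nat \<Rightarrow> nat \<Rightarrow> 'a \<Rightarrow> 'f::comm_ring_1"
  assumes "finite A"
  shows "(\<Sum>J\<in>{..<r} \<rightarrow>\<^sub>E A. wedge_coeff r (\<lambda>i. g i (J i)) u) = wedge_coeff r (\<lambda>i x. \<Sum>j\<in>A. g i j x) u"
proof -
  have "(\<Sum>J\<in>{..<r} \<rightarrow>\<^sub>E A. wedge_coeff r (\<lambda>i. g i (J i)) u) =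
    (\<Sum>\<pi> | \<pi> permutes {..<r}. of_int (sign \<pi>) * (\<Sum>J\<in>{..<r} \<rightarrow>\<^sub>E A. \<Prod>i<r. g i (J i) (u (\<pi> i))))"
    unfolding wedge_coeff_def by (subst sum.swap) (simp add: sum_distrib_left)
  also have "(\<lambda>\<pi>. \<Sum>J\<in>{..<r} \<rightarrow>\<^sub>E A. \<Prod>i<r. g i (J i) (u (\<pi> i))) = (\<lambda>\<pi>. \<Prod>i<r. \<Sum>j\<in>A. g i j (u (\<pi> i)))"
    using assms by (intro ext) (simp add: prod_sum_PiE)
  finally show ?thesis by (simp only: wedge_coeff_def)
qed

lemma wedge_coeff_closed:
  fixes f :: "nat \<Rightarrow> 'a \<Rightarrow> 'f::comm_ring_1"
  assumes "0 < r" and "\<And>i. i < r \<Longrightarrow> (\<Sum>x\<in>A. f i x) = 0"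
  shows "(\<Sum>x\<in>A. wedge_coeff r f (u(0 := x))) = 0"
proof -
  have "(\<Sum>x\<in>A. \<Prod>i<r. f i ((u(0 := x)) (\<pi> i))) = 0" if \<pi>: "\<pi> permutes {..<r}" for \<pi>
  proof -
    obtain k where k: "k < r" "\<pi> k = 0"
      using permutes_image[OF \<pi>] assms(1) by (metis imageE lessThan_iff)
    have ne: "\<pi> i \<noteq> 0" if "i \<noteq> k" for i using permutes_inj[OF \<pi>] k that by (metis injD)
    have "(\<Prod>i<r. f i ((u(0 := x)) (\<pi> i))) = f k x * (\<Prod>i\<in>{..<r} - {k}. f i (u (\<pi> i)))" for x
    proof -
      have "(\<Prod>i\<in>{..<r} - {k}. f i ((u(0 := x)) (\<pi> i))) = (\<Prod>i\<in>{..<r} - {k}. f i (u (\<pi> i)))"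
      proof (rule prod.cong[OF refl])
        fix i assume "i \<in> {..<r} - {k}"
        then have "\<pi> i \<noteq> 0" using ne by blast
        then show "f i ((u(0 := x)) (\<pi> i)) = f i (u (\<pi> i))" by simp
      qed
      then show ?thesis using k by (subst prod.remove[of _ k]) auto
    qed
    then show ?thesis using assms(2)[OF k(1)] by (simp add: sum_distrib_right[symmetric])
  qed
  then show ?thesis
    unfolding wedge_coeff_def by (subst sum.swap) (simp add: sum_distrib_left[symmetric])
qed

context hook
begin

text \<open>
  The exterior product as a function on tabloids. The choice of \<open>u\<close> is harmless, as the coefficient
  depends only on the values of \<open>u\<close> below \<open>r\<close>, and these are determined by the tabloid.
\<close>

definition wedge :: "(nat \<Rightarrow> nat \<Rightarrow> 'f::field) \<Rightarrow> tabl \<Rightarrow> 'f" where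
  "wedge f S = (if S \<in> tabloids lam then wedge_coeff r f (SOME u. admissible u \<and> tabloid_with u = S) else 0)"

text \<open>
  If \<open>u\<close> is not admissible, then \<open>tabloid_with u\<close> is not a tabloid and the left hand side is zero by
  definition. So is the determinant: two of its columns agree, or one of them vanishes.
\<close>

lemma wedge_eval:
  fixes f :: "nat \<Rightarrow> nat \<Rightarrow> 'f::field"
  assumes two: "(2::'f) \<noteq> 0" and supp: "\<And>i x. i < r \<Longrightarrow> x \<notin> {1..n} \<Longrightarrow> f i x = 0"
  shows "wedge f (tabloid_with u) = wedge_coeff r f u"
proof (cases "admissible u")
  case True
  define v where "v = (SOME v. admissible v \<and> tabloid_with v = tabloid_with u)"
  have "admissible v \<and> tabloid_with v = tabloid_with u" unfolding v_def by (rule someI[of _ u]) (simp add: True)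
  then have "v i = u i" if "i < r" for i using tabloid_with_eq_iff that by blast
  then have "wedge_coeff r f v = wedge_coeff r f u" by (intro wedge_coeff_cong) simp
  then show ?thesis using True by (simp add: wedge_def tabloid_with_in_tabloids_iff v_def)
next
  case False
  have "wedge_coeff r f u = 0"
  proof (cases "inj_on u {..<r}")
    case True
    then obtain j where j: "j < r" "u j \<notin> {1..n}" using False unfolding admissible_def by blast
    have z: "(\<Prod>i<r. f i (u (\<pi> i))) = 0" if \<pi>: "\<pi> permutes {..<r}" for \<pi>
    proof -
      obtain k where "k < r" "\<pi> k = j" using permutes_image[OF \<pi>] j(1) by (metis imageE lessThan_iff)
      then show ?thesis using supp[OF _ j(2)] by (intro prod_zero) auto
    qed
    show ?thesis
      unfolding wedge_coeff_def
      by (rule sum.neutral, rule ballI, subst z) simp_all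
  next
    case False
    then obtain i j where "i < r" "j < r" "i \<noteq> j" "u i = u j" by (auto simp: inj_on_def)
    then show ?thesis by (rule wedge_coeff_equal_points[OF two])
  qed
  then show ?thesis using False by (simp add: wedge_def tabloid_with_in_tabloids_iff)
qed

lemma wedge_cycles:
  fixes f :: "nat \<Rightarrow> nat \<Rightarrow> 'f::field"
  assumes two: "(2::'f) \<noteq> 0" and supp: "\<And>i x. i < r \<Longrightarrow> x \<notin> {1..n} \<Longrightarrow> f i x = 0"
    and sum0: "\<And>i. i < r \<Longrightarrow> (\<Sum>x\<in>{1..n}. f i x) = 0"
  shows "wedge f \<in> cycles"
proof -
  have W: "wedge f (tabloid_with u) = wedge_coeff r f u" for u using two supp by (rule wedge_eval)
  show ?thesis
    unfolding cycles_def
  proof (intro CollectI conjI allI impI)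
    show "wedge f S = 0" if "S \<notin> tabloids lam" for S using that by (simp add: wedge_def)
    show "wedge f (tabloid_with (u \<circ> transpose i j)) = - wedge f (tabloid_with u)" if "i < r" "j < r" "i \<noteq> j" for u i j
      unfolding W using that
      by (subst wedge_coeff_permute_points) (auto intro: permutes_swap_id simp: sign_swap_id)
    show "(\<Sum>x\<in>{1..n}. wedge f (tabloid_with (u(0 := x)))) = 0" for u
      unfolding W by (rule wedge_coeff_closed[OF r_pos sum0])
  qed
qed

end

section \<open>Permutations contained in a vertex of a hook Specht module\<close>

lemma sym_group_pow: "x [^]\<^bsub>sym_group n\<^esub> (j::nat) = x ^^ j"
proof (induction j)
  case 0
  then show ?case by (simp add: nat_pow_def sym_group_one)
next
  case (Suc j)
  have "x [^]\<^bsub>sym_group n\<^esub> Suc j = x [^]\<^bsub>sym_group n\<^esub> j \<circ> x"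
    by (simp add: nat_pow_def sym_group_mult)
  also have "\<dots> = x ^^ Suc j" by (simp only: Suc funpow_Suc_right)
  finally show ?case .
qed

lemma permutes_funpow: "x permutes A \<Longrightarrow> x ^^ j permutes A"
  by (induction j) (simp_all only: funpow.simps permutes_id permutes_compose)

lemma commute_funpow:
  assumes "x \<circ> y = y \<circ> x" shows "x ^^ i \<circ> y ^^ j = y ^^ j \<circ> x ^^ i"
proof -
  have 1: "x \<circ> y ^^ j = y ^^ j \<circ> x" if "x \<circ> y = y \<circ> x" for x y :: "'a \<Rightarrow> 'a" and j
    by (induction j) (simp_all only: funpow.simps id_comp comp_id o_assoc that, simp only: comp_assoc[of y] that)
  show ?thesis using 1[OF 1[OF assms, symmetric]] by simp
qed

lemma sum_periodic:
  fixes f :: "nat \<Rightarrow> 'a::ab_group_add"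
  assumes "\<And>j. f (j + r) = f j"
  shows "(\<Sum>j<r. f (i + j)) = (\<Sum>j<r. f j)"
proof (induction i)
  case (Suc i)
  have "f i + (\<Sum>j<r. f (i + Suc j)) = (\<Sum>j<Suc r. f (i + j))"
    by (simp only: sum.lessThan_Suc_shift add_0_right)
  also have "\<dots> = (\<Sum>j<r. f (i + j)) + f i" using assms[of i] by simp
  finally show ?case using Suc by simp
qed simp

lemma periodic_mod:
  fixes f :: "nat \<Rightarrow> 'a"
  assumes "\<And>j. f (j + r) = f j" shows "f (j mod r) = f j"
proof -
  have "f (j mod r + r * k) = f (j mod r)" for k
  proof (induction k)
    case (Suc k)
    have "f (j mod r + r * Suc k) = f ((j mod r + r * k) + r)" by (simp add: algebra_simps)
    then show ?case using assms Suc by simp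
  qed simp
  from this[of "j div r"] show ?thesis by simp
qed

context hook
begin

lemma two_nonzero:
  assumes "prime r" "odd r" "CHAR('f::field) = r" shows "(2::'f) \<noteq> 0"
proof
  assume "(2::'f) = 0"
  then have "(of_nat 2 :: 'f) = 0" by simp
  then have "r dvd 2" using assms(3) by (simp only: of_nat_eq_0_iff_char_dvd)
  then have "r = 2" using assms(1) two_is_prime_nat primes_dvd_imp_eq by blast
  then show False using assms(2) by simp
qed

text \<open>
  The counting argument for hook Specht modules, with the value at the points \<open>xs\<close> as functional and with
  \<open>d = g\<^sup>-\<^sup>1\<close>. The inverse has the effect that only positive powers of \<open>g\<close> occur in the averages.
\<close>

lemma vertex_of_test:
  fixes z :: "tabl \<Rightarrow> 'f::field"
  assumes r: "prime r" "odd r" "CHAR('f) = r"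
    and X: "\<And>x. x \<in> insert g X \<Longrightarrow> x permutes {1..n}"
    and order: "\<And>x. x \<in> insert g X \<Longrightarrow> x ^^ r = id"
    and comm: "\<And>x y. x \<in> insert g X \<Longrightarrow> y \<in> X \<Longrightarrow> x \<circ> y = y \<circ> x"
    and \<phi>_inv: "\<And>x v. x \<in> X \<Longrightarrow> v \<in> cycles \<Longrightarrow> v (tabloid_with (inv' x \<circ> xs)) = (v (tabloid_with xs) :: 'f)"
    and z: "z \<in> cycles" "\<And>x. x \<in> X \<Longrightarrow> fg_act specht x z = z" "z (tabloid_with xs) \<noteq> 0"
    and avg: "\<And>f. linear_endo (specht :: ('f, nat \<Rightarrow> nat, tabl \<Rightarrow> 'f) fg) f \<Longrightarrow>
      (\<And>x v. x \<in> X \<Longrightarrow> v \<in> cycles \<Longrightarrow> f (fg_act specht x v) = fg_act specht x (f v)) \<Longrightarrow>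
      (\<Sum>j<r. f (fg_act specht (g ^^ j) z) (tabloid_with (g ^^ j \<circ> xs))) = 0"
  shows "\<exists>Q. is_vertex (sym_group n) (specht :: ('f, nat \<Rightarrow> nat, tabl \<Rightarrow> 'f) fg) Q \<and> insert g X \<subseteq> Q"
proof -
  let ?G = "sym_group n" and ?M = "specht :: ('f, nat \<Rightarrow> nat, tabl \<Rightarrow> 'f) fg"
  note two = two_nonzero[OF r]
  interpret fg_mod ?G ?M by (rule specht_fg_mod[OF two])
  have fin: "finite (carrier ?G)"
    using finite_permutations[of "{1..n}"] by (simp add: sym_group_def)
  have g: "g permutes {1..n}" using X by blast
  have bij: "bij (g ^^ j)" for j using permutes_bij[OF permutes_funpow[OF g]] .
  have gj: "(inv' g) ^^ j = inv' (g ^^ j)" for j using inv_fn[OF permutes_bij[OF g]] by simp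
  have gr: "g ^^ r = id" using order by blast
  have invg: "inv' g = g ^^ (r - 1)"
  proof -
    have "g \<circ> g ^^ (r - 1) = id" using gr r_pos by (simp only: funpow.simps[symmetric]) simp
    then have "inv' g \<circ> (g \<circ> g ^^ (r - 1)) = inv' g" by simp
    then show ?thesis using permutes_inv_o(2)[OF g] by (simp only: o_assoc id_comp)
  qed
  have "\<exists>Q. is_vertex ?G ?M Q \<and> insert (inv' g) X \<subseteq> Q"
  proof (rule vertex_containing[OF fin specht_indecomposable[OF two]])
    show "insert (inv' g) X \<subseteq> carrier ?G"
      using X permutes_inv[OF g] by (auto simp: sym_group_carrier)
    fix Q F assume Q: "subgroup Q ?G" and F: "trace_decomposition ?G Q ?M F"
    show "\<exists>y\<in>lcosets\<^bsub>?G\<^esub> Q. \<forall>x\<in>insert (inv' g) X. x <#\<^bsub>?G\<^esub> y = y"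
    proof (rule fixed_coset_exists[OF r(1,3) fin Q F, where \<phi> = "\<lambda>v. v (tabloid_with xs)" and z = z])
      show "X \<subseteq> carrier ?G" "inv' g \<in> carrier ?G"
        using X permutes_inv[OF g] by (auto simp: sym_group_carrier)
      show "x [^]\<^bsub>?G\<^esub> r = \<one>\<^bsub>?G\<^esub>" if x: "x \<in> insert (inv' g) X" for x
      proof -
        have "(inv' g) ^^ r = id" using gj[of r] gr by simp
        then have "x ^^ r = id" using x order by auto
        then show ?thesis by (simp add: sym_group_pow sym_group_one)
      qed
      show "x \<otimes>\<^bsub>?G\<^esub> y = y \<otimes>\<^bsub>?G\<^esub> x" if "x \<in> insert (inv' g) X" "y \<in> X" for x y
      proof (cases "x = inv' g")
        case True
        have "g \<circ> y = y \<circ> g" using comm[of g y] that(2) by blast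
        from commute_funpow[OF this, of "r - 1" 1] show ?thesis
          by (simp add: True invg sym_group_mult)
      next
        case False
        then show ?thesis using comm[of x y] that by (simp add: sym_group_mult)
      qed
      show "(v + w) (tabloid_with xs) = v (tabloid_with xs) + w (tabloid_with xs)" for v w :: "tabl \<Rightarrow> 'f" by simp
      show "act x v (tabloid_with xs) = v (tabloid_with xs)" if "x \<in> X" "v \<in> V" for x v
        using that \<phi>_inv X specht_act_eval[of x v xs] by (simp add: specht_space[OF two])
      show "z \<in> V" using z(1) by (simp add: specht_space[OF two])
      show "act x z = z" if "x \<in> X" for x using z(2)[OF that] .
      show "z (tabloid_with xs) \<noteq> 0" by (rule z(3))
      fix f assume f: "linear_endo ?M f" and fx: "\<And>x v. x \<in> X \<Longrightarrow> v \<in> V \<Longrightarrow> f (act x v) = act x (f v)"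
      have "act (inv' g [^]\<^bsub>?G\<^esub> j) (f (act (inv\<^bsub>?G\<^esub> (inv' g [^]\<^bsub>?G\<^esub> j)) z)) (tabloid_with xs) =
          f (act (g ^^ j) z) (tabloid_with (g ^^ j \<circ> xs))" for j
      proof -
        have p: "inv' (g ^^ j) permutes {1..n}" using permutes_inv[OF permutes_funpow[OF g]] .
        have "inv\<^bsub>?G\<^esub> (inv' (g ^^ j)) = g ^^ j"
          using p inv_inv_eq[OF bij] by (simp add: sym_group_carrier)
        then show ?thesis
          unfolding sym_group_pow gj using specht_act_eval[OF p] inv_inv_eq[OF bij] by simp
      qed
      then show "(\<Sum>j<r. act (inv' g [^]\<^bsub>?G\<^esub> j) (f (act (inv\<^bsub>?G\<^esub> (inv' g [^]\<^bsub>?G\<^esub> j)) z)) (tabloid_with xs)) = 0"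
        using avg[OF f] fx by (simp only: specht_space[OF two])
    qed
  qed
  then obtain Q where Q: "is_vertex ?G ?M Q" "inv' g \<in> Q" "X \<subseteq> Q" by blast
  interpret Q: subgroup Q ?G using Q(1) by (simp add: is_vertex_def)
  have "inv\<^bsub>?G\<^esub> (inv' g) \<in> Q" by (rule Q.m_inv_closed[OF Q(2)])
  moreover have "inv\<^bsub>?G\<^esub> (inv' g) = g"
    using permutes_inv[OF g] inv_inv_eq[OF permutes_bij[OF g]] by (simp add: sym_group_carrier)
  ultimately show ?thesis using Q by auto
qed

lemma wedge_cong: "(\<And>i. i < r \<Longrightarrow> f i = g i) \<Longrightarrow> wedge f = wedge g"
  unfolding wedge_def by (intro ext if_cong refl wedge_coeff_cong) simp

lemma wedge_rot:
  assumes "odd r" shows "wedge (\<lambda>i. f (rot r i)) = wedge f"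
  unfolding wedge_def
  by (intro ext if_cong refl) (simp add: wedge_coeff_permute_factors[OF rot_permutes] sign_rot[OF assms])

lemma act_wedge:
  fixes f :: "nat \<Rightarrow> nat \<Rightarrow> 'f::field"
  assumes two: "(2::'f) \<noteq> 0" and supp: "\<And>i x. i < r \<Longrightarrow> x \<notin> {1..n} \<Longrightarrow> f i x = 0"
    and \<pi>: "\<pi> permutes {1..n}"
  shows "fg_act specht \<pi> (wedge f) = wedge (\<lambda>i x. f i (inv' \<pi> x))"
proof
  fix S
  show "fg_act specht \<pi> (wedge f) S = wedge (\<lambda>i x. f i (inv' \<pi> x)) S"
  proof (cases "S \<in> tabloids lam")
    case True
    then obtain u where S: "S = tabloid_with u" by (auto simp: tabloids_eq)
    have "f i (inv' \<pi> x) = 0" if "i < r" "x \<notin> {1..n}" for i x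
      using supp[OF that(1)] that(2) permutes_not_in[OF permutes_inv[OF \<pi>] that(2)] by simp
    then have "wedge (\<lambda>i x. f i (inv' \<pi> x)) (tabloid_with u) = wedge_coeff r (\<lambda>i x. f i (inv' \<pi> x)) u"
      by (intro wedge_eval[OF two]) blast
    moreover have "wedge f (tabloid_with (inv' \<pi> \<circ> u)) = wedge_coeff r f (inv' \<pi> \<circ> u)"
      by (rule wedge_eval[OF two supp])
    moreover have "wedge_coeff r (\<lambda>i x. f i (inv' \<pi> x)) u = wedge_coeff r f (inv' \<pi> \<circ> u)"
      by (rule wedge_coeff_cong) simp
    ultimately show ?thesis unfolding S specht_act_eval[OF \<pi>] by simp
  next
    case False
    then show ?thesis using act_tabloid_inv_outside[OF \<pi> False]
      by (simp add: wedge_def specht_act)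
  qed
qed

text \<open>
  A cycle of odd length is an even permutation.
\<close>

lemma cycles_rotate:
  assumes "odd r" "v \<in> (cycles :: (tabl \<Rightarrow> 'f::field) set)" "\<And>i. i < r \<Longrightarrow> u (rot r i) = u' i"
  shows "v (tabloid_with u') = v (tabloid_with u)"
proof -
  have "tabloid_with u' = tabloid_with (u \<circ> rot r)" by (rule tabloid_with_cong) (simp add: assms(3))
  then show ?thesis using cycles_permute[OF assms(2) rot_permutes, of u] sign_rot[OF assms(1)] by simp
qed

text \<open>
  The test vector is the exterior product of the \<open>x\<^sub>i - y\<^sub>i\<close>. The set \<open>R\<close> will consist
  of the restrictions of the elements of \<open>E\<close> to the complement of the two orbits.
\<close>

lemma vertex_two_orbits:
  assumes r: "prime r" "odd r" "CHAR('f::field) = r"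
    and perm: "\<And>\<pi>. \<pi> \<in> {g1, g2} \<union> R \<Longrightarrow> \<pi> permutes {1..n}"
    and order: "\<And>\<pi>. \<pi> \<in> {g1, g2} \<union> R \<Longrightarrow> \<pi> ^^ r = id"
    and comm: "\<And>\<pi> \<rho>. \<pi> \<in> {g1, g2} \<union> R \<Longrightarrow> \<rho> \<in> {g1, g2} \<union> R \<Longrightarrow> \<pi> \<circ> \<rho> = \<rho> \<circ> \<pi>"
    and x: "x0 \<in> {1..n}" "inj_on (\<lambda>i. (g1 ^^ i) x0) {..<r}"
    and y: "y0 \<in> {1..n}"
    and disj: "\<And>i j. (g1 ^^ i) x0 \<noteq> (g2 ^^ j) y0"
    and fix1: "\<And>\<pi> i. \<pi> \<in> insert g2 R \<Longrightarrow> \<pi> ((g1 ^^ i) x0) = (g1 ^^ i) x0"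
    and fix2: "\<And>\<pi> i. \<pi> \<in> insert g1 R \<Longrightarrow> \<pi> ((g2 ^^ i) y0) = (g2 ^^ i) y0"
  shows "\<exists>Q. is_vertex (sym_group n) (specht :: ('f, nat \<Rightarrow> nat, tabl \<Rightarrow> 'f) fg) Q \<and> {g1 \<circ> g2, g2} \<union> R \<subseteq> Q"
proof -
  note two = two_nonzero[OF r]
  define xs where "xs i = (g1 ^^ i) x0" for i
  define ys where "ys i = (g2 ^^ i) y0" for i
  define h where "h = g1 \<circ> g2"
  define \<delta> where "\<delta> a b = (if b = a then 1 else (0::'f))" for a b :: nat
  define v where "v i j b = \<delta> (xs i) b - \<delta> (ys (i + j)) b" for i j b
  \<comment> \<open>Only the values of \<open>J\<close> below \<open>r\<close> matter: \<open>w J\<close> is the product of the \<open>x\<^sub>i - y\<^sub>i\<^sub>+\<^sub>J\<^sub>i\<close>.\<close>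
  define w where "w J = (wedge (\<lambda>i. v i (J i)) :: tabl \<Rightarrow> 'f)" for J
  let ?P = "{..<r} \<rightarrow>\<^sub>E {..<r}"
  have g1: "g1 permutes {1..n}" "g1 ^^ r = id" and g2: "g2 permutes {1..n}" "g2 ^^ r = id"
    using perm order by auto
  have xs_per: "xs (i + r) = xs i" and ys_per: "ys (i + r) = ys i" for i
    using g1(2) g2(2) by (simp_all add: xs_def ys_def funpow_add)
  have xs_range: "xs i \<in> {1..n}" and ys_range: "ys i \<in> {1..n}" for i
    using permutes_in_image[OF permutes_funpow[OF g1(1)]] permutes_in_image[OF permutes_funpow[OF g2(1)]] x y
    by (simp_all add: xs_def ys_def)
  have hx: "h (xs i) = xs (Suc i)" and hy: "h (ys i) = ys (Suc i)" for i
    using fix1[of g2 i] fix2[of g1 "Suc i"] by (simp_all add: h_def xs_def ys_def)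
  have gx: "g2 (xs i) = xs i" and gy: "g2 (ys i) = ys (Suc i)" for i
    using fix1[of g2 i] by (simp_all add: xs_def ys_def)
  have \<rho>x: "\<rho> (xs i) = xs i" and \<rho>y: "\<rho> (ys i) = ys i" if "\<rho> \<in> R" for \<rho> i
    using fix1[of \<rho> i] fix2[of \<rho> i] that by (simp_all add: xs_def ys_def)
  have h: "h permutes {1..n}" unfolding h_def by (rule permutes_compose[OF g2(1) g1(1)])
  have hr: "h ^^ r = id"
  proof -
    have "h ^^ k = g1 ^^ k \<circ> g2 ^^ k" for k
    proof (induction k)
      case (Suc k)
      have "g2 \<circ> g1 ^^ k = g1 ^^ k \<circ> g2"
        using commute_funpow[OF comm[of g2 g1], of 1 k] by simp
      then have "(g1 \<circ> g2) \<circ> (g1 ^^ k \<circ> g2 ^^ k) = (g1 \<circ> g1 ^^ k) \<circ> (g2 \<circ> g2 ^^ k)"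
        by (simp add: fun_eq_iff)
      then show ?case using Suc by (simp only: funpow.simps h_def)
    qed simp
    then show ?thesis using g1(2) g2(2) by simp
  qed
  have \<delta>_perm: "\<delta> a (inv' \<pi> b) = \<delta> (\<pi> a) b" if "\<pi> permutes {1..n}" for \<pi> a b
    using permutes_inv_eq[OF that, of b a] by (auto simp: \<delta>_def)
  have v_supp: "v i j b = 0" if "b \<notin> {1..n}" for i j b
    using that xs_range[of i] ys_range[of "i + j"] by (auto simp: v_def \<delta>_def)
  have v_sum: "(\<Sum>b\<in>{1..n}. v i j b) = 0" for i j
    using xs_range[of i] ys_range[of "i + j"] by (simp add: v_def \<delta>_def sum_subtractf)
  have wC: "w J \<in> cycles" for J
    unfolding w_def using v_supp v_sum by (intro wedge_cycles[OF two]) auto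
  have w_act: "fg_act specht \<pi> (w J) = wedge (\<lambda>i b. \<delta> (\<pi> (xs i)) b - \<delta> (\<pi> (ys (i + J i))) b)"
    if "\<pi> permutes {1..n}" for \<pi> J
  proof -
    have "fg_act specht \<pi> (w J) = wedge (\<lambda>i x. v i (J i) (inv' \<pi> x))"
      unfolding w_def using v_supp by (intro act_wedge[OF two _ that]) blast
    then show ?thesis by (simp only: v_def \<delta>_perm[OF that])
  qed
  have v_rot: "v (Suc i) j = v (rot r i) j" if "i < r" for i j
  proof -
    have "xs (Suc i) = xs (rot r i)"
      using periodic_mod[of xs r "Suc i"] xs_per that by (simp add: rot_def)
    moreover have "ys (Suc i + j) = ys (rot r i + j)"
      using periodic_mod[of "\<lambda>k. ys (k + j)" r "Suc i"] ys_per[of "_ + j"] that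
      by (simp add: rot_def ac_simps)
    ultimately show ?thesis by (simp add: v_def fun_eq_iff)
  qed
  have h_w: "fg_act specht h (w (J \<circ> rot r)) = w J" for J
  proof -
    have "fg_act specht h (w (J \<circ> rot r)) = wedge (\<lambda>i. v (Suc i) (J (rot r i)))"
      unfolding w_act[OF h] by (simp add: hx hy v_def[abs_def])
    also have "\<dots> = wedge (\<lambda>i. (\<lambda>i. v i (J i)) (rot r i))"
      by (rule wedge_cong) (simp add: v_rot)
    also have "\<dots> = w J" unfolding w_def by (rule wedge_rot[OF r(2)])
    finally show ?thesis .
  qed
  define z where "z = w (\<lambda>i. 0)"
  have w_const: "w (\<lambda>i\<in>{..<r}. j) = fg_act specht (g2 ^^ j) z" for j
  proof -
    have gxj: "(g2 ^^ j) (xs i) = xs i" for i by (induction j) (simp_all add: gx)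
    have gyj: "(g2 ^^ j) (ys i) = ys (i + j)" for i by (induction j) (simp_all add: gy)
    show ?thesis
      unfolding z_def w_act[OF permutes_funpow[OF g2(1)]] unfolding w_def
      by (rule wedge_cong) (simp add: gxj gyj v_def[abs_def])
  qed
  \<comment> \<open>Multilinear expansion of a product all of whose factors are equal.\<close>
  have sum_w: "(\<Sum>J\<in>?P. w J) = 0"
  proof
    fix S
    show "(\<Sum>J\<in>?P. w J) S = (0 :: tabl \<Rightarrow> 'f) S"
    proof (cases "S \<in> tabloids lam")
      case True
      then obtain u where S: "S = tabloid_with u" by (auto simp: tabloids_eq)
      have "(\<Sum>J\<in>?P. w J) S = (\<Sum>J\<in>?P. wedge_coeff r (\<lambda>i. v i (J i)) u)"
        unfolding sum_fun_apply S w_def using v_supp by (intro sum.cong refl wedge_eval[OF two]) blast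
      also have "\<dots> = wedge_coeff r (\<lambda>i b. \<Sum>j<r. v i j b) u" by (rule wedge_coeff_sum) simp
      also have "\<dots> = 0"
      proof (rule wedge_coeff_equal_factors[OF two, of 0 _ 1])
        have "(\<Sum>j<r. v i j b) = - (\<Sum>j<r. \<delta> (ys j) b)" for i b
          using sum_periodic[of "\<lambda>j. \<delta> (ys j) b" r i] ys_per of_nat_char_eq_0[OF r(3)]
          by (simp add: v_def sum_subtractf)
        then show "(\<lambda>b. \<Sum>j<r. v 0 j b) = (\<lambda>b. \<Sum>j<r. v 1 j b)" by simp
        show "0 < r" "1 < r" "(0::nat) \<noteq> 1" using prime_gt_1_nat[OF r(1)] by auto
      qed
      finally show ?thesis by simp
    next
      case False
      then show ?thesis by (simp add: sum_fun_apply w_def wedge_def)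
    qed
  qed
  have inv_xs: "u (tabloid_with (inv' \<pi> \<circ> xs)) = u (tabloid_with xs)" if "\<pi> \<in> insert h R" "u \<in> cycles" for \<pi> and u :: "tabl \<Rightarrow> 'f"
  proof (cases "\<pi> = h")
    case True
    have "(inv' h \<circ> xs) (rot r i) = xs i" if "i < r" for i
    proof -
      have "xs (rot r i) = h (xs i)"
        using periodic_mod[of xs r "Suc i"] xs_per that by (simp add: rot_def hx)
      then show ?thesis using permutes_inverses(2)[OF h] by simp
    qed
    then show ?thesis using cycles_rotate[OF r(2) that(2), of "inv' h \<circ> xs" xs] True by simp
  next
    case False
    then have "\<pi> \<in> R" using that by blast
    then have "inv' \<pi> (xs i) = xs i" for i
      using \<rho>x permutes_inv_eq[of \<pi> "{1..n}" "xs i" "xs i"] perm[of \<pi>] by simp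
    then have "inv' \<pi> \<circ> xs = xs" by (simp add: fun_eq_iff)
    then show ?thesis by simp
  qed
  have "\<exists>Q. is_vertex (sym_group n) (specht :: ('f, nat \<Rightarrow> nat, tabl \<Rightarrow> 'f) fg) Q \<and> insert g2 (insert h R) \<subseteq> Q"
  proof (rule vertex_of_test[OF r, where z = z and xs = xs])
    show "\<pi> permutes {1..n}" if "\<pi> \<in> insert g2 (insert h R)" for \<pi> using that h perm by auto
    show "\<pi> ^^ r = id" if "\<pi> \<in> insert g2 (insert h R)" for \<pi> using that hr order by auto
    have ch: "\<pi> \<circ> h = h \<circ> \<pi>" if "\<pi> \<in> {g1, g2} \<union> R" for \<pi>
    proof -
      have "\<pi> (g1 y) = g1 (\<pi> y)" "\<pi> (g2 y) = g2 (\<pi> y)" for y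
        using fun_cong[OF comm[OF that, of g1], of y] fun_cong[OF comm[OF that, of g2], of y] by simp_all
      then show ?thesis by (simp add: h_def fun_eq_iff)
    qed
    show "\<pi> \<circ> \<rho> = \<rho> \<circ> \<pi>" if \<pi>: "\<pi> \<in> insert g2 (insert h R)" and \<rho>: "\<rho> \<in> insert h R" for \<pi> \<rho>
    proof (cases "\<pi> = h")
      case True
      then show ?thesis using ch[of \<rho>] \<rho> by (cases "\<rho> = h") auto
    next
      case False
      then have "\<pi> \<in> {g1, g2} \<union> R" using \<pi> by blast
      then show ?thesis using ch[of \<pi>] comm[of \<pi> \<rho>] \<rho> by (cases "\<rho> = h") auto
    qed
    show "u (tabloid_with (inv' \<pi> \<circ> xs)) = (u (tabloid_with xs) :: 'f)" if "\<pi> \<in> insert h R" "u \<in> cycles" for \<pi> u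
      using inv_xs that .
    show "z \<in> cycles" unfolding z_def by (rule wC)
    show "fg_act specht \<pi> z = z" if \<pi>: "\<pi> \<in> insert h R" for \<pi>
    proof (cases "\<pi> = h")
      case True
      have "(\<lambda>i. 0) \<circ> rot r = (\<lambda>i. 0::nat)" by auto
      then show ?thesis using h_w[of "\<lambda>i. 0"] True by (simp only: z_def)
    next
      case False
      then have "\<pi> \<in> R" using \<pi> by blast
      then show ?thesis
        unfolding z_def using w_act[of \<pi> "\<lambda>i. 0"] perm[of \<pi>] by (simp add: \<rho>x \<rho>y w_def v_def[abs_def])
    qed
    have "z (tabloid_with xs) = wedge_coeff r (\<lambda>i. v i 0) xs"
      unfolding z_def w_def using v_supp by (intro wedge_eval[OF two]) blast
    also have "\<dots> = 1"
    proof (rule wedge_coeff_diagonal)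
      fix i j assume ij: "i < r" "j < r"
      have "xs j \<noteq> ys i" unfolding xs_def ys_def by (rule disj)
      moreover have "xs j = xs i \<longleftrightarrow> i = j" using ij x(2) by (auto simp: xs_def inj_on_def)
      ultimately show "v i 0 (xs j) = (if i = j then 1 else 0)" by (simp add: v_def \<delta>_def)
    qed
    finally show "z (tabloid_with xs) \<noteq> 0" by simp
    fix f assume f: "linear_endo (specht :: ('f, nat \<Rightarrow> nat, tabl \<Rightarrow> 'f) fg) f"
      and f_act: "\<And>\<pi> u. \<pi> \<in> insert h R \<Longrightarrow> u \<in> cycles \<Longrightarrow> f (fg_act specht \<pi> u) = fg_act specht \<pi> (f u)"
    have fC: "f u \<in> cycles" and f_add: "u' \<in> cycles \<Longrightarrow> f (u + u') = f u + f u'" if "u \<in> cycles" for u u'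
      using f that by (auto simp: linear_endo_def specht_space[OF two])
    interpret vector_space "\<lambda>(c::'f) (v :: tabl \<Rightarrow> 'f) S. c * v S" by (rule scale_vector_space)
    have zC: "0 \<in> (cycles :: (tabl \<Rightarrow> 'f) set)" by (rule subspace_0[OF cycles_subspace])
    have f0: "f 0 = 0" using f_add[OF zC zC] by (simp only: add_0_left add_cancel_right_right)
    define a where "a J = f (w J) (tabloid_with xs)" for J
    have "(\<Sum>J\<in>?P. a J) = (\<Sum>J\<in>?P. f (w J)) (tabloid_with xs)" by (simp only: a_def sum_fun_apply)
    also have "(\<Sum>J\<in>?P. f (w J)) = f (\<Sum>J\<in>?P. w J)"
      by (rule sum_additive_on[where S = cycles, symmetric])
        (rule zC f0 wC f_add subspace_add[OF cycles_subspace]; assumption)+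
    finally have sum_a: "(\<Sum>J\<in>?P. a J) = 0" by (simp only: sum_w f0 zero_fun_apply)
    have "a (J \<circ> rot r) = a J" for J
    proof -
      have "a J = f (fg_act specht h (w (J \<circ> rot r))) (tabloid_with xs)" by (simp only: a_def h_w)
      also have "\<dots> = fg_act specht h (f (w (J \<circ> rot r))) (tabloid_with xs)"
        by (subst f_act[OF _ wC]) simp_all
      also have "\<dots> = f (w (J \<circ> rot r)) (tabloid_with (inv' h \<circ> xs))" by (rule specht_act_eval[OF h])
      also have "\<dots> = a (J \<circ> rot r)" unfolding a_def by (rule inv_xs[OF _ fC[OF wC]]) simp
      finally show ?thesis by simp
    qed
    then have "(\<Sum>J\<in>?P. a J) = (\<Sum>j<r. a (\<lambda>i\<in>{..<r}. j))" by (intro sum_PiE_cyclic[OF r(1,3)]) simp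
    also have "\<dots> = (\<Sum>j<r. f (fg_act specht (g2 ^^ j) z) (tabloid_with (g2 ^^ j \<circ> xs)))"
    proof (rule sum.cong[OF refl])
      fix j
      have "(g2 ^^ j) (xs i) = xs i" for i by (induction j) (simp_all add: gx)
      then have "g2 ^^ j \<circ> xs = xs" by (simp add: fun_eq_iff)
      then show "a (\<lambda>i\<in>{..<r}. j) = f (fg_act specht (g2 ^^ j) z) (tabloid_with (g2 ^^ j \<circ> xs))"
        by (simp only: a_def w_const)
    qed
    finally show "(\<Sum>j<r. f (fg_act specht (g2 ^^ j) z) (tabloid_with (g2 ^^ j \<circ> xs))) = 0" using sum_a by simp
  qed
  then show ?thesis by (auto simp: h_def)
qed

text \<open>
  With \<open>s = (\<Sum>j. pt 0 j)\<close> and \<open>w\<close> regarded as a multilinear form on sums of points, both sides of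
  \<open>w (s, c s, \<dots>, c\<^sup>r\<^sup>-\<^sup>1 s) = (\<Sum>j. w (pt 0 j, \<dots>, pt (r - 1) j))\<close> agree by the cyclic shift of exponents.
  On the left \<open>s\<close> may be replaced by \<open>s + c s + \<dots> + c\<^sup>r\<^sup>-\<^sup>1 s\<close>, because \<open>w\<close> is alternating. This is the sum of
  all points of the orbit, and as \<open>w\<close> sums to zero over its first argument, only points outside the
  orbit remain. They cancel because \<open>R\<close> acts on them without common fixed points.
\<close>

lemma transversal_sum_zero:
  fixes w :: "tabl \<Rightarrow> 'f::field"
  assumes r: "prime r" "odd r" "CHAR('f) = r"
    and w: "w \<in> cycles"
    and perm: "\<And>\<pi>. \<pi> \<in> insert c R \<Longrightarrow> \<pi> permutes {1..n}"
    and order: "\<And>\<pi>. \<pi> \<in> R \<Longrightarrow> \<pi> ^^ r = id"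
    and comm: "\<And>\<pi> \<rho>. \<pi> \<in> R \<Longrightarrow> \<rho> \<in> R \<Longrightarrow> \<pi> \<circ> \<rho> = \<rho> \<circ> \<pi>"
    and c_pt: "\<And>i j. c (pt i j) = pt (Suc i) j" and pt_per: "\<And>i j. pt (i + r) j = pt i j"
    and pt_range: "\<And>i j. pt i j \<in> {1..n}"
    and inj: "inj_on (\<lambda>(i, j). pt i j) ({..<r} \<times> {..<r})"
    and fixR: "\<And>\<rho> i j. \<rho> \<in> R \<Longrightarrow> \<rho> (pt i j) = pt i j"
    and free: "\<And>y. y \<in> {1..n} \<Longrightarrow> y \<notin> (\<lambda>(i, j). pt i j) ` ({..<r} \<times> {..<r}) \<Longrightarrow> \<exists>\<rho>\<in>R. \<rho> y \<noteq> y"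
    and w_inv: "\<And>\<pi> u. \<pi> \<in> insert c R \<Longrightarrow> w (tabloid_with (\<pi> \<circ> u)) = w (tabloid_with u)"
  shows "(\<Sum>j<r. w (tabloid_with (\<lambda>i. pt i j))) = 0"
proof -
  note two = two_nonzero[OF r]
  define \<Omega> where "\<Omega> = (\<lambda>(i, j). pt i j) ` ({..<r} \<times> {..<r})"
  define U where "U J = (\<lambda>i. pt i (J i))" for J :: "nat \<Rightarrow> nat"
  define a where "a J = w (tabloid_with (U J))" for J
  define b where "b i J = w (tabloid_with ((U J)(0 := pt i (J 0))))" for i J
  let ?P = "{..<r} \<rightarrow>\<^sub>E {..<r}" and ?K = "{1..<r} \<rightarrow>\<^sub>E {..<r}"
  have "a (J \<circ> rot r) = a J" for J
  proof -
    have "(c \<circ> U (J \<circ> rot r)) i = (U J \<circ> rot r) i" if "i < r" for i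
    proof -
      have "pt (Suc i) j = pt (rot r i) j" for j
        using periodic_mod[of "\<lambda>i. pt i j" r "Suc i"] pt_per that by (simp add: rot_def)
      then show ?thesis by (simp add: U_def c_pt)
    qed
    then have "tabloid_with (c \<circ> U (J \<circ> rot r)) = tabloid_with (U J \<circ> rot r)" by (rule tabloid_with_cong)
    then have "w (tabloid_with (U (J \<circ> rot r))) = w (tabloid_with (U J \<circ> rot r))"
      using w_inv[of c "U (J \<circ> rot r)"] by simp
    also have "\<dots> = w (tabloid_with (U J))"
      using cycles_permute[OF w rot_permutes, of "U J"] sign_rot[OF r(2)] by simp
    finally show ?thesis by (simp only: a_def)
  qed
  then have "(\<Sum>J\<in>?P. a J) = (\<Sum>j<r. a (\<lambda>i\<in>{..<r}. j))" by (intro sum_PiE_cyclic[OF r(1,3)]) simp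
  also have "\<dots> = (\<Sum>j<r. w (tabloid_with (\<lambda>i. pt i j)))"
    unfolding a_def U_def by (intro sum.cong refl arg_cong[of _ _ w] tabloid_with_cong) simp
  finally have sum_a: "(\<Sum>J\<in>?P. a J) = (\<Sum>j<r. w (tabloid_with (\<lambda>i. pt i j)))" .
  \<comment> \<open>Replacing the argument \<open>s\<close> by \<open>c\<^sup>i s\<close> repeats an argument, so interchanging the two changes the sign.\<close>
  have "(\<Sum>J\<in>?P. b i J) = 0" if i: "0 < i" "i < r" for i
  proof -
    let ?t = "transpose 0 i"
    have tt: "?t permutes {..<r}" using i by (intro permutes_swap_id) auto
    have "J \<circ> ?t \<in> ?P" if "J \<in> ?P" for J
      using that i permutes_in_image[OF tt] permutes_not_in[OF tt] by (auto simp: PiE_iff extensional_def)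
    then have bij: "bij_betw (\<lambda>J. J \<circ> ?t) ?P ?P"
      by (intro bij_betw_byWitness[where f' = "\<lambda>J. J \<circ> ?t"]) (auto simp: fun_eq_iff)
    have "b i (J \<circ> ?t) = - b i J" for J
    proof -
      have "(U (J \<circ> ?t))(0 := pt i ((J \<circ> ?t) 0)) = (U J)(0 := pt i (J 0)) \<circ> ?t"
        using i by (auto simp: fun_eq_iff U_def transpose_def)
      then show ?thesis
        unfolding b_def using cycles_transpose[OF w r_pos i(2), of "(U J)(0 := pt i (J 0))"] i(1) by simp
    qed
    moreover have "(\<Sum>J\<in>?P. b i (J \<circ> ?t)) = (\<Sum>J\<in>?P. b i J)" by (rule sum.reindex_bij_betw[OF bij])
    ultimately have "(\<Sum>J\<in>?P. b i J) = - (\<Sum>J\<in>?P. b i J)" by (simp add: sum_negf)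
    then show ?thesis using eq_uminus_self_iff[OF two] by blast
  qed
  moreover have "b 0 J = a J" for J
  proof -
    have "(U J)(0 := pt 0 (J 0)) = U J" by (simp add: U_def fun_eq_iff)
    then show ?thesis by (simp add: a_def b_def)
  qed
  moreover have "{..<r} = insert 0 {1..<r}" using r_pos by auto
  then have split: "(\<Sum>i<r. g i) = g 0 + (\<Sum>i\<in>{1..<r}. g i)" for g :: "nat \<Rightarrow> 'f" by simp
  ultimately have "(\<Sum>i<r. \<Sum>J\<in>?P. b i J) = (\<Sum>J\<in>?P. a J)" by (simp add: split)
  moreover have "?P = (\<lambda>(j, K). K(0 := j)) ` ({..<r} \<times> ?K)"
    unfolding \<open>{..<r} = insert 0 {1..<r}\<close> PiE_insert_eq by simp
  then have "(\<Sum>J\<in>?P. \<Sum>i<r. b i J) =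
      (\<Sum>J\<in>(\<lambda>(j, K). K(0 := j)) ` ({..<r} \<times> ?K). \<Sum>i<r. b i J)" by (simp only:)
  then have "(\<Sum>i<r. \<Sum>J\<in>?P. b i J) = (\<Sum>(j, K)\<in>{..<r} \<times> ?K. \<Sum>i<r. b i (K(0 := j)))"
    by (subst sum.swap) (subst (asm) sum.reindex[OF inj_combinator], auto simp: case_prod_unfold)
  ultimately have "(\<Sum>J\<in>?P. a J) = (\<Sum>(j, K)\<in>{..<r} \<times> ?K. \<Sum>i<r. b i (K(0 := j)))" by simp
  also have "\<dots> = (\<Sum>j<r. \<Sum>K\<in>?K. \<Sum>i<r. w (tabloid_with ((U K)(0 := pt i j))))"
  proof -
    have "(U (K(0 := j)))(0 := x) = (U K)(0 := x)" for K j x by (simp add: U_def fun_eq_iff)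
    then show ?thesis by (simp add: sum.cartesian_product[symmetric] b_def)
  qed
  also have "\<dots> = (\<Sum>K\<in>?K. \<Sum>j<r. \<Sum>i<r. w (tabloid_with ((U K)(0 := pt i j))))" by (rule sum.swap)
  also have "\<dots> = (\<Sum>K\<in>?K. \<Sum>y\<in>\<Omega>. w (tabloid_with ((U K)(0 := y))))"
  proof (rule sum.cong[OF refl])
    fix K
    have "(\<Sum>j<r. \<Sum>i<r. w (tabloid_with ((U K)(0 := pt i j)))) = (\<Sum>i<r. \<Sum>j<r. w (tabloid_with ((U K)(0 := pt i j))))"
      by (rule sum.swap)
    also have "\<dots> = (\<Sum>y\<in>\<Omega>. w (tabloid_with ((U K)(0 := y))))"
      unfolding \<Omega>_def by (subst sum.reindex[OF inj]) (simp add: sum.cartesian_product case_prod_unfold)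
    finally show "(\<Sum>j<r. \<Sum>i<r. w (tabloid_with ((U K)(0 := pt i j)))) = (\<Sum>y\<in>\<Omega>. w (tabloid_with ((U K)(0 := y))))" .
  qed
  also have "\<dots> = 0"
  proof (rule sum.neutral, rule ballI)
    fix K
    let ?a = "\<lambda>y. w (tabloid_with ((U K)(0 := y)))"
    have \<Omega>n: "\<Omega> \<subseteq> {1..n}" using pt_range by (auto simp: \<Omega>_def)
    have \<rho>\<Omega>: "\<rho> y = y" if "\<rho> \<in> R" "y \<in> \<Omega>" for \<rho> y using that fixR by (auto simp: \<Omega>_def)
    have "sum ?a ({1..n} - \<Omega>) = sum ?a {y \<in> {1..n} - \<Omega>. \<forall>\<rho>\<in>R. \<rho> y = y}"
    proof (rule sum_commuting_invariant[OF r(1,3)])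
      show "finite R"
        by (rule finite_subset[OF _ finite_permutations[of "{1..n}"]]) (use perm in auto)
      fix \<rho> y assume \<rho>: "\<rho> \<in> R" and y: "y \<in> {1..n} - \<Omega>"
      have p: "\<rho> permutes {1..n}" using perm \<rho> by blast
      have "\<rho> y \<notin> \<Omega>"
      proof
        assume "\<rho> y \<in> \<Omega>"
        then have "\<rho> (\<rho> y) = \<rho> y" using \<rho>\<Omega>[OF \<rho>] by blast
        then have "\<rho> y = y" using permutes_inj[OF p] by (simp add: inj_eq)
        then show False using \<open>\<rho> y \<in> \<Omega>\<close> y by simp
      qed
      then show "\<rho> y \<in> {1..n} - \<Omega>" using permutes_in_image[OF p] y by simp
      show "(\<rho> ^^ r) y = y" using order[OF \<rho>] by simp
      have "\<rho> \<circ> (U K)(0 := y) = (U K)(0 := \<rho> y)" using fixR[OF \<rho>] by (simp add: fun_eq_iff U_def)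
      then show "?a (\<rho> y) = ?a y" using w_inv[of \<rho> "(U K)(0 := y)"] \<rho> by simp
    next
      fix \<rho> \<rho>' y assume "\<rho> \<in> R" "\<rho>' \<in> R"
      then show "\<rho> (\<rho>' y) = \<rho>' (\<rho> y)" using fun_cong[OF comm[of \<rho> \<rho>'], of y] by simp
    qed simp
    also have "{y \<in> {1..n} - \<Omega>. \<forall>\<rho>\<in>R. \<rho> y = y} = {}" using free by (auto simp: \<Omega>_def)
    finally have "sum ?a ({1..n} - \<Omega>) = 0" by (simp only: sum.empty)
    moreover have "sum ?a {1..n} = sum ?a ({1..n} - \<Omega>) + sum ?a \<Omega>"
      by (rule sum.subset_diff[OF \<Omega>n]) simp
    ultimately show "sum ?a \<Omega> = 0" using cycles_closed[OF w, of "U K"] by simp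
  qed
  finally show ?thesis using sum_a by simp
qed

text \<open>
  The test vector is the exterior product of the indicator functions of the sets \<open>{pt i j | j}\<close>. It is
  invariant under \<open>d\<close> as well as under \<open>X\<close>, so the averages are sums over the translates
  \<open>(pt 0 j, \<dots>, pt (r - 1) j)\<close> of the test points, which vanish by \<open>transversal_sum_zero\<close>.
\<close>

lemma vertex_square_orbit:
  assumes r: "prime r" "odd r" "CHAR('f::field) = r"
    and perm: "\<And>\<pi>. \<pi> \<in> {c, d} \<union> R \<Longrightarrow> \<pi> permutes {1..n}"
    and order: "\<And>\<pi>. \<pi> \<in> {c, d} \<union> R \<Longrightarrow> \<pi> ^^ r = id"
    and comm: "\<And>\<pi> \<rho>. \<pi> \<in> {c, d} \<union> R \<Longrightarrow> \<rho> \<in> {c, d} \<union> R \<Longrightarrow> \<pi> \<circ> \<rho> = \<rho> \<circ> \<pi>"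
    and x0: "x0 \<in> {1..n}"
    and inj: "inj_on (\<lambda>(i, j). (c ^^ i) ((d ^^ j) x0)) ({..<r} \<times> {..<r})"
    and fixR: "\<And>\<rho> i j. \<rho> \<in> R \<Longrightarrow> \<rho> ((c ^^ i) ((d ^^ j) x0)) = (c ^^ i) ((d ^^ j) x0)"
    and free: "\<And>y. y \<in> {1..n} \<Longrightarrow> y \<notin> (\<lambda>(i, j). (c ^^ i) ((d ^^ j) x0)) ` ({..<r} \<times> {..<r}) \<Longrightarrow>
      \<exists>\<rho>\<in>R. \<rho> y \<noteq> y"
  shows "\<exists>Q. is_vertex (sym_group n) (specht :: ('f, nat \<Rightarrow> nat, tabl \<Rightarrow> 'f) fg) Q \<and> {c, d} \<union> R \<subseteq> Q"
proof -
  note two = two_nonzero[OF r]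
  define pt where "pt i j = (c ^^ i) ((d ^^ j) x0)" for i j
  have c: "c permutes {1..n}" "c ^^ r = id" and d: "d permutes {1..n}" "d ^^ r = id" using perm order by auto
  have cd: "(d ^^ k) ((c ^^ i) x) = (c ^^ i) ((d ^^ k) x)" for i k x
    using fun_cong[OF commute_funpow[OF comm[of d c], of k i], of x] by simp
  have c_pt: "c (pt i j) = pt (Suc i) j" for i j by (simp add: pt_def)
  have d_pt: "(d ^^ k) (pt i j) = pt i (k + j)" for i j k by (simp add: pt_def cd funpow_add)
  have pt_per: "pt (i + r) j = pt i j" and pt_per': "pt i (j + r) = pt i j" for i j
    using c(2) d(2) by (simp_all add: pt_def funpow_add)
  have pt_range: "pt i j \<in> {1..n}" for i j
    using permutes_in_image[OF permutes_funpow[OF c(1)]] permutes_in_image[OF permutes_funpow[OF d(1)]] x0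
    by (simp add: pt_def)
  have pt_inj: "inj_on (\<lambda>(i, j). pt i j) ({..<r} \<times> {..<r})" using inj by (simp add: pt_def)
  have fixR': "\<rho> (pt i j) = pt i j" if "\<rho> \<in> R" for \<rho> i j using fixR[OF that] by (simp add: pt_def)
  define F where "F i b = (if \<exists>j. b = pt i j then 1 else (0::'f))" for i b
  define xs where "xs i = pt i 0" for i
  define z where "z = (wedge F :: tabl \<Rightarrow> 'f)"
  have pt_mod: "pt i (j mod r) = pt i j" for i j by (rule periodic_mod) (rule pt_per')
  have pt_rot: "pt (rot r i) j = pt (Suc i) j" if "i < r" for i j
    using periodic_mod[of "\<lambda>i. pt i j" r "Suc i"] pt_per that by (simp add: rot_def)
  have F_supp: "F i b = 0" if "b \<notin> {1..n}" for i b using that pt_range by (auto simp: F_def)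
  have F_sum: "(\<Sum>b\<in>{1..n}. F i b) = 0" if i: "i < r" for i
  proof -
    have fib: "{b. \<exists>j. b = pt i j} = pt i ` {..<r}"
    proof (intro Set.equalityI subsetI)
      fix b assume "b \<in> {b. \<exists>j. b = pt i j}"
      then obtain j where "b = pt i (j mod r)" using pt_mod by auto
      then show "b \<in> pt i ` {..<r}" using r_pos by simp
    qed auto
    have "inj_on (pt i) {..<r}" using inj_onD[OF pt_inj, of "(i, _)" "(i, _)"] i by (auto intro!: inj_onI)
    then have "(\<Sum>b\<in>pt i ` {..<r}. 1) = (of_nat r :: 'f)" by (simp add: card_image)
    moreover have "(\<Sum>b\<in>{1..n}. F i b) = (\<Sum>b\<in>pt i ` {..<r}. 1)"
      using pt_range fib by (intro sum.mono_neutral_cong_right) (auto simp: F_def)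
    ultimately show ?thesis using of_nat_char_eq_0[OF r(3)] by simp
  qed
  have zC: "z \<in> cycles" unfolding z_def using F_supp F_sum by (intro wedge_cycles[OF two]) auto
  have act_z: "fg_act specht \<pi> z = wedge (\<lambda>i b. if \<exists>j. b = \<pi> (pt i j) then 1 else 0)"
    if "\<pi> permutes {1..n}" for \<pi>
  proof -
    have "fg_act specht \<pi> z = wedge (\<lambda>i b. F i (inv' \<pi> b))"
      unfolding z_def using F_supp by (intro act_wedge[OF two _ that]) blast
    moreover have "inv' \<pi> b = pt i j \<longleftrightarrow> b = \<pi> (pt i j)" for i j b
      using permutes_inv_eq[OF that, of b "pt i j"] by auto
    ultimately show ?thesis by (simp add: F_def)
  qed
  have c_z: "fg_act specht c z = z"
  proof -
    have "fg_act specht c z = wedge (\<lambda>i. F (Suc i))" unfolding act_z[OF c(1)] by (simp add: c_pt F_def[abs_def])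
    also have "\<dots> = wedge (\<lambda>i. F (rot r i))" by (rule wedge_cong) (simp add: F_def fun_eq_iff pt_rot)
    also have "\<dots> = z" unfolding z_def by (rule wedge_rot[OF r(2)])
    finally show ?thesis .
  qed
  have d_z: "fg_act specht (d ^^ k) z = z" if "k < r" for k
  proof -
    have *: "(\<exists>j. b = pt i (k + j)) \<longleftrightarrow> (\<exists>j. b = pt i j)" for i b
    proof
      assume "\<exists>j. b = pt i j"
      then obtain j where "b = pt i j" by blast
      then have "b = pt i (k + (r - k + j))" using pt_per'[of i j] that by (simp add: add.commute)
      then show "\<exists>j. b = pt i (k + j)" by blast
    qed blast
    have "fg_act specht (d ^^ k) z = wedge (\<lambda>i b. if \<exists>j. b = pt i (k + j) then 1 else 0)"
      using act_z[OF permutes_funpow[OF d(1)], of k] by (simp only: d_pt)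
    also have "\<dots> = z" by (simp only: * z_def F_def[abs_def])
    finally show ?thesis .
  qed
  have \<rho>_z: "fg_act specht \<rho> z = z" if "\<rho> \<in> R" for \<rho>
    using act_z[of \<rho>] perm[of \<rho>] that fixR'[OF that] by (simp add: z_def F_def[abs_def])
  have "\<exists>Q. is_vertex (sym_group n) (specht :: ('f, nat \<Rightarrow> nat, tabl \<Rightarrow> 'f) fg) Q \<and> insert d (insert c R) \<subseteq> Q"
  proof (rule vertex_of_test[OF r, where z = z and xs = xs])
    show "\<pi> permutes {1..n}" if "\<pi> \<in> insert d (insert c R)" for \<pi> using that perm by auto
    show "\<pi> ^^ r = id" if "\<pi> \<in> insert d (insert c R)" for \<pi> using that order by auto
    show "\<pi> \<circ> \<rho> = \<rho> \<circ> \<pi>" if "\<pi> \<in> insert d (insert c R)" "\<rho> \<in> insert c R" for \<pi> \<rho>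
      using that by (intro comm) auto
    show "v (tabloid_with (inv' \<pi> \<circ> xs)) = (v (tabloid_with xs) :: 'f)" if \<pi>: "\<pi> \<in> insert c R" and v: "v \<in> cycles" for \<pi> v
    proof (cases "\<pi> = c")
      case True
      have "(inv' c \<circ> xs) (rot r i) = xs i" if "i < r" for i
        using permutes_inverses(2)[OF c(1)] by (simp add: xs_def pt_rot[OF that] flip: c_pt)
      then show ?thesis using cycles_rotate[OF r(2) v, of "inv' c \<circ> xs" xs] True by simp
    next
      case False
      then have "\<pi> \<in> R" using \<pi> by blast
      then have "inv' \<pi> (xs i) = xs i" for i
        using fixR' permutes_inv_eq[of \<pi> "{1..n}" "xs i" "xs i"] perm[of \<pi>] by (simp add: xs_def)
      then have "inv' \<pi> \<circ> xs = xs" by (simp add: fun_eq_iff)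
      then show ?thesis by simp
    qed
    show "z \<in> cycles" by (rule zC)
    show "fg_act specht \<pi> z = z" if "\<pi> \<in> insert c R" for \<pi> using that c_z \<rho>_z by auto
    have "z (tabloid_with xs) = wedge_coeff r F xs" unfolding z_def using F_supp by (intro wedge_eval[OF two]) blast
    also have "\<dots> = 1"
    proof (rule wedge_coeff_diagonal)
      fix i k assume ik: "i < r" "k < r"
      have "(\<exists>j. pt k 0 = pt i j) \<longleftrightarrow> i = k"
      proof
        assume "\<exists>j. pt k 0 = pt i j"
        then obtain j where "pt k 0 = pt i (j mod r)" using pt_mod by metis
        then show "i = k" using inj_onD[OF pt_inj, of "(k, 0)" "(i, j mod r)"] ik r_pos by simp
      qed blast
      then show "F i (xs k) = (if i = k then 1 else 0)" by (simp add: F_def xs_def)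
    qed
    finally show "z (tabloid_with xs) \<noteq> 0" by simp
    fix f assume f: "linear_endo (specht :: ('f, nat \<Rightarrow> nat, tabl \<Rightarrow> 'f) fg) f"
      and f_act: "\<And>\<pi> v. \<pi> \<in> insert c R \<Longrightarrow> v \<in> cycles \<Longrightarrow> f (fg_act specht \<pi> v) = fg_act specht \<pi> (f v)"
    have fz: "f z \<in> cycles" using f zC by (auto simp: linear_endo_def specht_space[OF two])
    have f_inv: "f z (tabloid_with (\<pi> \<circ> u)) = f z (tabloid_with u)" if \<pi>: "\<pi> \<in> insert c R" for \<pi> u
    proof -
      have p: "\<pi> permutes {1..n}" using perm \<pi> by auto
      have "fg_act specht \<pi> (f z) = f z" using f_act[OF \<pi> zC] \<pi> c_z \<rho>_z by auto
      then have "f z (tabloid_with (\<pi> \<circ> u)) = f z (tabloid_with (inv' \<pi> \<circ> (\<pi> \<circ> u)))"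
        using specht_act_eval[OF p, of "f z" "\<pi> \<circ> u"] by simp
      then show ?thesis using permutes_inv_o(2)[OF p] by (simp only: o_assoc id_comp)
    qed
    have "(\<Sum>j<r. f (fg_act specht (d ^^ j) z) (tabloid_with (d ^^ j \<circ> xs))) = (\<Sum>j<r. f z (tabloid_with (\<lambda>i. pt i j)))"
    proof (rule sum.cong[OF refl])
      fix j assume "j \<in> {..<r}"
      moreover have "d ^^ j \<circ> xs = (\<lambda>i. pt i j)" by (simp add: fun_eq_iff xs_def d_pt)
      ultimately show "f (fg_act specht (d ^^ j) z) (tabloid_with (d ^^ j \<circ> xs)) = f z (tabloid_with (\<lambda>i. pt i j))"
        using d_z by simp
    qed
    also have "\<dots> = 0"
    proof (rule transversal_sum_zero[OF r fz, where c = c and R = R])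
      show "\<pi> \<circ> \<rho> = \<rho> \<circ> \<pi>" if "\<pi> \<in> R" "\<rho> \<in> R" for \<pi> \<rho> using that by (intro comm) auto
      show "\<exists>\<rho>\<in>R. \<rho> y \<noteq> y"
        if "y \<in> {1..n}" "y \<notin> (\<lambda>(i, j). pt i j) ` ({..<r} \<times> {..<r})" for y
        using that free[of y] by (simp add: pt_def)
    qed (use perm order c_pt pt_per pt_range pt_inj fixR' f_inv in auto)
    finally show "(\<Sum>j<r. f (fg_act specht (d ^^ j) z) (tabloid_with (d ^^ j \<circ> xs))) = 0" .
  qed
  then show ?thesis by auto
qed

end

section \<open>Elementary abelian subgroups of symmetric groups\<close>

lemma ex_free_permutation:
  fixes A :: "'a set"
  assumes "finite A" "p dvd card A" "1 < p"
  shows "\<exists>q. q permutes A \<and> q ^^ p = id \<and> (\<forall>y\<in>A. q y \<noteq> y)"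
proof -
  obtain m where m: "card A = p * m" using assms(2) by auto
  obtain b where b: "bij_betw b ({..<p} \<times> {..<m}) A"
    using finite_same_card_bij[of "{..<p} \<times> {..<m}" A] assms(1) m by auto
  define k where "k = inv_into ({..<p} \<times> {..<m}) b"
  have kb: "k (b ij) = ij" if "ij \<in> {..<p} \<times> {..<m}" for ij
    using that b by (simp add: k_def bij_betw_def)
  have bA: "b ij \<in> A" if "ij \<in> {..<p} \<times> {..<m}" for ij using that b by (auto simp: bij_betw_def)
  have ex: "\<exists>i j. i < p \<and> j < m \<and> y = b (i, j)" if "y \<in> A" for y
    using that b by (auto simp: bij_betw_def image_iff)
  define q where "q y = (if y \<in> A then b ((fst (k y) + 1) mod p, snd (k y)) else y)" for y
  have qb: "q (b (i, j)) = b ((i + 1) mod p, j)" if "i < p" "j < m" for i j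
    using that bA kb by (simp add: q_def)
  have qk: "(q ^^ l) (b (i, j)) = b ((i + l) mod p, j)" if "i < p" "j < m" for i j l
  proof (induction l)
    case (Suc l)
    have "(q ^^ Suc l) (b (i, j)) = q (b ((i + l) mod p, j))" using Suc by simp
    also have "\<dots> = b (((i + l) mod p + 1) mod p, j)" using that by (intro qb) auto
    also have "((i + l) mod p + 1) mod p = (i + Suc l) mod p" by (simp add: mod_simps)
    finally show ?case .
  qed (use that in simp)
  have id: "(q ^^ p) y = y" for y
  proof (cases "y \<in> A")
    case True
    then obtain i j where ij: "i < p" "j < m" "y = b (i, j)" using ex by blast
    then show ?thesis using qk[OF ij(1,2), of p] by simp
  next
    case False
    then have "(q ^^ l) y = y" for l by (induction l) (auto simp: q_def)
    then show ?thesis by simp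
  qed
  have "q y \<in> A" if y: "y \<in> A" for y
  proof -
    obtain i j where ij: "i < p" "j < m" "y = b (i, j)" using ex[OF y] by blast
    then show ?thesis using qb[OF ij(1,2)] bA by simp
  qed
  moreover have "inj_on q A"
  proof (rule inj_on_inverseI)
    fix y
    have "(q ^^ Suc (p - 1)) y = y" using id[of y] assms(3) by simp
    then show "(q ^^ (p - 1)) (q y) = y" by (simp only: funpow_Suc_right o_apply)
  qed
  ultimately have "bij_betw q A A" using endo_inj_surj[OF assms(1)] by (simp add: bij_betw_def image_subset_iff)
  then have "q permutes A" by (rule bij_imp_permutes) (simp add: q_def)
  moreover have "q y \<noteq> y" if y: "y \<in> A" for y
  proof -
    obtain i j where ij: "i < p" "j < m" "y = b (i, j)" using ex[OF y] by blast
    have "(i + 1) mod p \<noteq> i"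
    proof (cases "i + 1 < p")
      case False
      then have "i + 1 = p" using ij by simp
      then show ?thesis using assms(3) by auto
    qed simp
    moreover have "inj_on b ({..<p} \<times> {..<m})" using b by (simp add: bij_betw_def)
    ultimately have "b ((i + 1) mod p, j) \<noteq> b (i, j)"
      using inj_onD[of b "{..<p} \<times> {..<m}" "((i + 1) mod p, j)" "(i, j)"] ij by auto
    then show ?thesis using qb[OF ij(1,2)] ij by simp
  qed
  ultimately show ?thesis using id by (intro exI[of _ q]) (auto simp: fun_eq_iff)
qed

lemma sym_subgroup_funpow: "subgroup Q (sym_group n) \<Longrightarrow> x \<in> Q \<Longrightarrow> x ^^ j \<in> Q"
  using subgroup.one_closed[of Q "sym_group n"] subgroup.m_closed[of Q "sym_group n"]
  by (induction j) (simp_all only: funpow.simps sym_group_one sym_group_mult)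

locale elementary_abelian =
  fixes p n :: nat and E :: "(nat \<Rightarrow> nat) set"
  assumes prime: "prime p" and elab: "elementary_abelian_subgroup p E (sym_group n)"
begin

lemma sub: "subgroup E (sym_group n)"
  using elab by (simp add: elementary_abelian_subgroup_def)

lemma perm: "e \<in> E \<Longrightarrow> e permutes {1..n}"
  using subgroup.subset[OF sub] by (auto simp: sym_group_carrier)

lemma order: "e \<in> E \<Longrightarrow> e ^^ p = id"
  using elab by (simp add: elementary_abelian_subgroup_def sym_group_pow sym_group_one)

lemma comm: "e \<in> E \<Longrightarrow> f \<in> E \<Longrightarrow> e \<circ> f = f \<circ> e"
proof -
  assume ef: "e \<in> E" "f \<in> E"
  interpret comm_group "(sym_group n)\<lparr>carrier := E\<rparr>"
    using elab by (simp add: elementary_abelian_subgroup_def)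
  show ?thesis using m_comm[of e f] ef by (simp add: sym_group_mult)
qed

lemma id_in: "id \<in> E" and comp_in: "e \<in> E \<Longrightarrow> f \<in> E \<Longrightarrow> e \<circ> f \<in> E"
  using subgroup.one_closed[OF sub] subgroup.m_closed[OF sub] by (simp_all add: sym_group_one sym_group_mult)

lemma pow_in: "e \<in> E \<Longrightarrow> e ^^ j \<in> E"
  by (rule sym_subgroup_funpow[OF sub])

lemma comm_apply: "e \<in> E \<Longrightarrow> f \<in> E \<Longrightarrow> e (f x) = f (e x)"
  using fun_cong[OF comm[of e f], of x] by simp

lemma pow_minus: "e \<in> E \<Longrightarrow> (e ^^ (p - 1)) (e x) = x"
proof -
  assume "e \<in> E"
  then have "(e ^^ Suc (p - 1)) x = x" using order prime_gt_0_nat[OF prime] by simp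
  then show ?thesis by (simp only: funpow_Suc_right o_apply)
qed

text \<open>
  For such a set the restrictions of the elements of \<open>E\<close>, extended by the identity, are again commuting
  permutations of order \<open>p\<close>. They need not lie in \<open>E\<close>, but they may be used to enlarge \<open>E\<close>.
\<close>

definition stable :: "nat set \<Rightarrow> bool" where
  "stable A \<longleftrightarrow> (\<forall>e\<in>E. \<forall>x. e x \<in> A \<longleftrightarrow> x \<in> A)"

lemma stable_Compl: "stable A \<Longrightarrow> stable (- A)"
  and stable_Un: "stable A \<Longrightarrow> stable B \<Longrightarrow> stable (A \<union> B)"
  by (simp_all add: stable_def)

lemma restrict_permutes:
  assumes "stable A" "e \<in> E" shows "restrict_id e A permutes {1..n}"
proof -
  have "bij_betw e A A"
  proof (rule bij_betw_imageI)
    show "inj_on e A" using permutes_inj[OF perm[OF assms(2)]] by (rule inj_on_subset) simp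
    have "A \<subseteq> e ` A"
    proof
      fix y assume y: "y \<in> A"
      have "e (inv' e y) = y" using permutes_inverses(1)[OF perm[OF assms(2)]] .
      moreover from this have "inv' e y \<in> A" using y assms unfolding stable_def by metis
      ultimately show "y \<in> e ` A" by (metis imageI)
    qed
    then show "e ` A = A" using assms by (auto simp: stable_def)
  qed
  then have "restrict_id e A permutes A" by (rule permutes_restrict_id)
  then show ?thesis
    by (rule permutes_superset) (use permutes_not_in[OF perm[OF assms(2)]] in auto)
qed

lemma restrict_funpow:
  assumes "stable A" "e \<in> E"
  shows "(restrict_id e A ^^ k) x = (if x \<in> A then (e ^^ k) x else x)"
proof (induction k)
  case (Suc k)
  have "(e ^^ k) x \<in> A \<longleftrightarrow> x \<in> A" using assms pow_in[OF assms(2)] by (simp add: stable_def)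
  then show ?case using Suc by (simp add: restrict_id_def)
qed simp

lemma restrict_order: "stable A \<Longrightarrow> e \<in> E \<Longrightarrow> restrict_id e A ^^ p = id"
  by (rule ext) (simp add: restrict_funpow order)

lemma restrict_comm:
  assumes "stable A" "stable B" "e \<in> E" "f \<in> E"
  shows "restrict_id e A \<circ> restrict_id f B = restrict_id f B \<circ> restrict_id e A"
proof
  fix x
  have "e x \<in> B \<longleftrightarrow> x \<in> B" "f x \<in> A \<longleftrightarrow> x \<in> A" using assms by (auto simp: stable_def)
  then show "(restrict_id e A \<circ> restrict_id f B) x = (restrict_id f B \<circ> restrict_id e A) x"
    using comm_apply[OF assms(3,4)] by (simp add: restrict_id_def)
qed

definition orb :: "nat \<Rightarrow> nat set" where "orb x = (\<lambda>e. e x) ` E"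

lemma point_orbits_eq: "point_orbits n E = orb ` {1..n}"
  by (auto simp: point_orbits_def orbits_def orbit_def orb_def)

lemma orb_self: "x \<in> orb x"
  using id_in by (auto simp: orb_def intro!: image_eqI[of _ _ id])

lemma orb_stable: "stable (orb x)"
  unfolding stable_def
proof (intro ballI allI iffI)
  fix e y assume e: "e \<in> E"
  show "e y \<in> orb x" if y: "y \<in> orb x"
  proof -
    obtain f where f: "f \<in> E" "y = f x" using y by (auto simp: orb_def)
    then have "e y = (e \<circ> f) x" by simp
    then show ?thesis using comp_in[OF e f(1)] unfolding orb_def by blast
  qed
  show "y \<in> orb x" if y: "e y \<in> orb x"
  proof -
    obtain f where f: "f \<in> E" "e y = f x" using y by (auto simp: orb_def)
    then have "y = (e ^^ (p - 1) \<circ> f) x" using pow_minus[OF e, of y] by simp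
    then show ?thesis using comp_in[OF pow_in[OF e] f(1)] unfolding orb_def by blast
  qed
qed

lemma orb_subset: "x \<in> {1..n} \<Longrightarrow> orb x \<subseteq> {1..n}"
  using permutes_in_image[OF perm] by (auto simp: orb_def)

lemma orb_eqI: assumes "z \<in> orb x" "z \<in> orb y" shows "orb x = orb y"
proof -
  have "orb x \<subseteq> orb y" if z: "z \<in> orb x" "z \<in> orb y" for x y
  proof -
    obtain e where e: "e \<in> E" "z = e x" using z(1) by (auto simp: orb_def)
    then have "x \<in> orb y" using z(2) orb_stable[of y] by (simp add: stable_def)
    then show ?thesis using orb_stable[of y] by (auto simp: orb_def[of x] stable_def)
  qed
  then show ?thesis using assms by blast
qed

lemma orb_moved:
  assumes "1 < card (orb x)" obtains e where "e \<in> E" "e x \<noteq> x"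
proof -
  have "\<not> orb x \<subseteq> {x}"
  proof
    assume "orb x \<subseteq> {x}"
    then have "card (orb x) \<le> 1" using card_mono[of "{x}" "orb x"] by simp
    then show False using assms by simp
  qed
  then show thesis using that by (auto simp: orb_def)
qed

lemma orb_prime_generated:
  assumes "card (orb x) = p" "e \<in> E" "e x \<noteq> x"
  shows "inj_on (\<lambda>i. (e ^^ i) x) {..<p}" and "orb x = (\<lambda>i. (e ^^ i) x) ` {..<p}"
proof -
  show inj: "inj_on (\<lambda>i. (e ^^ i) x) {..<p}"
    by (rule prime_cycle_inj[OF prime]) (simp_all add: order assms(2,3))
  have "(\<lambda>i. (e ^^ i) x) ` {..<p} \<subseteq> orb x" using pow_in[OF assms(2)] by (auto simp: orb_def)
  moreover have "finite (orb x)" using assms(1) prime_gt_0_nat[OF prime] card_ge_0_finite by force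
  moreover have "card ((\<lambda>i. (e ^^ i) x) ` {..<p}) = p" using inj by (simp add: card_image)
  ultimately show "orb x = (\<lambda>i. (e ^^ i) x) ` {..<p}" using card_subset_eq assms(1) by metis
qed

text \<open>
  A transitive abelian group acts regularly, so \<open>f\<close> acts on the orbit as the power of \<open>e\<close> that maps
  \<open>x\<close> to \<open>f x\<close>.
\<close>

lemma restrict_orb_prime:
  assumes x: "card (orb x) = p" "e \<in> E" "e x \<noteq> x" and f: "f \<in> E"
  shows "\<exists>a. restrict_id f (orb x) = restrict_id e (orb x) ^^ a"
proof -
  have "f x \<in> orb x" using f by (auto simp: orb_def)
  then obtain a where a: "f x = (e ^^ a) x" using orb_prime_generated(2)[OF x] by auto
  have "restrict_id f (orb x) y = (restrict_id e (orb x) ^^ a) y" for y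
  proof (cases "y \<in> orb x")
    case True
    then obtain g where g: "g \<in> E" "y = g x" by (auto simp: orb_def)
    have "f y = (e ^^ a) y"
      using comm_apply[OF f g(1), of x] comm_apply[OF pow_in[OF x(2)] g(1), of a x] a g(2) by simp
    then show ?thesis using True by (simp add: restrict_funpow[OF orb_stable x(2)])
  qed (simp add: restrict_funpow[OF orb_stable x(2)])
  then show ?thesis by blast
qed

text \<open>
  Every element of \<open>E\<close> is the product of its restrictions to the two orbits, which are powers of \<open>g1\<close>
  and \<open>g2\<close>, and of its restriction to the complement, which belongs to \<open>R\<close>.
\<close>

lemma two_prime_orbits:
  assumes odd: "odd p" and ch: "CHAR('f::field) = p"
    and x: "x0 \<in> {1..n}" "card (orb x0) = p" and y: "y0 \<in> {1..n}" "card (orb y0) = p"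
    and ne: "orb x0 \<noteq> orb y0"
  shows "\<exists>Q. is_vertex (sym_group n)
    (specht_module ((n - p) # replicate p 1) :: ('f, nat \<Rightarrow> nat, tabl \<Rightarrow> 'f) fg) Q \<and> E \<subseteq> Q"
proof -
  have p1: "1 < p" by (rule prime_gt_1_nat[OF prime])
  have disj: "orb x0 \<inter> orb y0 = {}" using orb_eqI ne by blast
  have fin: "finite (orb x0)" "finite (orb y0)" using x y p1 card_ge_0_finite by force+
  have "card (orb x0 \<union> orb y0) \<le> card {1..n}"
    using orb_subset[OF x(1)] orb_subset[OF y(1)] by (intro card_mono) auto
  then have "p < n" using card_Un_disjoint[OF fin disj] x y p1 by simp
  interpret hook n p using \<open>p < n\<close> p1 by unfold_locales auto
  obtain e1 where e1: "e1 \<in> E" "e1 x0 \<noteq> x0" using orb_moved[of x0] x p1 by auto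
  obtain e2 where e2: "e2 \<in> E" "e2 y0 \<noteq> y0" using orb_moved[of y0] y p1 by auto
  define g1 where "g1 = restrict_id e1 (orb x0)"
  define g2 where "g2 = restrict_id e2 (orb y0)"
  define C where "C = - (orb x0 \<union> orb y0)"
  define R where "R = (\<lambda>e. restrict_id e C) ` E"
  have stC: "stable C" unfolding C_def by (intro stable_Compl stable_Un orb_stable)
  have rep: "\<exists>e A. e \<in> E \<and> stable A \<and> \<pi> = restrict_id e A" if "\<pi> \<in> {g1, g2} \<union> R" for \<pi>
    using that e1 e2 orb_stable stC by (auto simp: g1_def g2_def R_def)
  have g1x: "(g1 ^^ i) x0 = (e1 ^^ i) x0" and g2y: "(g2 ^^ i) y0 = (e2 ^^ i) y0" for i
    using orb_self by (simp_all add: g1_def g2_def restrict_funpow[OF orb_stable] e1 e2)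
  have inx: "(e1 ^^ i) x0 \<in> orb x0" and iny: "(e2 ^^ i) y0 \<in> orb y0" for i
    using pow_in e1(1) e2(1) by (auto simp: orb_def)
  have "\<exists>Q. is_vertex (sym_group n) (specht :: ('f, nat \<Rightarrow> nat, tabl \<Rightarrow> 'f) fg) Q \<and> {g1 \<circ> g2, g2} \<union> R \<subseteq> Q"
  proof (rule vertex_two_orbits[OF prime odd ch, where ?x0.0 = x0 and ?y0.0 = y0])
    show "\<pi> permutes {1..n}" if "\<pi> \<in> {g1, g2} \<union> R" for \<pi>
      using rep[OF that] restrict_permutes by blast
    show "\<pi> ^^ p = id" if "\<pi> \<in> {g1, g2} \<union> R" for \<pi> using rep[OF that] restrict_order by blast
    show "\<pi> \<circ> \<rho> = \<rho> \<circ> \<pi>" if "\<pi> \<in> {g1, g2} \<union> R" "\<rho> \<in> {g1, g2} \<union> R" for \<pi> \<rho>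
      using rep[OF that(1)] rep[OF that(2)] restrict_comm by blast
    show "x0 \<in> {1..n}" "y0 \<in> {1..n}" by (rule x y)+
    show "inj_on (\<lambda>i. (g1 ^^ i) x0) {..<p}"
      unfolding g1x by (rule orb_prime_generated(1)[OF x(2) e1])
    show "(g1 ^^ i) x0 \<noteq> (g2 ^^ j) y0" for i j
      unfolding g1x g2y using inx[of i] iny[of j] disj by auto
    show "\<pi> ((g1 ^^ i) x0) = (g1 ^^ i) x0" if "\<pi> \<in> insert g2 R" for \<pi> i
      unfolding g1x using that inx[of i] disj by (auto simp: g2_def R_def C_def restrict_id_def)
    show "\<pi> ((g2 ^^ i) y0) = (g2 ^^ i) y0" if "\<pi> \<in> insert g1 R" for \<pi> i
      unfolding g2y using that iny[of i] disj by (auto simp: g1_def R_def C_def restrict_id_def)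
  qed
  then obtain Q where Q: "is_vertex (sym_group n) (specht :: ('f, nat \<Rightarrow> nat, tabl \<Rightarrow> 'f) fg) Q"
    "g1 \<circ> g2 \<in> Q" "g2 \<in> Q" "R \<subseteq> Q" by auto
  have sQ: "subgroup Q (sym_group n)" using Q(1) by (simp add: is_vertex_def)
  have mQ: "a \<circ> b \<in> Q" if "a \<in> Q" "b \<in> Q" for a b
    using subgroup.m_closed[OF sQ that] by (simp add: sym_group_mult)
  have "g1 \<in> Q"
  proof -
    have "g2 \<circ> g2 ^^ (p - 1) = g2 ^^ Suc (p - 1)" by simp
    also have "\<dots> = id" using restrict_order[OF orb_stable e2(1)] p1 by (simp add: g2_def)
    finally have "g1 \<circ> g2 \<circ> g2 ^^ (p - 1) = g1" by (simp only: comp_assoc comp_id)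
    then show ?thesis using mQ[OF Q(2) sym_subgroup_funpow[OF sQ Q(3), of "p - 1"]] by simp
  qed
  have "e \<in> Q" if e: "e \<in> E" for e
  proof -
    obtain a b where ab: "restrict_id e (orb x0) = g1 ^^ a" "restrict_id e (orb y0) = g2 ^^ b"
      using restrict_orb_prime[OF x(2) e1 e] restrict_orb_prime[OF y(2) e2 e] by (auto simp: g1_def g2_def)
    have "restrict_id e C \<in> Q" using Q(4) e by (auto simp: R_def)
    moreover have "restrict_id e (orb x0) \<in> Q" "restrict_id e (orb y0) \<in> Q"
      unfolding ab using sym_subgroup_funpow[OF sQ] \<open>g1 \<in> Q\<close> Q(3) by auto
    ultimately have "restrict_id e C \<circ> (restrict_id e (orb x0) \<circ> restrict_id e (orb y0)) \<in> Q"
      by (intro mQ)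
    also have "restrict_id e C \<circ> (restrict_id e (orb x0) \<circ> restrict_id e (orb y0)) = e"
    proof
      fix t
      have "e t \<in> orb x0 \<longleftrightarrow> t \<in> orb x0" "e t \<in> orb y0 \<longleftrightarrow> t \<in> orb y0"
        using orb_stable e by (auto simp: stable_def)
      then show "(restrict_id e C \<circ> (restrict_id e (orb x0) \<circ> restrict_id e (orb y0))) t = e t"
        using disj by (auto simp: restrict_id_def C_def)
    qed
    finally show ?thesis .
  qed
  then show ?thesis using Q(1) unfolding lam_def by blast
qed

text \<open>
  An element \<open>e1\<close> of \<open>E\<close> that moves \<open>x0\<close> and an element \<open>e2\<close> that moves \<open>x0\<close> out of its \<open>e1\<close>-orbit generate
  a regular action on an orbit of size \<open>p\<^sup>2\<close>. The divisibility of \<open>n\<close> by \<open>p\<close> enters through the number of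
  points fixed by \<open>E\<close>, which must be divisible by \<open>p\<close> for the permutation \<open>q\<close> to exist.
\<close>

lemma square_orbit:
  assumes odd: "odd p" and ch: "CHAR('f::field) = p" and "p dvd n"
    and x: "x0 \<in> {1..n}" "card (orb x0) = p ^ 2"
  shows "\<exists>Q. is_vertex (sym_group n)
    (specht_module ((n - p) # replicate p 1) :: ('f, nat \<Rightarrow> nat, tabl \<Rightarrow> 'f) fg) Q \<and> E \<subseteq> Q"
proof -
  have p1: "1 < p" by (rule prime_gt_1_nat[OF prime])
  then have p2: "p < p ^ 2" by (simp add: power2_eq_square)
  define Om where "Om = orb x0"
  have On: "Om \<subseteq> {1..n}" unfolding Om_def by (rule orb_subset[OF x(1)])
  have "card Om \<le> card {1..n}" using On by (intro card_mono) auto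
  then have "p < n" using x(2) p2 by (simp add: Om_def)
  interpret hook n p using \<open>p < n\<close> p1 by unfold_locales auto
  have stO: "stable Om" unfolding Om_def by (rule orb_stable)
  have finO: "finite Om" using On finite_subset by blast
  have xO: "x0 \<in> Om" unfolding Om_def by (rule orb_self)
  have "1 < card (orb x0)" using x(2) p1 p2 by linarith
  then obtain e1 where e1: "e1 \<in> E" "e1 x0 \<noteq> x0" using orb_moved[of x0] by blast
  define C where "C = (\<lambda>i. (e1 ^^ i) x0) ` {..<p}"
  have inj1: "inj_on (\<lambda>i. (e1 ^^ i) x0) {..<p}"
    by (rule prime_cycle_inj[OF prime]) (simp_all add: order e1)
  have C_all: "(e1 ^^ i) x0 \<in> C" for i
  proof -
    have "(e1 ^^ (i mod p)) x0 = (e1 ^^ i) x0"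
      by (rule periodic_mod) (simp add: funpow_add order e1(1))
    then show ?thesis using p1 unfolding C_def by (intro image_eqI[of _ _ "i mod p"]) auto
  qed
  have "\<not> Om \<subseteq> C"
  proof
    assume "Om \<subseteq> C"
    then have "card Om \<le> card C" by (intro card_mono) (auto simp: C_def)
    also have "\<dots> \<le> p" unfolding C_def using card_image_le[of "{..<p}"] by auto
    finally show False using x(2) p2 by (simp add: Om_def)
  qed
  then obtain e2 where e2: "e2 \<in> E" "e2 x0 \<notin> C" by (auto simp: Om_def orb_def)
  define pt where "pt i j = (e1 ^^ i) ((e2 ^^ j) x0)" for i j
  have comm12: "(e1 ^^ i) ((e2 ^^ j) y) = (e2 ^^ j) ((e1 ^^ i) y)" for i j y
    by (rule comm_apply[OF pow_in[OF e1(1)] pow_in[OF e2(1)]])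
  have per1: "(e1 ^^ i) ((e1 ^^ k) y) = (e1 ^^ (i + k)) y" for i k y by (simp add: funpow_add)
  have per2: "(e2 ^^ i) ((e2 ^^ k) y) = (e2 ^^ (i + k)) y" for i k y by (simp add: funpow_add)
  have o1: "(e1 ^^ p) y = y" and o2: "(e2 ^^ p) y = y" for y using order e1 e2 by simp_all
  \<comment> \<open>Otherwise \<open>e2 x0\<close>, a power of \<open>e2 ^^ m\<close> applied to \<open>x0\<close>, would lie in \<open>C\<close> too.\<close>
  have not_C: "(e2 ^^ m) x0 \<notin> C" if m: "0 < m" "m < p" for m
  proof
    assume "(e2 ^^ m) x0 \<in> C"
    then obtain l where l: "(e2 ^^ m) x0 = (e1 ^^ l) x0" by (auto simp: C_def)
    have mk: "(e2 ^^ (m * k)) x0 = (e1 ^^ (l * k)) x0" for k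
    proof (induction k)
      case (Suc k)
      have "(e2 ^^ (m * Suc k)) x0 = (e2 ^^ (m * k)) ((e2 ^^ m) x0)" by (simp add: per2 add.commute)
      also have "\<dots> = (e1 ^^ l) ((e2 ^^ (m * k)) x0)" by (simp only: l comm12)
      also have "\<dots> = (e1 ^^ (l * Suc k)) x0" by (simp add: Suc per1)
      finally show ?case .
    qed simp
    have "coprime m p"
      using prime_imp_coprime[OF prime, of m] m by (simp add: coprime_commute nat_dvd_not_less)
    then obtain k q where kq: "m * k = p * q + 1"
      using bezout_nat[of m p] m by (metis coprime_imp_gcd_eq_1 less_numeral_extra(3))
    have "(e2 ^^ (p * q)) y = y" for y by (rule funpow_mult_fixed[OF o2])
    then have "(e2 ^^ (m * k)) x0 = e2 x0" by (simp add: kq)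
    then show False using mk[of k] C_all e2(2) by metis
  qed
  have le: "i = i' \<and> j = j'" if eq: "pt i j = pt i' j'" and lt: "i < p" "i' < p" "j < p" "j' < p" and "j \<le> j'" for i i' j j'
  proof -
    have "(e2 ^^ (p - j)) (pt i j) = (e1 ^^ i) x0"
      using lt by (simp add: pt_def comm12[symmetric] per2 o2)
    moreover have "(e2 ^^ (p - j)) (pt i' j') = (e1 ^^ i') ((e2 ^^ (j' - j)) x0)"
    proof -
      have "p - j + j' = (j' - j) + p" using \<open>j \<le> j'\<close> lt by simp
      then have "(e2 ^^ (p - j)) ((e2 ^^ j') x0) = (e2 ^^ (j' - j)) ((e2 ^^ p) x0)" by (simp only: per2)
      then show ?thesis by (simp only: pt_def comm12[symmetric] o2)
    qed
    ultimately have 1: "(e1 ^^ i) x0 = (e1 ^^ i') ((e2 ^^ (j' - j)) x0)" using eq by simp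
    then have "(e1 ^^ (p - i')) ((e1 ^^ i) x0) = (e1 ^^ (p - i' + i')) ((e2 ^^ (j' - j)) x0)"
      by (simp only: per1)
    then have "(e2 ^^ (j' - j)) x0 = (e1 ^^ (p - i' + i)) x0" using lt by (simp add: per1 o1)
    then have "(e2 ^^ (j' - j)) x0 \<in> C" using C_all by metis
    moreover have "0 < j' - j" "j' - j < p" if "j \<noteq> j'" using that \<open>j \<le> j'\<close> lt by auto
    ultimately have "j = j'" using not_C[of "j' - j"] by blast
    then show ?thesis using 1 inj1 lt by (auto simp: inj_on_def)
  qed
  have inj: "inj_on (\<lambda>(i, j). pt i j) ({..<p} \<times> {..<p})"
  proof (rule inj_onI)
    fix a b assume "a \<in> {..<p} \<times> {..<p}" "b \<in> {..<p} \<times> {..<p}"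
      and eq: "(case a of (i, j) \<Rightarrow> pt i j) = (case b of (i, j) \<Rightarrow> pt i j)"
    then obtain i j i' j' where ab: "a = (i, j)" "b = (i', j')" and lt: "i < p" "j < p" "i' < p" "j' < p"
      by auto
    have "pt i j = pt i' j'" using eq ab by simp
    then have "i = i' \<and> j = j'" using le[of i j i' j'] le[of i' j' i j] lt by (cases "j \<le> j'") auto
    then show "a = b" using ab by simp
  qed
  have ptO: "pt i j \<in> Om" for i j
    using stO pow_in[OF e1(1)] pow_in[OF e2(1)] xO by (simp add: pt_def stable_def)
  have Om_eq: "Om = (\<lambda>(i, j). pt i j) ` ({..<p} \<times> {..<p})"
  proof (rule sym, rule card_subset_eq[OF finO])
    show "(\<lambda>(i, j). pt i j) ` ({..<p} \<times> {..<p}) \<subseteq> Om" using ptO by auto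
    show "card ((\<lambda>(i, j). pt i j) ` ({..<p} \<times> {..<p})) = card Om"
      using card_image[OF inj] x(2) by (simp add: Om_def power2_eq_square)
  qed
  \<comment> \<open>Counting \<open>{1..n}\<close> in the field: only the fixed points of \<open>E\<close> contribute.\<close>
  define Fx where "Fx = {y \<in> {1..n}. \<forall>e\<in>E. e y = y}"
  have "(\<Sum>y\<in>{1..n}. 1 :: 'f) = (\<Sum>y\<in>{y \<in> {1..n}. \<forall>e\<in>E. e y = y}. 1)"
  proof (rule sum_commuting_invariant[OF prime ch])
    show "finite E" by (rule finite_subset[OF _ finite_permutations[of "{1..n}"]]) (use perm in auto)
  qed (use permutes_in_image[OF perm] order comm_apply in auto)
  then have "of_nat (card Fx) = (of_nat n :: 'f)" by (simp add: Fx_def)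
  also have "\<dots> = 0" using \<open>p dvd n\<close> ch by (simp add: of_nat_eq_0_iff_char_dvd)
  finally have "p dvd card Fx" using ch by (simp add: of_nat_eq_0_iff_char_dvd)
  moreover have "finite Fx" by (simp add: Fx_def)
  ultimately obtain q where q: "q permutes Fx" "q ^^ p = id" "\<And>y. y \<in> Fx \<Longrightarrow> q y \<noteq> y"
    using ex_free_permutation[of Fx p] p1 by blast
  have qn: "q permutes {1..n}" by (rule permutes_subset[OF q(1)]) (auto simp: Fx_def)
  have q_comm: "q \<circ> restrict_id e A = restrict_id e A \<circ> q" if e: "e \<in> E" for e A
  proof
    fix y
    show "(q \<circ> restrict_id e A) y = (restrict_id e A \<circ> q) y"
    proof (cases "y \<in> Fx")
      case True
      then have "q y \<in> Fx" using permutes_in_image[OF q(1)] by simp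
      then have "e y = y" "e (q y) = q y" using True e by (simp_all add: Fx_def)
      then show ?thesis by (simp add: restrict_id_def)
    next
      case False
      have "e y \<notin> Fx"
      proof
        assume F: "e y \<in> Fx"
        then have "(e ^^ (p - 1)) (e y) = e y" using pow_in[OF e] by (simp add: Fx_def)
        then have "e y = y" using pow_minus[OF e] by simp
        then show False using F False by simp
      qed
      then show ?thesis using False permutes_not_in[OF q(1)] by (simp add: restrict_id_def)
    qed
  qed
  have qO: "q y = y" if "y \<in> Om" for y
  proof -
    have "y \<notin> Fx"
    proof
      assume F: "y \<in> Fx"
      obtain e where e: "e \<in> E" "y = e x0" using \<open>y \<in> Om\<close> by (auto simp: Om_def orb_def)
      have "(e ^^ (p - 1)) y = y" using F pow_in[OF e(1)] by (simp add: Fx_def)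
      then have "x0 = y" using pow_minus[OF e(1), of x0] e(2) by simp
      then show False using F e1 by (auto simp: Fx_def)
    qed
    then show ?thesis by (rule permutes_not_in[OF q(1)])
  qed
  define c where "c = restrict_id e1 Om"
  define d where "d = restrict_id e2 Om"
  define R0 where "R0 = (\<lambda>e. restrict_id e (- Om)) ` E"
  have rep: "\<exists>e A. e \<in> E \<and> stable A \<and> \<pi> = restrict_id e A" if "\<pi> \<in> {c, d} \<union> R0" for \<pi>
    using that e1 e2 stO stable_Compl[OF stO] by (auto simp: c_def d_def R0_def)
  have pt_eq: "(c ^^ i) ((d ^^ j) x0) = pt i j" for i j
  proof -
    have "(e2 ^^ j) x0 \<in> Om" using ptO[of 0 j] by (simp add: pt_def)
    then show ?thesis using xO by (simp add: c_def d_def restrict_funpow[OF stO] e1 e2 pt_def)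
  qed
  have "\<exists>Q. is_vertex (sym_group n) (specht :: ('f, nat \<Rightarrow> nat, tabl \<Rightarrow> 'f) fg) Q \<and> {c, d} \<union> insert q R0 \<subseteq> Q"
  proof (rule vertex_square_orbit[OF prime odd ch, where ?x0.0 = x0])
    show "\<pi> permutes {1..n}" if "\<pi> \<in> {c, d} \<union> insert q R0" for \<pi>
      using that rep[of \<pi>] restrict_permutes qn by blast
    show "\<pi> ^^ p = id" if "\<pi> \<in> {c, d} \<union> insert q R0" for \<pi>
      using that rep[of \<pi>] restrict_order q(2) by blast
    show "\<pi> \<circ> \<rho> = \<rho> \<circ> \<pi>" if \<pi>: "\<pi> \<in> {c, d} \<union> insert q R0" and \<rho>: "\<rho> \<in> {c, d} \<union> insert q R0" for \<pi> \<rho>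
    proof (cases "\<pi> = q")
      case True
      then show ?thesis using rep[of \<rho>] q_comm \<rho> by (cases "\<rho> = q") auto
    next
      case False
      then have *: "\<pi> \<in> {c, d} \<union> R0" using \<pi> by blast
      show ?thesis
      proof (cases "\<rho> = q")
        case True
        obtain e A where "e \<in> E" "\<pi> = restrict_id e A" using rep[OF *] by blast
        then show ?thesis using q_comm[of e A] True by simp
      next
        case False
        then have "\<rho> \<in> {c, d} \<union> R0" using \<rho> by blast
        then show ?thesis using rep[OF *] rep[of \<rho>] restrict_comm by blast
      qed
    qed
    show "x0 \<in> {1..n}" by (rule x(1))
    show "inj_on (\<lambda>(i, j). (c ^^ i) ((d ^^ j) x0)) ({..<p} \<times> {..<p})" unfolding pt_eq by (rule inj)
    show "\<rho> ((c ^^ i) ((d ^^ j) x0)) = (c ^^ i) ((d ^^ j) x0)" if "\<rho> \<in> insert q R0" for \<rho> i j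
      unfolding pt_eq using that ptO[of i j] qO by (auto simp: R0_def restrict_id_def)
    show "\<exists>\<rho>\<in>insert q R0. \<rho> y \<noteq> y"
      if y: "y \<in> {1..n}" "y \<notin> (\<lambda>(i, j). (c ^^ i) ((d ^^ j) x0)) ` ({..<p} \<times> {..<p})" for y
    proof (cases "y \<in> Fx")
      case True
      then show ?thesis using q(3) by blast
    next
      case False
      then obtain e where e: "e \<in> E" "e y \<noteq> y" using y(1) by (auto simp: Fx_def)
      have "y \<notin> Om" using y(2) unfolding pt_eq Om_eq .
      then have "restrict_id e (- Om) y \<noteq> y" using e(2) by simp
      then show ?thesis using e(1) by (auto simp: R0_def)
    qed
  qed
  then obtain Q where Q: "is_vertex (sym_group n) (specht :: ('f, nat \<Rightarrow> nat, tabl \<Rightarrow> 'f) fg) Q"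
    "c \<in> Q" "d \<in> Q" "R0 \<subseteq> Q" by auto
  have sQ: "subgroup Q (sym_group n)" using Q(1) by (simp add: is_vertex_def)
  have mQ: "a \<circ> b \<in> Q" if "a \<in> Q" "b \<in> Q" for a b
    using subgroup.m_closed[OF sQ that] by (simp add: sym_group_mult)
  have "e \<in> Q" if e: "e \<in> E" for e
  proof -
    have "e x0 \<in> Om" using e by (auto simp: Om_def orb_def)
    then obtain i j where ij: "e x0 = pt i j" unfolding Om_eq by auto
    have "e = restrict_id e (- Om) \<circ> (c ^^ i \<circ> d ^^ j)"
    proof
      fix y
      show "e y = (restrict_id e (- Om) \<circ> (c ^^ i \<circ> d ^^ j)) y"
      proof (cases "y \<in> Om")
        case True
        then obtain f where f: "f \<in> E" "y = f x0" by (auto simp: Om_def orb_def)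
        have "e y = f (pt i j)" using comm_apply[OF e f(1), of x0] f(2) ij by simp
        also have "\<dots> = (e1 ^^ i) ((e2 ^^ j) y)"
          using comm_apply[OF f(1) pow_in[OF e1(1)]] comm_apply[OF f(1) pow_in[OF e2(1)]] f(2) by (simp add: pt_def)
        finally have ey: "e y = (e1 ^^ i) ((e2 ^^ j) y)" .
        have "(e2 ^^ j) y \<in> Om" "e y \<in> Om" using True stO e pow_in[OF e2(1)] by (auto simp: stable_def)
        then show ?thesis using True ey
          by (simp add: c_def d_def restrict_funpow[OF stO] e1 e2)
      next
        case False
        then show ?thesis by (simp add: c_def d_def restrict_funpow[OF stO] e1 e2)
      qed
    qed
    moreover have "restrict_id e (- Om) \<in> Q" using Q(4) e by (auto simp: R0_def)
    ultimately show ?thesis using mQ sym_subgroup_funpow[OF sQ] Q(2,3) by metis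
  qed
  then show ?thesis using Q(1) unfolding lam_def by blast
qed

end

theorem theorem1p3:
  fixes p k :: nat and E :: "(nat \<Rightarrow> nat) set"
  assumes "prime p" and "odd p"
    and "CHAR('f::alg_closed_field) = p"
    and "elementary_abelian_subgroup p E (sym_group (k * p))"
    and "card {X \<in> point_orbits (k * p) E. card X = p} \<ge> 2 \<or>
         (\<exists>X \<in> point_orbits (k * p) E. card X = p ^ 2)"
  shows "\<exists>Q. is_vertex (sym_group (k * p))
               (specht_module ((k * p - p) # replicate p 1) :: ('f, nat \<Rightarrow> nat, tabl \<Rightarrow> 'f) fg) Q \<and>
             E \<subseteq> Q"
proof -
  interpret elementary_abelian p "k * p" E
    using assms(1,4) by unfold_locales
  show ?thesis
    using assms(5)
  proof
    assume "card {X \<in> point_orbits (k * p) E. card X = p} \<ge> 2"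
    then obtain B where "B \<subseteq> {X \<in> point_orbits (k * p) E. card X = p}" "card B = 2"
      by (rule obtain_subset_with_card_n)
    moreover from \<open>card B = 2\<close> obtain X Y where "B = {X, Y}" "X \<noteq> Y" by (meson card_2_iff)
    ultimately have X: "X \<in> orb ` {1..k * p}" "card X = p" and Y: "Y \<in> orb ` {1..k * p}" "card Y = p"
      unfolding point_orbits_eq by blast+
    obtain x0 where x0: "x0 \<in> {1..k * p}" "X = orb x0" using X(1) by blast
    obtain y0 where y0: "y0 \<in> {1..k * p}" "Y = orb y0" using Y(1) by blast
    have "orb x0 \<noteq> orb y0" "card (orb x0) = p" "card (orb y0) = p"
      using X(2) Y(2) x0(2) y0(2) \<open>X \<noteq> Y\<close> by simp_all
    then show ?thesis using x0(1) y0(1) by (intro two_prime_orbits[OF assms(2,3)])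
  next
    assume "\<exists>X \<in> point_orbits (k * p) E. card X = p ^ 2"
    then obtain x0 where "x0 \<in> {1..k * p}" "card (orb x0) = p ^ 2" unfolding point_orbits_eq by blast
    then show ?thesis by (intro square_orbit[OF assms(2,3)]) simp_all
  qed
qed

end
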